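(* Let $n\ge 1$ and let $f\in C^\infty(n,n)$ be an $n$-Morin singularity, with $\lambda$ the determinant of its Jacobi matrix and $\eta$ a null vector field. (a) If $n=1$, then $f$ is $\mathcal{A}$-isotopic to $f^1_{\varepsilon_1}$, where $\varepsilon_1=\operatorname{sgn}(\eta^2f(0))$ (i.e. the sign of $f''(0)$); the two germs $f^1_{1},f^1_{-1}$ are not $\mathcal{A}$-isotopic. (b) If $n=4l$ with $l\ge1$, then $f$ is $\mathcal{A}$-isotopic to $f^n_{(\varepsilon_1,\varepsilon_2)}$, where $\varepsilon_1,\varepsilon_2\in\{\pm1\}$ are determined by $\operatorname{sgn}(\eta^{n}\lambda(0))=\varepsilon_1\varepsilon_2$ and $\operatorname{sgn}\det(\operatorname{grad}\lambda,\operatorname{grad}\eta\lambda,\dots,\operatorname{grad}\eta^{n-1}\lambda)(0)=-\varepsilon_2$; the four germs $f^n_{(\pm1,\pm1)}$ are pairwise not $\mathcal{A}$-isotopic. (c) If $n=4l+1$ with $l\ge1$, then $f$ is $\mathcal{A}$-isotopic to $f^n_{(\varepsilon_1,1)}$, where $\varepsilon_1=\operatorname{sgn}\det(\operatorname{grad}\lambda,\dots,\operatorname{grad}\eta^{n-1}\lambda)(0)$; the two germs $f^n_{(1,1)},f^n_{(-1,1)}$ are not $\mathcal{A}$-isotopic. (d) If $n=4l+2$ with $l\ge0$, then $f$ is $\mathcal{A}$-isotopic to $f^n_{(\varepsilon_1,1)}$, where $\varepsilon_1=\operatorname{sgn}(\eta^{n}\lambda(0))$; the two germs $f^n_{(1,1)},f^n_{(-1,1)}$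 are not $\mathcal{A}$-isotopic. (e) If $n=4l+3$ with $l\ge0$, then $f$ is $\mathcal{A}$-isotopic to $f^n_{(1,\varepsilon_2)}$, where $\varepsilon_2=\operatorname{sgn}\big(\eta^n\lambda\cdot\det(\operatorname{grad}\lambda,\dots,\operatorname{grad}\eta^{n-1}\lambda)\big)(0)$; the two germs $f^n_{(1,1)},f^n_{(1,-1)}$ are not $\mathcal{A}$-isotopic.
   Context: All germs are $C^\infty$, and $C^\infty(m,n)$ denotes the set of map-germs $(\mathbb{R}^m,0)\to(\mathbb{R}^n,0)$. Two germs are $\mathcal{A}$-equivalent if $g=\tau\circ f\circ\sigma$ for diffeomorphism-germs $\sigma,\tau$ of source and target at $0$. A germ $f$ is $r$-determined if every germ with the same $r$-jet at $0$ is $\mathcal{A}$-equivalent to $f$. Let $f,g\in C^\infty(m,n)$ be $\mathcal{A}$-equivalent and $r$-determined. They are $\mathcal{A}$-isotopic if there exist continuous curves $\sigma:[0,1]\to \mathrm{Diff}^r(m)$ and $\tau:[0,1]\to\mathrm{Diff}^r(n)$ with $\sigma(0),\tau(0)$ the identity and $j^rg(0)=j^r(\tau(1)\circ f\circ\sigma(1))(0)$, where $\mathrm{Diff}^r(m)$ is the space of $r$-jets at $0$ of diffeomorphism-germs of $(\mathbb{R}^m,0)$. Equivalently, there are orientation-preserving diffeomorphism-germs $\sigma^+$, $\tau^+$ of source and target with $j^rg(0)=j^r(\tau^+\circ f\circ\sigma^+)(0)$. For $1\le k\le n$, a germ $f\in C^\infty(n,n)$ is a $k$-Morin singularity if it is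 $\mathcal{A}$-equivalent to $(x_1,\dots,x_n)\mapsto(x_1x_2+x_1^2x_3+\cdots+x_1^{k-1}x_k+x_1^{k+1},\,x_2,\dots,x_n)$ (for $k=1$: $(x_1^2,x_2,\dots,x_n)$). A $k$-Morin singularity is $(k+1)$-determined. For $2\le k\le n$ and $\varepsilon_1,\varepsilon_2\in\{\pm1\}$ put $$f^k_{(\varepsilon_1,\varepsilon_2)}(x)=\big(\varepsilon_1(\varepsilon_2x_2x_1+x_3x_1^2+\cdots+x_kx_1^{k-1}+x_1^{k+1}),\ \varepsilon_2x_2,\ x_3,\dots,x_n\big),$$ and $f^1_{\varepsilon_1}(x)=(\varepsilon_1x_1^2,x_2,\dots,x_n)$. For a Morin singularity $f$, $\lambda$ is the determinant of the Jacobi matrix of $f$ (then $d\lambda(0)\ne0$), and a null vector field $\eta$ is a nowhere vanishing vector field near $0$ in the source with $\eta(p)\in\ker df(p)$ for every $p$ in the singular set $\{\lambda=0\}$. $\eta^j\lambda$ is the $j$-fold directional derivative of $\lambda$ along $\eta$, and $\operatorname{grad}h$ is the column vector of first partial derivatives of $h$. The signs in the claim do not depend on the choice of $\eta$. *)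

theory Defs
  imports "HOL-Analysis.Analysis"
begin

section \<open>Smooth germs and jets\<close>

text \<open>A germ at the origin is represented by any total function having it as its germ; all notions
  below depend on the values near the origin only.\<close>

primrec partials :: "'m::finite list \<Rightarrow> (real^'m \<Rightarrow> real^'n) \<Rightarrow> real^'m \<Rightarrow> real^'n" where
  "partials [] f = f"
| "partials (i # is) f = (\<lambda>x. frechet_derivative (partials is f) (at x) (axis i 1))"

text \<open>For open \<open>S\<close> this is \<open>C\<^sup>\<infinity>\<close>: differentiability of all iterated partial derivatives entails their
  existence and continuity.\<close>

definition smooth_on :: "(real^'m::finite) set \<Rightarrow> (real^'m \<Rightarrow> real^'n) \<Rightarrow> bool" where
  "smooth_on S f \<longleftrightarrow> (\<forall>is. \<forall>x\<in>S. partials is f differentiable (at x))"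

definition map_germ :: "(real^'m::finite \<Rightarrow> real^'n) \<Rightarrow> bool" where
  "map_germ f \<longleftrightarrow> f 0 = 0 \<and> (\<exists>U. open U \<and> 0 \<in> U \<and> smooth_on U f)"

definition diffeo_germ :: "(real^'m::finite \<Rightarrow> real^'m) \<Rightarrow> bool" where
  "diffeo_germ s \<longleftrightarrow> s 0 = 0 \<and>
     (\<exists>U V t. open U \<and> open V \<and> 0 \<in> U \<and> homeomorphism U V s t \<and> smooth_on U s \<and> smooth_on V t)"

definition A_equivalent :: "(real^'m::finite \<Rightarrow> real^'n::finite) \<Rightarrow> (real^'m \<Rightarrow> real^'n) \<Rightarrow> bool" where
  "A_equivalent f g \<longleftrightarrow>
     (\<exists>s t. diffeo_germ s \<and> diffeo_germ t \<and> (\<forall>\<^sub>F x in nhds 0. g x = t (f (s x))))"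

text \<open>The \<open>r\<close>-jet at the origin is recorded by the partial derivatives of order at most \<open>r\<close>, padded
  with zeros. The product topology on the function space \<open>'m list \<Rightarrow> real^'n\<close> then induces the usual
  topology on the finite-dimensional space of \<open>r\<close>-jets.\<close>

definition jet :: "nat \<Rightarrow> (real^'m::finite \<Rightarrow> real^'n) \<Rightarrow> 'm list \<Rightarrow> real^'n" where
  "jet r f = (\<lambda>is. if length is \<le> r then partials is f 0 else 0)"

definition Diff_jets :: "nat \<Rightarrow> ('m::finite list \<Rightarrow> real^'m) set" where
  "Diff_jets r = {jet r s | s. diffeo_germ s}"

text \<open>\<open>\<A>\<close>-isotopy of \<open>\<A>\<close>-equivalent, \<open>r\<close>-determined germs. These standing assumptions on \<open>f\<close> and \<open>g\<close>
  are not part of the relation itself. The jet of \<open>t \<circ> f \<circ> s\<close> does not depend on the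
  representatives \<open>s\<close>, \<open>t\<close> of the end points of the two curves.\<close>

definition A_isotopic :: "nat \<Rightarrow> (real^'m::finite \<Rightarrow> real^'n::finite) \<Rightarrow> (real^'m \<Rightarrow> real^'n) \<Rightarrow> bool" where
  "A_isotopic r f g \<longleftrightarrow>
     (\<exists>(\<sigma> :: real \<Rightarrow> 'm list \<Rightarrow> real^'m) (\<tau> :: real \<Rightarrow> 'n list \<Rightarrow> real^'n) s t.
        continuous_on {0..1} \<sigma> \<and> \<sigma> ` {0..1} \<subseteq> Diff_jets r \<and> \<sigma> 0 = jet r id \<and>
        continuous_on {0..1} \<tau> \<and> \<tau> ` {0..1} \<subseteq> Diff_jets r \<and> \<tau> 0 = jet r id \<and>
        diffeo_germ s \<and> \<sigma> 1 = jet r s \<and> diffeo_germ t \<and> \<tau> 1 = jet r t \<and>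
        jet r g = jet r (t \<circ> f \<circ> s))"

section \<open>Morin singularities\<close>

text \<open>The coordinates of \<open>real^'n\<close> are numbered \<open>1, \<dots>, CARD('n)\<close> along the linear order of the index
  type.\<close>

definition pos :: "'n::{finite,linorder} \<Rightarrow> nat" where
  "pos i = card {j. j \<le> i}"

definition coord :: "nat \<Rightarrow> 'n::{finite,linorder}" where
  "coord k = (THE i. pos i = k)"

text \<open>For \<open>k = 1\<close> the first component is \<open>x\<^sub>1\<^sup>2\<close>.\<close>

definition morin_map :: "nat \<Rightarrow> real^'n::{finite,linorder} \<Rightarrow> real^'n::{finite,linorder}" where
  "morin_map k x = (\<chi> i. if pos i = 1
     then (\<Sum>j=2..k. x $ coord 1 ^ (j - 1) * x $ coord j) + x $ coord 1 ^ (k + 1)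
     else x $ i)"

definition Morin_singularity :: "nat \<Rightarrow> (real^'n::{finite,linorder} \<Rightarrow> real^'n::{finite,linorder}) \<Rightarrow> bool" where
  "Morin_singularity k f \<longleftrightarrow>
     1 \<le> k \<and> k \<le> CARD('n) \<and> map_germ f \<and> A_equivalent f (morin_map k)"

text \<open>The germs \<open>f\<^sup>k\<close> with signs \<open>\<epsilon>\<^sub>1, \<epsilon>\<^sub>2\<close> for \<open>k \<ge> 2\<close>, and the germ \<open>f\<^sup>1\<close> with sign \<open>\<epsilon>\<^sub>1\<close>.\<close>

definition morin_sgn :: "nat \<Rightarrow> real \<Rightarrow> real \<Rightarrow> real^'n::{finite,linorder} \<Rightarrow> real^'n::{finite,linorder}" where
  "morin_sgn k \<epsilon>1 \<epsilon>2 x = (\<chi> i.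
     if pos i = 1 then
       \<epsilon>1 * (\<epsilon>2 * x $ coord 2 * x $ coord 1
            + (\<Sum>j=3..k. x $ coord j * x $ coord 1 ^ (j - 1)) + x $ coord 1 ^ (k + 1))
     else if pos i = 2 then \<epsilon>2 * x $ i
     else x $ i)"

definition fold_sgn :: "real \<Rightarrow> real^'n::{finite,linorder} \<Rightarrow> real^'n::{finite,linorder}" where
  "fold_sgn \<epsilon>1 x = (\<chi> i. if pos i = 1 then \<epsilon>1 * (x $ i)\<^sup>2 else x $ i)"

definition jac_det :: "(real^'n::finite \<Rightarrow> real^'n) \<Rightarrow> real^'n \<Rightarrow> real" where
  "jac_det f x = det (jacobian f (at x))"

definition null_vector_field :: "(real^'n::finite \<Rightarrow> real^'n) \<Rightarrow> (real^'n \<Rightarrow> real^'n) \<Rightarrow> bool" where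
  "null_vector_field f \<eta> \<longleftrightarrow>
     (\<exists>U. open U \<and> 0 \<in> U \<and> smooth_on U \<eta> \<and> (\<forall>p\<in>U. \<eta> p \<noteq> 0) \<and>
        (\<forall>p\<in>U. jac_det f p = 0 \<longrightarrow> frechet_derivative f (at p) (\<eta> p) = 0))"

definition along :: "(real^'n::finite \<Rightarrow> real^'n) \<Rightarrow> (real^'n \<Rightarrow> 'b::real_normed_vector) \<Rightarrow> real^'n \<Rightarrow> 'b" where
  "along \<eta> h = (\<lambda>x. frechet_derivative h (at x) (\<eta> x))"

definition grad :: "(real^'n::finite \<Rightarrow> real) \<Rightarrow> real^'n \<Rightarrow> real^'n" where
  "grad h x = (\<chi> i. frechet_derivative h (at x) (axis i 1))"

text \<open>The determinant of the matrix with columns \<open>grad \<lambda>, grad \<eta>\<lambda>, \<dots>, grad \<eta>\<^sup>n\<^sup>-\<^sup>1\<lambda>\<close> at \<open>x\<close>.\<close>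

definition grad_det ::
  "(real^'n::{finite,linorder} \<Rightarrow> real^'n::{finite,linorder}) \<Rightarrow> (real^'n::{finite,linorder} \<Rightarrow> real) \<Rightarrow> real^'n::{finite,linorder} \<Rightarrow> real" where
  "grad_det \<eta> h x = det (\<chi> i j. grad ((along \<eta> ^^ (pos j - 1)) h) x $ i)"

end

(*
  Write a Morin germ as f = T o M o S near 0, where M is the normal form and S, T are diffeomorphism
  germs. A diffeomorphism germ s with positive Jacobian determinant is joined to the identity in the
  space of jets (rescale s(tx)/t to its linear part, then use connectedness of GL+(n)), so the isotopy
  class of f depends only on the signs sigma, tau of det S'(0), det T'(0); the symmetry of M under the
  weighted scaling by -1 identifies some of these sign pairs, depending on n mod 4.

  For the invariants let p_k be the k-th x_1-derivative of the first component of M, composed with S,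
  so that lambda is a unit u times p_1, and let a = eta(S_1). Modulo functions vanishing on
  {lambda = 0} and functions of high order at 0, differentiation along eta maps p_k to a p_(k+1), and
  it preserves this ideal modulo p_2. Hence eta^k lambda = u a^k p_(k+1) plus a combination of
  p_1, ..., p_k up to the ideal, which gives eta^n lambda(0) and the determinant of gradients in terms
  of sigma, tau and the sign of a(0). Allowing the terms of high order makes the computation apply to
  fields that are null only up to order n; this is what shows that the invariants depend on the jet.
*)
theory Submission
  imports Defs
begin

section \<open>Smooth scalar functions\<close>

text \<open>A null field is only required to annihilate df on the set {\<lambda> = 0}. Instead of
  dividing df(\<eta>) by \<lambda>, the computation uses that a smooth function vanishing on {p_1 =
  0} has gradient c grad p_1 there, with c smooth. Isotopy compares jets, so a proof that two germs
  are not isotopic starts from g and t \<circ> f \<circ> s agreeing to order r only. A null field of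
  one is null for the other modulo order n, and n is just enough: each derivative along \<eta> costs
  one order, the value of \<eta>^n \<lambda> at 0 needs order 1 to be left over, and the gradient of
  \<eta>^(n-1) \<lambda> needs order 2. The sign \<beta> of a(0) is no invariant, since -\<eta> is a
  null field too. It enters the two quantities as \<beta>^n and \<beta>^(n(n-1)/2), and the
  invariants are the combinations from which it cancels. The determinant signs of the symmetry have
  the exponents n(n+1)/2 in the source and n(n+1)/2 + n in the target, the sums of its weights. All
  these parities have period 4 in n.\<close>

definition pdv :: "'m::finite \<Rightarrow> (real^'m \<Rightarrow> real) \<Rightarrow> real^'m \<Rightarrow> real" where
  "pdv i h x = frechet_derivative h (at x) (axis i 1)"

text \<open>Differentiability of the partial derivatives of order below k. The recursion takes off
  the derivative applied to h directly, so the product and chain rules, which rewrite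
  \<open>pdv i h\<close>, feed an induction hypothesis for arbitrary functions.\<close>

primrec Ck :: "nat \<Rightarrow> (real^'m::finite) set \<Rightarrow> (real^'m \<Rightarrow> real) \<Rightarrow> bool" where
  "Ck 0 U h \<longleftrightarrow> True"
| "Ck (Suc k) U h \<longleftrightarrow> (\<forall>x\<in>U. h differentiable (at x)) \<and> (\<forall>i. Ck k U (pdv i h))"

definition sm :: "(real^'m::finite) set \<Rightarrow> (real^'m \<Rightarrow> real) \<Rightarrow> bool" where
  "sm U h \<longleftrightarrow> (\<forall>k. Ck k U h)"

lemma has_derivative_cong_open:
  assumes "open U" "x \<in> U" "\<And>y. y \<in> U \<Longrightarrow> f y = g y"
  shows "(f has_derivative D) (at x) \<longleftrightarrow> (g has_derivative D) (at x)"
  using has_derivative_transform_within_open[of f D x UNIV U g]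
    has_derivative_transform_within_open[of g D x UNIV U f] assms by auto

lemma frechet_derivative_cong_open:
  assumes "open U" "x \<in> U" "\<And>y. y \<in> U \<Longrightarrow> f y = g y"
  shows "frechet_derivative f (at x) = frechet_derivative g (at x)"
  unfolding frechet_derivative_def using has_derivative_cong_open[OF assms] by simp

lemma differentiable_cong_open:
  assumes "open U" "x \<in> U" "\<And>y. y \<in> U \<Longrightarrow> f y = g y"
  shows "f differentiable (at x) \<longleftrightarrow> g differentiable (at x)"
  unfolding differentiable_def using has_derivative_cong_open[OF assms] by simp

lemma pdv_cong_open:
  assumes "open U" "x \<in> U" "\<And>y. y \<in> U \<Longrightarrow> f y = g y"
  shows "pdv i f x = pdv i g x"
  unfolding pdv_def using frechet_derivative_cong_open[OF assms] by simp

lemma pdv_eqI: "(h has_derivative D) (at x) \<Longrightarrow> pdv i h x = D (axis i 1)"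
  unfolding pdv_def by (metis frechet_derivative_at)

lemma linear_axis_expansion:
  fixes L :: "real^'m::finite \<Rightarrow> 'b::real_vector"
  assumes "linear L"
  shows "L v = (\<Sum>i\<in>UNIV. (v $ i) *\<^sub>R L (axis i 1))"
proof -
  have "v = (\<Sum>i\<in>UNIV. (v $ i) *\<^sub>R axis i 1)"
    using basis_expansion[of v] by (simp add: scalar_mult_eq_scaleR)
  then have "L v = L (\<Sum>i\<in>UNIV. (v $ i) *\<^sub>R axis i 1)" by simp
  also have "\<dots> = (\<Sum>i\<in>UNIV. (v $ i) *\<^sub>R L (axis i 1))"
    by (simp add: linear_sum[OF assms] linear_scale[OF assms])
  finally show ?thesis .
qed

lemma frechet_pdv:
  "h differentiable (at x) \<Longrightarrow> frechet_derivative h (at x) v = (\<Sum>i\<in>UNIV. v $ i * pdv i h x)"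
  using linear_axis_expansion[OF linear_frechet_derivative, of h "at x" v] by (simp add: pdv_def)

lemma has_derivative_pdv:
  "h differentiable (at x) \<Longrightarrow> (h has_derivative (\<lambda>v. \<Sum>i\<in>UNIV. v $ i * pdv i h x)) (at x)"
  by (metis (no_types, lifting) ext frechet_derivative_works frechet_pdv)

text \<open>Functions are total but differentiation rules hold on U only. This lemma lets such a
  rule replace \<open>pdv i h\<close> inside \<open>Ck\<close>.\<close>

lemma Ck_cong:
  assumes "open U" "\<And>y. y \<in> U \<Longrightarrow> f y = g y"
  shows "Ck k U f \<longleftrightarrow> Ck k U g"
  using assms(2)
proof (induction k arbitrary: f g)
  case (Suc k)
  have "Ck k U (pdv i f) \<longleftrightarrow> Ck k U (pdv i g)" for i
    by (rule Suc.IH, rule pdv_cong_open[OF assms(1)]) (auto simp: Suc.prems)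
  moreover have "f differentiable (at x) \<longleftrightarrow> g differentiable (at x)" if "x \<in> U" for x
    by (rule differentiable_cong_open[OF assms(1) that]) (rule Suc.prems)
  ultimately show ?case by simp
qed simp

lemma sm_cong:
  "open U \<Longrightarrow> (\<And>y. y \<in> U \<Longrightarrow> f y = g y) \<Longrightarrow> sm U f \<longleftrightarrow> sm U g"
  unfolding sm_def using Ck_cong by metis

lemma Ck_subset: "Ck k U h \<Longrightarrow> V \<subseteq> U \<Longrightarrow> Ck k V h"
  by (induction k arbitrary: h) auto

lemma sm_subset: "sm U h \<Longrightarrow> V \<subseteq> U \<Longrightarrow> sm V h"
  unfolding sm_def using Ck_subset by blast

lemma Ck_Suc: "Ck (Suc k) U h \<Longrightarrow> Ck k U h"
  by (induction k arbitrary: h) auto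

lemma sm_differentiable: "sm U h \<Longrightarrow> x \<in> U \<Longrightarrow> h differentiable (at x)"
  unfolding sm_def by (metis Ck.simps(2))

lemma sm_pdv: "sm U h \<Longrightarrow> sm U (pdv i h)"
  unfolding sm_def by (metis Ck.simps(2))

lemma pdv_const: "pdv i (\<lambda>x. c) = (\<lambda>x. 0)"
  by (rule ext, subst pdv_eqI[of _ "\<lambda>v. 0"]) auto

lemma Ck_const: "Ck k U (\<lambda>x. c)"
  by (induction k arbitrary: c) (auto simp: pdv_const)

lemma sm_const: "sm U (\<lambda>x. c)"
  by (simp add: sm_def Ck_const)

lemma has_derivative_coord: "((\<lambda>x::real^'m::finite. x $ i) has_derivative (\<lambda>v. v $ i)) (at x)"
  by (intro bounded_linear_imp_has_derivative bounded_linear_vec_nth)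

lemma pdv_coord: "pdv i (\<lambda>x. x $ j) = (\<lambda>x. if i = j then 1 else 0)"
  by (rule ext, subst pdv_eqI[OF has_derivative_coord]) (auto simp: axis_def)

lemma sm_coord: "sm U (\<lambda>x. x $ j)"
  unfolding sm_def
proof
  fix k show "Ck k U (\<lambda>x. x $ j)"
    by (cases k) (auto simp: pdv_coord Ck_const intro: has_derivative_coord differentiableI)
qed

lemma pdv_add:
  assumes "f differentiable (at x)" "g differentiable (at x)"
  shows "pdv i (\<lambda>x. f x + g x) x = pdv i f x + pdv i g x"
  using pdv_eqI[OF has_derivative_add[OF assms[unfolded frechet_derivative_works]], of i]
  by (simp add: pdv_def)

lemma pdv_mult:
  assumes "f differentiable (at x)" "g differentiable (at x)"
  shows "pdv i (\<lambda>x. f x * g x) x = f x * pdv i g x + pdv i f x * g x"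
  using pdv_eqI[OF has_derivative_mult[OF assms[unfolded frechet_derivative_works]], of i]
  by (simp add: pdv_def)

lemma pdv_diff:
  assumes "f differentiable (at x)" "g differentiable (at x)"
  shows "pdv i (\<lambda>x. f x - g x) x = pdv i f x - pdv i g x"
  using pdv_eqI[OF has_derivative_diff[OF assms[unfolded frechet_derivative_works]], of i]
  by (simp add: pdv_def)

lemma Ck_add: "open U \<Longrightarrow> Ck k U f \<Longrightarrow> Ck k U g \<Longrightarrow> Ck k U (\<lambda>x. f x + g x)"
proof (induction k arbitrary: f g)
  case (Suc k)
  have "Ck k U (pdv i (\<lambda>x. f x + g x))" for i
    by (subst Ck_cong[OF Suc.prems(1), of _ "\<lambda>x. pdv i f x + pdv i g x"])
       (use Suc in \<open>auto simp: pdv_add\<close>)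
  then show ?case using Suc.prems by auto
qed simp

lemma Ck_mult: "open U \<Longrightarrow> Ck k U f \<Longrightarrow> Ck k U g \<Longrightarrow> Ck k U (\<lambda>x. f x * g x)"
proof (induction k arbitrary: f g)
  case (Suc k)
  \<comment> \<open>The Leibniz rule leaves one factor undifferentiated, so f and g themselves are
    needed at the lower order.\<close>
  have "Ck k U f" "Ck k U g" using Suc.prems Ck_Suc by auto
  then have "Ck k U (pdv i (\<lambda>x. f x * g x))" for i
    by (subst Ck_cong[OF Suc.prems(1), of _ "\<lambda>x. f x * pdv i g x + pdv i f x * g x"])
       (use Suc in \<open>auto simp: pdv_mult intro!: Ck_add\<close>)
  then show ?case using Suc.prems by auto
qed simp

lemma sm_add: "open U \<Longrightarrow> sm U f \<Longrightarrow> sm U g \<Longrightarrow> sm U (\<lambda>x. f x + g x)"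
  by (simp add: sm_def Ck_add)

lemma sm_mult: "open U \<Longrightarrow> sm U f \<Longrightarrow> sm U g \<Longrightarrow> sm U (\<lambda>x. f x * g x)"
  by (simp add: sm_def Ck_mult)

lemma sm_diff: "open U \<Longrightarrow> sm U f \<Longrightarrow> sm U g \<Longrightarrow> sm U (\<lambda>x. f x - g x)"
  using sm_add[of U f "\<lambda>x. (-1) * g x"] sm_mult[of U "\<lambda>x. -1" g] by (simp add: sm_const)

lemma Ck_sum: "open U \<Longrightarrow> (\<And>i. i \<in> A \<Longrightarrow> Ck k U (f i)) \<Longrightarrow> Ck k U (\<lambda>x. \<Sum>i\<in>A. f i x)"
  by (induction A rule: infinite_finite_induct) (auto simp: Ck_const intro: Ck_add)

lemma sm_sum: "open U \<Longrightarrow> (\<And>i. i \<in> A \<Longrightarrow> sm U (f i)) \<Longrightarrow> sm U (\<lambda>x. \<Sum>i\<in>A. f i x)"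
  by (simp add: sm_def Ck_sum)

lemma sm_prod: "open U \<Longrightarrow> (\<And>i. i \<in> A \<Longrightarrow> sm U (f i)) \<Longrightarrow> sm U (\<lambda>x. \<Prod>i\<in>A. f i x)"
  by (induction A rule: infinite_finite_induct) (auto simp: sm_const intro: sm_mult)

lemma sm_power: "open U \<Longrightarrow> sm U f \<Longrightarrow> sm U (\<lambda>x. f x ^ m)"
  by (induction m) (auto simp: sm_const intro: sm_mult)

lemma sm_det:
  "open U \<Longrightarrow> (\<And>i j. sm U (\<lambda>x. A x $ i $ j)) \<Longrightarrow> sm U (\<lambda>x. det (A x))"
  unfolding det_def by (intro sm_sum sm_mult sm_const sm_prod)

lemma has_derivative_vec_lambda:
  fixes D :: "'a::real_normed_vector \<Rightarrow> real^'m::finite"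
  assumes "\<And>i. ((\<lambda>x. f x $ i) has_derivative (\<lambda>v. D v $ i)) (at x)"
  shows "(f has_derivative D) (at x)"
  unfolding has_derivative_componentwise_within[of f]
proof
  fix b :: "real^'m" assume "b \<in> Basis"
  then obtain i where "b = axis i 1" by (auto simp: Basis_vec_def)
  then show "((\<lambda>x. f x \<bullet> b) has_derivative (\<lambda>x. D x \<bullet> b)) (at x)"
    using assms[of i] by (simp add: inner_axis)
qed

lemma has_derivative_compose_pdv:
  fixes S :: "real^'m::finite \<Rightarrow> real^'k::finite"
  assumes "\<And>j. (\<lambda>x. S x $ j) differentiable (at x)" "h differentiable (at (S x))"
  shows "((\<lambda>x. h (S x)) has_derivative
     (\<lambda>v. \<Sum>j\<in>UNIV. (\<Sum>i\<in>UNIV. v $ i * pdv i (\<lambda>x. S x $ j) x) * pdv j h (S x))) (at x)"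
proof -
  have "(S has_derivative (\<lambda>v. \<chi> j. \<Sum>i\<in>UNIV. v $ i * pdv i (\<lambda>x. S x $ j) x)) (at x)"
    by (rule has_derivative_vec_lambda) (simp add: has_derivative_pdv[OF assms(1)])
  from has_derivative_compose[OF this has_derivative_pdv[OF assms(2)]] show ?thesis by simp
qed

lemma pdv_compose:
  fixes S :: "real^'m::finite \<Rightarrow> real^'k::finite"
  assumes "\<And>j. (\<lambda>x. S x $ j) differentiable (at x)" "h differentiable (at (S x))"
  shows "pdv i (\<lambda>x. h (S x)) x = (\<Sum>j\<in>UNIV. pdv i (\<lambda>x. S x $ j) x * pdv j h (S x))"
proof -
  have eq: "(\<Sum>l\<in>UNIV. axis i 1 $ l * c l) = c i" for c :: "'m \<Rightarrow> real"
    by (subst sum.remove[of _ i]) (auto simp: axis_def intro!: sum.neutral)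
  show ?thesis
    by (subst pdv_eqI[OF has_derivative_compose_pdv[OF assms]]) (simp_all add: eq)
qed

text \<open>By the chain rule a partial derivative of the composite is a sum of products of partial
  derivatives of S with \<open>pdv j h\<close> composed with S. The latter has one order less, so
  the induction runs over h with S fixed.\<close>

lemma Ck_compose:
  fixes S :: "real^'m::finite \<Rightarrow> real^'k::finite"
  assumes "open U"
  shows "Ck k V h \<Longrightarrow> (\<And>j. Ck k U (\<lambda>x. S x $ j)) \<Longrightarrow> S ` U \<subseteq> V \<Longrightarrow> Ck k U (\<lambda>x. h (S x))"
proof (induction k arbitrary: h)
  case (Suc k)
  have d: "(\<lambda>x. S x $ j) differentiable (at x)" if "x \<in> U" for x j
    using Suc.prems(2)[of j] that by simp
  have dh: "h differentiable (at (S x))" if "x \<in> U" for x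
    using Suc.prems that by auto
  have "Ck k U (\<lambda>x. S x $ j)" for j using Suc.prems(2) by (rule Ck_Suc)
  then have "Ck k U (\<lambda>x. pdv j h (S x))" for j
    using Suc.prems by (rule_tac Suc.IH) simp_all
  then have "Ck k U (\<lambda>x. \<Sum>j\<in>UNIV. pdv i (\<lambda>x. S x $ j) x * pdv j h (S x))" for i
    using Suc.prems(2) by (intro Ck_sum Ck_mult assms) auto
  then have "Ck k U (pdv i (\<lambda>x. h (S x)))" for i
    using Ck_cong[OF assms, of "pdv i (\<lambda>x. h (S x))"] pdv_compose[OF d dh] by simp
  moreover have "(\<lambda>x. h (S x)) differentiable (at x)" if "x \<in> U" for x
    using has_derivative_compose_pdv[OF d[OF that] dh[OF that]] differentiableI by blast
  ultimately show ?case by auto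
qed simp

lemma sm_compose:
  fixes S :: "real^'m::finite \<Rightarrow> real^'k::finite"
  assumes "open U" "sm V h" "\<And>j. sm U (\<lambda>x. S x $ j)" "S ` U \<subseteq> V"
  shows "sm U (\<lambda>x. h (S x))"
  using assms by (auto simp: sm_def intro: Ck_compose)

text \<open>\<open>partials\<close> puts later derivatives at the head of the list, so the one taken
  of f directly is the last entry. Splitting lists at the end matches the recursion of
  \<open>Ck\<close>.\<close>

lemma smooth_step:
  "(\<forall>is. length is < Suc k \<longrightarrow> (\<forall>x\<in>U. partials is f differentiable (at x))) \<longleftrightarrow>
   (\<forall>x\<in>U. f differentiable (at x)) \<and>
   (\<forall>i is. length is < k \<longrightarrow> (\<forall>x\<in>U. partials is (partials [i] f) differentiable (at x)))"
proof -
  have app: "partials (is @ [i]) f = partials is (partials [i] f)" for "is" i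
    by (induction "is") auto
  show ?thesis
  proof (intro iffI conjI allI impI)
    assume *: "\<forall>is. length is < Suc k \<longrightarrow> (\<forall>x\<in>U. partials is f differentiable (at x))"
    show "\<forall>x\<in>U. f differentiable (at x)" using *[rule_format, of "[]"] by simp
    fix i and js :: "'a list" assume "length js < k"
    then show "\<forall>x\<in>U. partials js (partials [i] f) differentiable (at x)"
      using *[rule_format, of "js @ [i]"] app[of js i] by auto
  next
    fix js :: "'a list"
    assume *: "(\<forall>x\<in>U. f differentiable (at x)) \<and>
     (\<forall>i is. length is < k \<longrightarrow> (\<forall>x\<in>U. partials is (partials [i] f) differentiable (at x)))"
    assume l: "length js < Suc k"
    show "\<forall>x\<in>U. partials js f differentiable (at x)"
    proof (cases js rule: rev_exhaust)
      case Nil with * show ?thesis by simp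
    next
      case (snoc ys y)
      then show ?thesis using * app[of ys y] l by auto
    qed
  qed
qed

lemma differentiable_vec_iff:
  fixes f :: "real^'m::finite \<Rightarrow> real^'n::finite"
  shows "f differentiable (at x) \<longleftrightarrow> (\<forall>i. (\<lambda>x. f x $ i) differentiable (at x))"
proof
  assume "f differentiable (at x)"
  then show "\<forall>i. (\<lambda>x. f x $ i) differentiable (at x)"
    unfolding differentiable_def
    using bounded_linear.has_derivative[OF bounded_linear_vec_nth, of f _ "at x"] by blast
next
  assume *: "\<forall>i. (\<lambda>x. f x $ i) differentiable (at x)"
  have "(f has_derivative (\<lambda>v. \<chi> j. \<Sum>i\<in>UNIV. v $ i * pdv i (\<lambda>x. f x $ j) x)) (at x)"
    by (rule has_derivative_vec_lambda) (use * has_derivative_pdv in auto)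
  then show "f differentiable (at x)" by (rule differentiableI)
qed

lemma frechet_vec_nth:
  fixes f :: "real^'m::finite \<Rightarrow> real^'n::finite"
  assumes "f differentiable (at x)"
  shows "frechet_derivative f (at x) v $ j = frechet_derivative (\<lambda>x. f x $ j) (at x) v"
proof -
  have "((\<lambda>x. f x $ j) has_derivative (\<lambda>v. frechet_derivative f (at x) v $ j)) (at x)"
    by (rule bounded_linear.has_derivative[OF bounded_linear_vec_nth])
       (use assms frechet_derivative_works in blast)
  from frechet_derivative_at[OF this] show ?thesis by metis
qed

lemma partials_single_nth:
  fixes f :: "real^'m::finite \<Rightarrow> real^'n::finite"
  shows "f differentiable (at x) \<Longrightarrow> partials [i] f x $ j = pdv i (\<lambda>x. f x $ j) x"
  by (simp add: pdv_def frechet_vec_nth)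

lemma Ck_iff_partials:
  fixes f :: "real^'m::finite \<Rightarrow> real^'n::finite"
  assumes "open U"
  shows "(\<forall>is. length is < k \<longrightarrow> (\<forall>x\<in>U. partials is f differentiable (at x))) \<longleftrightarrow>
    (\<forall>j. Ck k U (\<lambda>x. f x $ j))"
proof (induction k arbitrary: f)
  case (Suc k)
  have "(\<forall>j. Ck k U (\<lambda>x. partials [i] f x $ j)) \<longleftrightarrow> (\<forall>j. Ck k U (pdv i (\<lambda>x. f x $ j)))"
    if "\<forall>x\<in>U. f differentiable (at x)" for i
  proof -
    have "Ck k U (\<lambda>x. partials [i] f x $ j) \<longleftrightarrow> Ck k U (pdv i (\<lambda>x. f x $ j))" for j
      by (rule Ck_cong[OF assms]) (rule partials_single_nth, use that in blast)
    then show ?thesis by blast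
  qed
  then have "(\<forall>x\<in>U. f differentiable (at x)) \<and> (\<forall>i j. Ck k U (\<lambda>x. partials [i] f x $ j)) \<longleftrightarrow>
    (\<forall>j. Ck (Suc k) U (\<lambda>x. f x $ j))"
    by (auto simp: differentiable_vec_iff)
  then show ?case
    unfolding smooth_step using Suc.IH by auto
qed simp

lemma smooth_on_iff_sm:
  fixes f :: "real^'m::finite \<Rightarrow> real^'n::finite"
  assumes "open U"
  shows "smooth_on U f \<longleftrightarrow> (\<forall>j. sm U (\<lambda>x. f x $ j))"
proof -
  have "smooth_on U f \<longleftrightarrow> (\<forall>k is. length is < k \<longrightarrow> (\<forall>x\<in>U. partials is f differentiable (at x)))"
    unfolding smooth_on_def by (metis lessI)
  also have "\<dots> \<longleftrightarrow> (\<forall>k j. Ck k U (\<lambda>x. f x $ j))"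
    using Ck_iff_partials[OF assms, of _ f] by auto
  finally show ?thesis unfolding sm_def by auto
qed

lemma smooth_on_nth:
  fixes f :: "real^'m::finite \<Rightarrow> real^'k::finite"
  shows "open U \<Longrightarrow> smooth_on U f \<Longrightarrow> sm U (\<lambda>x. f x $ i)"
  by (simp add: smooth_on_iff_sm)

lemma smooth_onI_nth:
  fixes f :: "real^'m::finite \<Rightarrow> real^'k::finite"
  shows "open U \<Longrightarrow> (\<And>i. sm U (\<lambda>x. f x $ i)) \<Longrightarrow> smooth_on U f"
  by (simp add: smooth_on_iff_sm)

lemma smooth_on_subset: "smooth_on U f \<Longrightarrow> V \<subseteq> U \<Longrightarrow> smooth_on V f"
  unfolding smooth_on_def by blast

lemma smooth_on_differentiable: "smooth_on U f \<Longrightarrow> x \<in> U \<Longrightarrow> f differentiable (at x)"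
  unfolding smooth_on_def by (metis partials.simps(1))

lemma smooth_on_compose:
  fixes f :: "real^'m::finite \<Rightarrow> real^'n::finite" and g :: "real^'n \<Rightarrow> real^'k::finite"
  assumes "open U" "open V" "smooth_on U f" "smooth_on V g" "f ` U \<subseteq> V"
  shows "smooth_on U (\<lambda>x. g (f x))"
  using assms by (auto simp: smooth_on_iff_sm intro: sm_compose)

section \<open>Order of vanishing and jets\<close>

text \<open>For smooth h this is membership in the k-th power of the maximal ideal at 0: all
  derivatives of order below k vanish there. Smoothness enters through the \<open>sm\<close>
  hypotheses of the closure lemmas.\<close>

primrec Zo :: "nat \<Rightarrow> (real^'m::finite \<Rightarrow> real) \<Rightarrow> bool" where
  "Zo 0 h \<longleftrightarrow> True"
| "Zo (Suc k) h \<longleftrightarrow> h 0 = 0 \<and> (\<forall>i. Zo k (pdv i h))"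

lemma Zo_cong:
  assumes "open U" "0 \<in> U" "\<And>y. y \<in> U \<Longrightarrow> f y = g y"
  shows "Zo k f \<longleftrightarrow> Zo k g"
  using assms(3)
proof (induction k arbitrary: f g)
  case (Suc k)
  have "Zo k (pdv i f) \<longleftrightarrow> Zo k (pdv i g)" for i
    by (rule Suc.IH, rule pdv_cong_open[OF assms(1)]) (auto simp: Suc.prems)
  then show ?case using Suc.prems assms(2) by auto
qed simp

lemma Zo_Suc: "Zo (Suc k) h \<Longrightarrow> Zo k h"
  by (induction k arbitrary: h) auto

lemma Zo_mono: "Zo k h \<Longrightarrow> l \<le> k \<Longrightarrow> Zo l h"
  by (induction k) (use Zo_Suc in \<open>auto simp: le_Suc_eq simp del: Zo.simps\<close>)

lemma Zo_zero: "Zo k (\<lambda>x. 0)"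
  by (induction k) (auto simp: pdv_const)

lemma Zo_add:
  assumes "open U" "0 \<in> U"
  shows "sm U f \<Longrightarrow> sm U g \<Longrightarrow> Zo k f \<Longrightarrow> Zo k g \<Longrightarrow> Zo k (\<lambda>x. f x + g x)"
proof (induction k arbitrary: f g)
  case (Suc k)
  have "Zo k (pdv i (\<lambda>x. f x + g x))" for i
    by (subst Zo_cong[OF assms, of _ "\<lambda>x. pdv i f x + pdv i g x"])
       (use Suc in \<open>auto simp: pdv_add sm_differentiable sm_pdv\<close>)
  then show ?case using Suc.prems by auto
qed simp

lemma Zo_mult:
  assumes "open U" "0 \<in> U"
  shows "sm U f \<Longrightarrow> sm U g \<Longrightarrow> Zo k g \<Longrightarrow> Zo k (\<lambda>x. f x * g x)"
proof (induction k arbitrary: f g)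
  case (Suc k)
  have "Zo k g" using Suc.prems Zo_Suc by auto
  then have "Zo k (\<lambda>x. f x * pdv i g x + pdv i f x * g x)" for i
    using Suc by (intro Zo_add[OF assms] sm_mult assms sm_pdv Suc.IH) auto
  then have "Zo k (pdv i (\<lambda>x. f x * g x))" for i
    by (subst Zo_cong[OF assms, of _ "\<lambda>x. f x * pdv i g x + pdv i f x * g x"])
       (use Suc in \<open>auto simp: pdv_mult sm_differentiable\<close>)
  then show ?case using Suc.prems by auto
qed simp

lemma Zo_sum:
  assumes "open U" "0 \<in> U"
  shows "(\<And>i. i \<in> A \<Longrightarrow> sm U (f i)) \<Longrightarrow> (\<And>i. i \<in> A \<Longrightarrow> Zo k (f i)) \<Longrightarrow> Zo k (\<lambda>x. \<Sum>i\<in>A. f i x)"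
  by (induction A rule: infinite_finite_induct)
     (auto simp: Zo_zero intro!: Zo_add[OF assms] sm_sum assms)

lemma Zo_diff_mult:
  assumes U: "open U" "0 \<in> U" and s: "sm U f" "sm U f'" "sm U g" "sm U g'"
    and z: "Zo k (\<lambda>x. f x - f' x)" "Zo k (\<lambda>x. g x - g' x)"
  shows "Zo k (\<lambda>x. f x * g x - f' x * g' x)"
proof -
  have "Zo k (\<lambda>x. f x * (g x - g' x) + g' x * (f x - f' x))"
    by (intro Zo_add[OF U] sm_mult sm_diff U s Zo_mult[OF U] z)
  then show ?thesis by (simp add: algebra_simps)
qed

lemma Zo_diff_prod:
  assumes U: "open U" "0 \<in> U"
  shows "(\<And>i. i \<in> A \<Longrightarrow> sm U (f i)) \<Longrightarrow> (\<And>i. i \<in> A \<Longrightarrow> sm U (g i)) \<Longrightarrow>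
    (\<And>i. i \<in> A \<Longrightarrow> Zo k (\<lambda>x. f i x - g i x)) \<Longrightarrow> Zo k (\<lambda>x. (\<Prod>i\<in>A. f i x) - (\<Prod>i\<in>A. g i x))"
proof (induction A rule: infinite_finite_induct)
  case (insert i A)
  then show ?case by (auto intro!: Zo_diff_mult[OF U] sm_prod U)
qed (auto simp: Zo_zero)

text \<open>Telescoping over the factors of each Leibniz product. It is applied to the Jacobian
  matrices of two germs with the same jet.\<close>

lemma Zo_diff_det:
  assumes U: "open U" "0 \<in> U"
    and s: "\<And>i j. sm U (\<lambda>x. A x $ i $ j)" "\<And>i j. sm U (\<lambda>x. B x $ i $ j)"
    and z: "\<And>i j. Zo k (\<lambda>x. A x $ i $ j - B x $ i $ j)"
  shows "Zo k (\<lambda>x. det (A x) - det (B x))"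
proof -
  have "Zo k (\<lambda>x. \<Sum>p\<in>{p. p permutes UNIV}. of_int (sign p) * ((\<Prod>i\<in>UNIV. A x $ i $ p i) - (\<Prod>i\<in>UNIV. B x $ i $ p i)))"
    by (intro Zo_sum[OF U] sm_mult U sm_const sm_diff sm_prod s Zo_mult[OF U] Zo_diff_prod[OF U] z)
  then show ?thesis by (simp add: det_def sum_subtractf right_diff_distrib)
qed

text \<open>The bridge from jets, recorded by lists of indices, to orders of vanishing, on which
  products and derivations act.\<close>

lemma Zo_of_partials_eq:
  fixes f g :: "real^'m::finite \<Rightarrow> real^'n::finite"
  assumes U: "open U" "0 \<in> U"
  shows "smooth_on U f \<Longrightarrow> smooth_on U g \<Longrightarrow> (\<And>is. length is < k \<Longrightarrow> partials is f 0 = partials is g 0)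
    \<Longrightarrow> Zo k (\<lambda>x. f x $ j - g x $ j)"
proof (induction k arbitrary: f g)
  case (Suc k)
  have app: "partials (is @ [i]) f = partials is (partials [i] f)" for "is" i and f :: "real^'m \<Rightarrow> real^'n"
    by (induction "is") auto
  have sm: "smooth_on U (partials [i] h)" if "smooth_on U h" for i and h :: "real^'m \<Rightarrow> real^'n"
    using that unfolding smooth_on_def app[symmetric] by blast
  have df: "h differentiable (at x)" if "smooth_on U h" "x \<in> U" for x and h :: "real^'m \<Rightarrow> real^'n"
    using that smooth_on_differentiable by blast
  have 1: "Zo k (\<lambda>x. partials [i] f x $ j - partials [i] g x $ j)" for i
  proof (rule Suc.IH)
    fix js :: "'m list" assume "length js < k"
    then show "partials js (partials [i] f) 0 = partials js (partials [i] g) 0"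
      using Suc.prems(3)[of "js @ [i]"] app by auto
  qed (use Suc.prems sm in auto)
  have "Zo k (pdv i (\<lambda>x. f x $ j - g x $ j))" for i
  proof (subst Zo_cong[OF U])
    show "Zo k (\<lambda>x. partials [i] f x $ j - partials [i] g x $ j)" by (rule 1)
    fix y assume y: "y \<in> U"
    have "(\<lambda>x. f x $ j) differentiable (at y)" "(\<lambda>x. g x $ j) differentiable (at y)"
      using df[OF _ y] Suc.prems differentiable_vec_iff by blast+
    then show "pdv i (\<lambda>x. f x $ j - g x $ j) y = partials [i] f y $ j - partials [i] g y $ j"
      using df[OF _ y] Suc.prems by (simp only: pdv_diff partials_single_nth)
  qed
  then show ?case using Suc.prems(3)[of "[]"] by simp
qed simp

section \<open>Dependence of jets on the germ\<close>

lemma partials_cong_open: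
  assumes "open U" "\<And>x. x \<in> U \<Longrightarrow> f x = g x"
  shows "x \<in> U \<Longrightarrow> partials is f x = partials is g x"
proof (induction "is" arbitrary: x)
  case (Cons i "is")
  then have "frechet_derivative (partials is f) (at x) = frechet_derivative (partials is g) (at x)"
    by (intro frechet_derivative_cong_open[OF assms(1)]) auto
  then show ?case by simp
qed (simp add: assms)

lemma jet_cong:
  assumes "\<forall>\<^sub>F x in nhds 0. f x = g x"
  shows "jet r f = jet r g"
proof -
  obtain U where U: "open U" "0 \<in> U" "\<And>x. x \<in> U \<Longrightarrow> f x = g x"
    using assms unfolding eventually_nhds by blast
  then have "partials is f 0 = partials is g 0" for "is"
    using partials_cong_open by blast
  then show ?thesis unfolding jet_def by presburger
qed

section \<open>Connectedness of the matrices of positive determinant\<close>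

lemma continuous_on_matrix_entries:
  fixes g :: "'a::topological_space \<Rightarrow> real^'n::finite^'m::finite"
  assumes "\<And>i j. continuous_on S (\<lambda>t. g t $ i $ j)"
  shows "continuous_on S g"
proof -
  have "continuous_on S (\<lambda>t. \<chi> i. \<chi> j. g t $ i $ j)"
    by (intro continuous_on_vec_lambda assms)
  then show ?thesis by simp
qed

lemma continuous_on_det_entries:
  fixes g :: "'a::topological_space \<Rightarrow> real^'n::finite^'n"
  assumes "continuous_on S g"
  shows "continuous_on S (\<lambda>t. det (g t))"
  unfolding det_def
  by (intro continuous_on_sum continuous_on_mult continuous_on_const continuous_on_prod
      continuous_on_component assms)

lemma det_pos_along_path:
  fixes g :: "real \<Rightarrow> real^'n::finite^'n"
  assumes "continuous_on {0..1} g" "\<And>t. t \<in> {0..1} \<Longrightarrow> det (g t) \<noteq> 0" "det (g 0) > 0"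
  shows "det (g 1) > 0"
proof (rule ccontr)
  assume "\<not> det (g 1) > 0"
  then obtain t where "0 \<le> t" "t \<le> 1" "det (g t) = 0"
    using IVT2'[of "\<lambda>t. det (g t)" 1 0 0] continuous_on_det_entries[OF assms(1)] assms(3) by force
  with assms(2) show False by auto
qed

definition GLm :: "(real^'n::finite^'n) set" where "GLm = {A. det A \<noteq> 0}"

definition reflect_mat :: "'n::finite \<Rightarrow> real^'n^'n" where
  "reflect_mat i = (\<chi> a b. if a = b then (if a = i then -1 else 1) else 0)"

lemma path_component_GLm_mult:
  fixes A B A' B' :: "real^'n::finite^'n"
  assumes "path_component GLm A B" "path_component GLm A' B'"
  shows "path_component GLm (A ** A') (B ** B')"
proof -
  obtain g g' where "path g" "path_image g \<subseteq> GLm" "pathstart g = A" "pathfinish g = B"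
    and "path g'" "path_image g' \<subseteq> GLm" "pathstart g' = A'" "pathfinish g' = B'"
    using assms unfolding path_component_def by blast
  then have g: "continuous_on {0..1} g" "g ` {0..1} \<subseteq> GLm" "g 0 = A" "g 1 = B"
    and g': "continuous_on {0..1} g'" "g' ` {0..1} \<subseteq> GLm" "g' 0 = A'" "g' 1 = B'"
    by (auto simp: path_defs)
  have "continuous_on {0..1} (\<lambda>t. g t ** g' t)"
    unfolding matrix_matrix_mult_def
    by (intro continuous_on_vec_lambda continuous_on_sum continuous_on_mult
        continuous_on_component g g')
  moreover have "(\<lambda>t. g t ** g' t) ` {0..1} \<subseteq> GLm"
    using g(2) g'(2) by (auto simp: GLm_def det_mul image_subset_iff)
  ultimately show ?thesis
    unfolding path_defs using g g' by (intro exI[of _ "\<lambda>t. g t ** g' t"]) auto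
qed

text \<open>For i \<noteq> j this acts on the (i, j)-plane as the reflection in the line of angle
  t/2. One family serves twice: t = 0 and t = pi give the two coordinate reflections, and t = pi/2
  gives the swap of the two coordinates.\<close>

definition plane_reflection :: "'n::finite \<Rightarrow> 'n \<Rightarrow> real \<Rightarrow> real^'n^'n" where
  "plane_reflection i j t = (\<chi> a b. if a = i \<and> b = i then cos t else if a = j \<and> b = j then - cos t
     else if a = i \<and> b = j \<or> a = j \<and> b = i then sin t else of_bool (a = b))"

text \<open>An involution has nonzero determinant, which keeps the whole family inside
  \<open>GLm\<close>.\<close>

lemma plane_reflection_square:
  assumes "i \<noteq> j"
  shows "plane_reflection i j t ** plane_reflection i j t = mat 1"
proof -
  let ?F = "plane_reflection i j t"
  have "(\<Sum>k\<in>UNIV. ?F $ a $ k * ?F $ k $ b) = of_bool (a = b)" for a b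
  proof (cases "a = i \<or> a = j")
    case True
    then have "(\<Sum>k\<in>UNIV. ?F $ a $ k * ?F $ k $ b) = (\<Sum>k\<in>{i,j}. ?F $ a $ k * ?F $ k $ b)"
      by (intro sum.mono_neutral_right) (auto simp: plane_reflection_def)
    also have "\<dots> = of_bool (a = b)"
      using True assms sin_cos_squared_add[of t]
      by (auto simp: plane_reflection_def power2_eq_square algebra_simps)
    finally show ?thesis .
  next
    case False
    then have "(\<Sum>k\<in>UNIV. ?F $ a $ k * ?F $ k $ b) = (\<Sum>k\<in>{a}. ?F $ a $ k * ?F $ k $ b)"
      by (intro sum.mono_neutral_right) (auto simp: plane_reflection_def)
    with False show ?thesis by (auto simp: plane_reflection_def)
  qed
  then show ?thesis
    by (simp add: matrix_matrix_mult_def mat_def vec_eq_iff of_bool_def)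
qed

lemma path_component_plane_reflection:
  assumes "i \<noteq> j"
  shows "path_component GLm (plane_reflection i j s) (plane_reflection i j t)"
proof -
  define g where "g u = plane_reflection i j ((1 - u) * s + u * t)" for u :: real
  have "det (plane_reflection i j u) \<noteq> 0" for u
    using arg_cong[OF plane_reflection_square[OF assms, of u], of det] by (auto simp: det_mul)
  then have "g ` {0..1} \<subseteq> GLm" by (auto simp: g_def GLm_def)
  moreover have "continuous_on {0..1} g"
  proof (rule continuous_on_matrix_entries)
    fix a b
    show "continuous_on {0..1} (\<lambda>u. g u $ a $ b)"
      unfolding g_def plane_reflection_def
      by (cases "a = i"; cases "a = j"; cases "b = i"; cases "b = j")
        (use assms in \<open>auto intro!: continuous_intros\<close>)
  qed
  ultimately show ?thesis
    unfolding path_defs by (intro exI[of _ g]) (auto simp: g_def)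
qed

lemma reflect_mat_component: "path_component GLm (reflect_mat i) (reflect_mat j)"
proof (cases "i = j")
  case True
  have "det (reflect_mat i) \<noteq> 0"
    by (subst det_diagonal) (auto simp: reflect_mat_def)
  with True show ?thesis by (simp add: path_component_refl GLm_def)
next
  case False
  then have "plane_reflection i j 0 = reflect_mat j" "plane_reflection i j pi = reflect_mat i"
    by (auto simp: plane_reflection_def reflect_mat_def vec_eq_iff)
  with path_component_plane_reflection[OF False] show ?thesis by metis
qed

lemma swap_component:
  assumes "i \<noteq> j"
  shows "path_component GLm (reflect_mat j) (\<chi> a b. mat 1 $ a $ Transposition.transpose i j b)"
proof -
  have "plane_reflection i j 0 = reflect_mat j"
    using assms by (auto simp: plane_reflection_def reflect_mat_def vec_eq_iff)
  moreover have "plane_reflection i j (pi/2) $ a $ b = mat 1 $ a $ Transposition.transpose i j b" for a b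
    using assms unfolding plane_reflection_def mat_def Transposition.transpose_def
    by (cases "a = i"; cases "a = j"; cases "b = i"; cases "b = j"; simp)
  then have "plane_reflection i j (pi/2) = (\<chi> a b. mat 1 $ a $ Transposition.transpose i j b)"
    by (simp add: vec_eq_iff)
  ultimately have "plane_reflection i j 0 = reflect_mat j"
    "plane_reflection i j (pi/2) = (\<chi> a b. mat 1 $ a $ Transposition.transpose i j b)" by auto
  with path_component_plane_reflection[OF assms] show ?thesis by metis
qed

lemma reflect_mat_square: "reflect_mat i ** reflect_mat i = mat 1"
proof -
  have "(\<Sum>k\<in>UNIV. reflect_mat i $ a $ k * reflect_mat i $ k $ b) =
    (if a = b then 1 else 0)" for a b
  proof -
    have "(\<Sum>k\<in>UNIV. reflect_mat i $ a $ k * reflect_mat i $ k $ b) =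
      (\<Sum>k\<in>{a}. reflect_mat i $ a $ k * reflect_mat i $ k $ b)"
      by (intro sum.mono_neutral_right) (auto simp: reflect_mat_def)
    then show ?thesis by (simp add: reflect_mat_def)
  qed
  then show ?thesis by (simp add: matrix_matrix_mult_def mat_def vec_eq_iff)
qed

text \<open>A claim about both components at once is closed under products, as an induction over
  elementary factors requires. Positivity of the determinant would not pass from a product to its
  factors.\<close>

definition GL_normal :: "'n::finite \<Rightarrow> real^'n^'n \<Rightarrow> bool" where
  "GL_normal c A \<longleftrightarrow> path_component GLm (mat 1) A \<or> path_component GLm (reflect_mat c) A"

lemma GL_normal_mult: "GL_normal c A \<Longrightarrow> GL_normal c B \<Longrightarrow> GL_normal c (A ** B)"
  unfolding GL_normal_def
  using path_component_GLm_mult[of "mat 1" A "mat 1" B] path_component_GLm_mult[of "mat 1" A "reflect_mat c" B]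
    path_component_GLm_mult[of "reflect_mat c" A "mat 1" B]
    path_component_GLm_mult[of "reflect_mat c" A "reflect_mat c" B]
  by (auto simp: reflect_mat_square)

lemma GL_normal_trans: "GL_normal c A \<Longrightarrow> path_component GLm A B \<Longrightarrow> GL_normal c B"
  unfolding GL_normal_def using path_component_trans by blast

lemma GL_normal_sign_diagonal:
  "GL_normal c (\<chi> a b. if a = b then (if a \<in> N then -1 else 1) else 0)"
proof (induction N rule: infinite_finite_induct)
  case (insert i N)
  have "reflect_mat i ** (\<chi> a b. if a = b then (if a \<in> N then -1 else 1) else 0) =
    (\<chi> a b. if a = b then (if a \<in> insert i N then -1 else 1) else 0)"
  proof -
    have "(\<Sum>k\<in>UNIV. reflect_mat i $ a $ k * (if k = b then (if k \<in> N then -1 else 1) else 0)) =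
      (\<Sum>k\<in>{a}. reflect_mat i $ a $ k * (if k = b then (if k \<in> N then -1 else 1) else 0))" for a b
      by (intro sum.mono_neutral_right) (auto simp: reflect_mat_def)
    then show ?thesis
      using insert.hyps by (auto simp: matrix_matrix_mult_def vec_eq_iff reflect_mat_def)
  qed
  moreover have "GL_normal c (reflect_mat i)"
    unfolding GL_normal_def using reflect_mat_component by blast
  ultimately show ?case using GL_normal_mult[OF _ insert.IH, of "reflect_mat i"] by simp
next
  case empty
  have "(\<chi> a b. if a = b then (if a \<in> {} then -1 else 1) else 0) = (mat 1 :: real^'a^'a)"
    by (simp add: mat_def vec_eq_iff)
  moreover have "path_component GLm (mat 1) (mat 1 :: real^'a^'a)"
    by (simp add: path_component_refl GLm_def)
  ultimately show ?case unfolding GL_normal_def by metis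
qed simp

text \<open>On the segment from the matrix of signs to A no diagonal entry vanishes, because its
  values at both ends have the same sign.\<close>

lemma GL_normal_diagonal:
  assumes d: "\<And>i j. i \<noteq> j \<Longrightarrow> A $ i $ j = 0" and "det A \<noteq> 0"
  shows "GL_normal c A"
proof (rule GL_normal_trans[OF GL_normal_sign_diagonal])
  let ?D = "(\<chi> a b. if a = b then (if a \<in> {i. A $ i $ i < 0} then -1 else 1) else 0)"
  have nz: "A $ i $ i \<noteq> 0" for i using assms det_diagonal[OF d] by simp
  show "path_component GLm ?D A"
  proof (rule path_component_linepath, rule subsetI)
    fix B assume "B \<in> closed_segment ?D A"
    then obtain u where u: "0 \<le> u" "u \<le> 1" "B = (1 - u) *\<^sub>R ?D + u *\<^sub>R A"
      unfolding closed_segment_def by blast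
    have off: "B $ i $ j = 0" if "i \<noteq> j" for i j using u that d by simp
    have "B $ i $ i \<noteq> 0" for i
    proof (cases "A $ i $ i < 0")
      case True
      then have "u * A $ i $ i \<le> 0" using u by (simp add: mult_nonneg_nonpos)
      then show ?thesis using u True by (cases "u = 1") auto
    next
      case False
      then have "A $ i $ i > 0" using nz[of i] by simp
      then have "u * A $ i $ i \<ge> 0" using u by simp
      then have "1 - u + u * A $ i $ i > 0"
        using u \<open>A $ i $ i > 0\<close> by (cases "u = 1") (auto simp: add_pos_nonneg)
      then show ?thesis using u False by simp
    qed
    then show "B \<in> GLm" by (simp add: GLm_def det_diagonal[OF off])
  qed
qed

lemma det_shear:
  fixes m n :: "'n::finite"
  assumes "m \<noteq> n"
  shows "det ((\<chi> i j. if i = m \<and> j = n then c else of_bool (i = j)) :: real^'n^'n) = 1"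
proof -
  have "det ((\<chi> i. if i = m then row m (mat 1) + c *s row n (mat 1) else row i (mat 1)) :: real^'n^'n) = det (mat 1 :: real^'n^'n)"
    by (rule det_row_operation[OF assms])
  moreover have "(\<chi> i. if i = m then row m (mat 1) + c *s row n (mat 1) else row i (mat 1)) =
    ((\<chi> i j. if i = m \<and> j = n then c else of_bool (i = j)) :: real^'n^'n)"
    using assms by (auto simp: vec_eq_iff row_def mat_def)
  ultimately show ?thesis by simp
qed

text \<open>Induction over elementary matrices. A matrix with a zero row is singular, a swap lies on
  a path of plane reflections, and a shear is joined to the identity by shrinking its off-diagonal
  entry at constant determinant 1.\<close>

lemma GL_normal_det: "det A \<noteq> 0 \<longrightarrow> GL_normal c A"
proof (rule induct_matrix_elementary[of "\<lambda>A. det A \<noteq> 0 \<longrightarrow> GL_normal c A"])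
  fix A B :: "real^'a^'a"
  assume "det A \<noteq> 0 \<longrightarrow> GL_normal c A" "det B \<noteq> 0 \<longrightarrow> GL_normal c B"
  then show "det (A ** B) \<noteq> 0 \<longrightarrow> GL_normal c (A ** B)" by (auto simp: det_mul GL_normal_mult)
next
  fix A :: "real^'a^'a" and i assume "row i A = 0"
  then show "det A \<noteq> 0 \<longrightarrow> GL_normal c A" using det_zero_row(2)[of i A] by simp
next
  fix A :: "real^'a^'a" assume "\<And>i j. i \<noteq> j \<Longrightarrow> A $ i $ j = 0"
  then show "det A \<noteq> 0 \<longrightarrow> GL_normal c A" using GL_normal_diagonal by blast
next
  fix m n :: 'a assume "m \<noteq> n"
  let ?A = "(\<chi> i j. mat 1 $ i $ Transposition.transpose m n j) :: real^'a^'a"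
  show "det ?A \<noteq> 0 \<longrightarrow> GL_normal c ?A"
    using swap_component[OF \<open>m \<noteq> n\<close>] reflect_mat_component path_component_trans unfolding GL_normal_def by blast
next
  fix m n :: 'a and c' :: real assume idplus: "m \<noteq> n"
  let ?S = "\<lambda>c. (\<chi> i j. if i = m \<and> j = n then c else of_bool (i = j)) :: real^'a^'a"
  have "path_component GLm (?S 0) (?S c')"
  proof (rule path_component_linepath, rule subsetI)
    fix B assume "B \<in> closed_segment (?S 0) (?S c')"
    then obtain u where "B = (1 - u) *\<^sub>R ?S 0 + u *\<^sub>R ?S c'"
      unfolding closed_segment_def by blast
    then have "B = ?S (u * c')"
      using idplus by (auto simp: vec_eq_iff)
    then show "B \<in> GLm" using det_shear[OF idplus] by (simp add: GLm_def)
  qed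
  moreover have "?S 0 = mat 1" using idplus by (auto simp: vec_eq_iff mat_def)
  ultimately show "det (?S c') \<noteq> 0 \<longrightarrow> GL_normal c (?S c')" unfolding GL_normal_def by simp
qed

text \<open>The sign of the determinant is constant along paths in \<open>GLm\<close>, which
  excludes the component of the reflection.\<close>

lemma path_component_GLm_pos:
  assumes "det A > 0"
  shows "path_component GLm (mat 1) A"
proof -
  obtain c :: 'a where True by simp
  have "\<not> path_component GLm (reflect_mat c) A"
  proof
    assume "path_component GLm (reflect_mat c) A"
    from path_component_sym[OF this] obtain g where
      "path g" "path_image g \<subseteq> GLm" "pathstart g = A" "pathfinish g = reflect_mat c"
      unfolding path_component_def by blast
    then have g: "continuous_on {0..1} g" "g ` {0..1} \<subseteq> GLm" "g 0 = A" "g 1 = reflect_mat c"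
      by (auto simp: path_defs)
    have "det (g 1) > 0"
      by (rule det_pos_along_path[OF g(1)]) (use g assms in \<open>auto simp: GLm_def image_subset_iff\<close>)
    moreover have "det (reflect_mat c) = -1"
      by (subst det_diagonal) (simp_all add: reflect_mat_def)
    ultimately show False using g(4) by simp
  qed
  moreover have "GL_normal c A" using GL_normal_det[of A c] assms by simp
  ultimately show ?thesis unfolding GL_normal_def by blast
qed

section \<open>Germs of diffeomorphisms\<close>

lemma has_derivative_jacobian:
  fixes f :: "real^'m::finite \<Rightarrow> real^'n::finite"
  shows "f differentiable (at x) \<Longrightarrow> (f has_derivative (\<lambda>v. jacobian f (at x) *v v)) (at x)"
  using jacobian_works by blast

lemma jacobian_eqI:
  fixes f :: "real^'m::finite \<Rightarrow> real^'n::finite"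
  assumes "(f has_derivative (\<lambda>v. A *v v)) (at x)"
  shows "jacobian f (at x) = A"
  unfolding jacobian_def frechet_derivative_at[OF assms, symmetric]
  by simp

lemma jacobian_nth:
  fixes f :: "real^'m::finite \<Rightarrow> real^'n::finite"
  assumes "f differentiable (at x)"
  shows "jacobian f (at x) $ i $ j = pdv j (\<lambda>x. f x $ i) x"
  using frechet_vec_nth[OF assms] by (simp add: jacobian_def matrix_def pdv_def)

lemma jacobian_mult_nth:
  fixes f :: "real^'m::finite \<Rightarrow> real^'n::finite"
  assumes "f differentiable (at x)"
  shows "(jacobian f (at x) *v v) $ i = frechet_derivative (\<lambda>x. f x $ i) (at x) v"
  using frechet_vec_nth[OF assms] frechet_derivative_at[OF has_derivative_jacobian[OF assms]] by metis

lemma jacobian_compose: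
  fixes f :: "real^'m::finite \<Rightarrow> real^'n::finite" and g :: "real^'n \<Rightarrow> real^'k::finite"
  assumes "f differentiable (at x)" "g differentiable (at (f x))"
  shows "jacobian (\<lambda>x. g (f x)) (at x) = jacobian g (at (f x)) ** jacobian f (at x)"
    and "(\<lambda>x. g (f x)) differentiable (at x)"
proof -
  have *: "((\<lambda>x. g (f x)) has_derivative (\<lambda>v. (jacobian g (at (f x)) ** jacobian f (at x)) *v v)) (at x)"
    using has_derivative_compose[OF has_derivative_jacobian[OF assms(1)] has_derivative_jacobian[OF assms(2)]]
    by (simp add: matrix_vector_mul_assoc)
  show "jacobian (\<lambda>x. g (f x)) (at x) = jacobian g (at (f x)) ** jacobian f (at x)"
    by (rule jacobian_eqI[OF *])
  show "(\<lambda>x. g (f x)) differentiable (at x)" using * by (rule differentiableI)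
qed

lemma jacobian_cong_open:
  assumes "open U" "x \<in> U" "\<And>y. y \<in> U \<Longrightarrow> f y = g y"
  shows "jacobian f (at x) = jacobian g (at x)"
  unfolding jacobian_def using frechet_derivative_cong_open[OF assms] by simp

lemma has_derivative_matrix_mult:
  "((\<lambda>x. A *v x) has_derivative (\<lambda>v. A *v v)) (at (x::real^'m::finite))"
  by (rule bounded_linear_imp_has_derivative) (rule matrix_vector_mul_bounded_linear)

lemma jacobian_linear: "jacobian (\<lambda>x. A *v x) (at (x::real^'m::finite)) = (A::real^'m^'n::finite)"
  by (rule jacobian_eqI[OF has_derivative_matrix_mult])

lemma partials_linear:
  fixes A :: "real^'m::finite^'n::finite"
  shows "partials is (\<lambda>x. A *v x) x =
    (case is of [] \<Rightarrow> A *v x | i # js \<Rightarrow> if js = [] then column i A else 0)"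
proof (induction "is" arbitrary: x)
  case (Cons i js)
  have "partials js (\<lambda>x. A *v x) = (\<lambda>x. case js of [] \<Rightarrow> A *v x | i # js \<Rightarrow> if js = [] then column i A else 0)"
    using Cons by blast
  then show ?case
    using frechet_derivative_at[OF has_derivative_matrix_mult, of A x, symmetric]
    by (cases js) (simp_all add: matrix_vector_mult_basis frechet_derivative_const)
qed simp

lemma smooth_on_linear: "smooth_on U (\<lambda>x. A *v x)"
proof -
  have "smooth_on UNIV (\<lambda>x. A *v x)"
    unfolding smooth_on_iff_sm[OF open_UNIV] matrix_vector_mult_def
    by (auto intro!: sm_sum sm_mult sm_const sm_coord)
  then show ?thesis by (rule smooth_on_subset) simp
qed

lemma diffeo_germ_linear:
  fixes A :: "real^'m::finite^'m"
  assumes "det A \<noteq> 0"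
  shows "diffeo_germ (\<lambda>x. A *v x)"
proof -
  obtain B where inv: "A ** B = mat 1" "B ** A = mat 1"
    using assms invertible_det_nz[of A] unfolding invertible_def by blast
  have "homeomorphism UNIV UNIV (\<lambda>x. A *v x) (\<lambda>x. B *v x)"
    by (rule homeomorphismI) (auto simp: matrix_vector_mul_assoc inv intro: matrix_vector_mult_linear_continuous_on)
  then show ?thesis unfolding diffeo_germ_def
    by (intro conjI exI[of _ UNIV] exI[of _ "\<lambda>x. B *v x"]) (simp_all add: smooth_on_linear)
qed

text \<open>Representatives of a diffeomorphism germ and of its inverse on explicit neighbourhoods,
  so that domains can be shrunk and the chain rule applied at points other than 0.\<close>

definition smooth_inverse ::
  "(real^'m::finite) set \<Rightarrow> (real^'m) set \<Rightarrow> (real^'m \<Rightarrow> real^'m) \<Rightarrow> (real^'m \<Rightarrow> real^'m) \<Rightarrow> bool" where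
  "smooth_inverse U V s t \<longleftrightarrow> open U \<and> open V \<and> 0 \<in> U \<and> s 0 = 0 \<and> s ` U = V \<and>
     (\<forall>x\<in>U. t (s x) = x) \<and> smooth_on U s \<and> smooth_on V t"

lemma smooth_inverseD:
  assumes "smooth_inverse U V s t"
  shows "open U" "open V" "0 \<in> U" "0 \<in> V" "s 0 = 0" "t 0 = 0" "s ` U = V" "t ` V = U"
    "\<And>x. x \<in> U \<Longrightarrow> t (s x) = x" "\<And>y. y \<in> V \<Longrightarrow> s (t y) = y" "smooth_on U s" "smooth_on V t"
proof -
  show U: "open U" "open V" "0 \<in> U" "s 0 = 0" "s ` U = V" "\<And>x. x \<in> U \<Longrightarrow> t (s x) = x"
    "smooth_on U s" "smooth_on V t"
    using assms by (simp_all add: smooth_inverse_def)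
  have t: "t (s x) = x" if "x \<in> U" for x by (rule U(6)[OF that])
  show "t 0 = 0" using t[OF U(3)] U(4) by simp
  show "0 \<in> V" using U(3,4,5) by (metis imageI)
  show "t ` V = U" unfolding U(5)[symmetric] image_image by (simp add: t)
  fix y assume "y \<in> V"
  then obtain x where "x \<in> U" "y = s x" using U(5) by blast
  then show "s (t y) = y" using t by simp
qed

lemma diffeo_germE:
  assumes "diffeo_germ s"
  obtains U V t where "smooth_inverse U V s t"
  using assms unfolding diffeo_germ_def smooth_inverse_def homeomorphism_def by blast

lemma smooth_on_continuous_on: "smooth_on U f \<Longrightarrow> continuous_on U f"
  by (meson continuous_at_imp_continuous_on differentiable_imp_continuous_within smooth_on_differentiable)

lemma diffeo_germI:
  assumes "smooth_inverse U V s t"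
  shows "diffeo_germ s"
proof -
  note * = smooth_inverseD[OF assms]
  have "homeomorphism U V s t"
    unfolding homeomorphism_def using * smooth_on_continuous_on by blast
  with * show ?thesis unfolding diffeo_germ_def by blast
qed

lemma smooth_inverse_sym: "smooth_inverse U V s t \<Longrightarrow> smooth_inverse V U t s"
  unfolding smooth_inverse_def[of V] using smooth_inverseD[of U V s t] by blast

lemma diffeo_germ_inverse:
  assumes "diffeo_germ s"
  obtains t where "diffeo_germ t" "\<forall>\<^sub>F x in nhds 0. t (s x) = x" "\<forall>\<^sub>F x in nhds 0. s (t x) = x"
proof -
  obtain U V t where st: "smooth_inverse U V s t" by (rule diffeo_germE[OF assms])
  note * = smooth_inverseD[OF st]
  have "diffeo_germ t" by (rule diffeo_germI[OF smooth_inverse_sym[OF st]])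
  moreover have "\<forall>\<^sub>F x in nhds 0. t (s x) = x"
    unfolding eventually_nhds using *(1,3,9) by (intro exI[of _ U]) simp
  moreover have "\<forall>\<^sub>F x in nhds 0. s (t x) = x"
    unfolding eventually_nhds using *(2,4,10) by (intro exI[of _ V]) simp
  ultimately show ?thesis by (rule that)
qed

lemma open_vimage_smooth:
  assumes "open U" "smooth_on U s" "open V"
  shows "open {x \<in> U. s x \<in> V}"
proof -
  have "{x \<in> U. s x \<in> V} = U \<inter> s -` V" by blast
  then show ?thesis
    using continuous_open_preimage[OF smooth_on_continuous_on[OF assms(2)] assms(1,3)] by simp
qed

lemma diffeo_germ_compose:
  assumes "diffeo_germ s" "diffeo_germ s'"
  shows "diffeo_germ (\<lambda>x. s' (s x))"
proof -
  obtain U V t where "smooth_inverse U V s t" by (rule diffeo_germE[OF assms(1)])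
  note * = smooth_inverseD[OF this]
  obtain U' V' t' where "smooth_inverse U' V' s' t'" by (rule diffeo_germE[OF assms(2)])
  note # = smooth_inverseD[OF this]
  \<comment> \<open>The composite is restricted to the points that s sends into the domain of s',
    and its inverse to the points that t' sends into the image of s.\<close>
  let ?U = "{x \<in> U. s x \<in> U'}" and ?V = "{y \<in> V'. t' y \<in> V}"
  have o: "open ?U" "open ?V"
    by (rule open_vimage_smooth[OF *(1,11) #(1)] open_vimage_smooth[OF #(2,12) *(2)])+
  have in1: "t (t' (s' (s x))) = x" if "x \<in> ?U" for x
    using that *(9) #(9) by auto
  have im: "(\<lambda>x. s' (s x)) ` ?U = ?V"
  proof (rule equalityI[OF image_subsetI subsetI])
    fix x assume "x \<in> ?U"
    moreover from this have "s x \<in> V" "s' (s x) \<in> V'" using *(7) #(7) by blast+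
    ultimately show "s' (s x) \<in> ?V" using #(9) by auto
  next
    fix y assume y: "y \<in> ?V"
    then have "t' y \<in> U'" "t (t' y) \<in> U" using *(8) #(8) by blast+
    then show "y \<in> (\<lambda>x. s' (s x)) ` ?U"
      using y *(10) #(10) by (intro image_eqI[of _ _ "t (t' y)"]) auto
  qed
  have "smooth_on ?U (\<lambda>x. s' (s x))"
    by (rule smooth_on_compose[OF o(1) #(1) smooth_on_subset[OF *(11)] #(11)]) auto
  moreover have "smooth_on ?V (\<lambda>x. t (t' x))"
    by (rule smooth_on_compose[OF o(2) *(2) smooth_on_subset[OF #(12)] *(12)]) auto
  ultimately have "smooth_inverse ?U ?V (\<lambda>x. s' (s x)) (\<lambda>y. t (t' y))"
    unfolding smooth_inverse_def using im in1 o *(3,5) #(3,5) by auto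
  then show ?thesis by (rule diffeo_germI)
qed

lemma diffeo_germ_differentiable: "diffeo_germ s \<Longrightarrow> s differentiable (at 0)"
  by (meson diffeo_germ_def smooth_on_differentiable)

lemma det_jacobian_left_inverse:
  fixes s t :: "real^'m::finite \<Rightarrow> real^'m"
  assumes "open U" "x \<in> U" "s differentiable (at x)" "t differentiable (at (s x))"
    and "\<And>x. x \<in> U \<Longrightarrow> t (s x) = x"
  shows "jacobian t (at (s x)) ** jacobian s (at x) = mat 1" "det (jacobian s (at x)) \<noteq> 0"
proof -
  have "jacobian (\<lambda>x. t (s x)) (at x) = jacobian (\<lambda>x. mat 1 *v x) (at x)"
    by (rule jacobian_cong_open[OF assms(1,2)]) (simp add: assms(5))
  then show *: "jacobian t (at (s x)) ** jacobian s (at x) = mat 1"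
    using jacobian_compose(1)[OF assms(3,4)] by (simp only: jacobian_linear)
  then have "det (jacobian t (at (s x))) * det (jacobian s (at x)) = 1"
    by (metis det_I det_mul)
  then show "det (jacobian s (at x)) \<noteq> 0" by auto
qed

lemma diffeo_germ_det:
  assumes "diffeo_germ s"
  shows "det (jacobian s (at 0)) \<noteq> 0"
proof -
  obtain U V t where "smooth_inverse U V s t" by (rule diffeo_germE[OF assms])
  note * = smooth_inverseD[OF this]
  show ?thesis
    by (rule det_jacobian_left_inverse(2)[of U 0 s t])
      (use * in \<open>simp_all add: smooth_on_differentiable\<close>)
qed

lemma diffeo_germ_compose_det:
  assumes "diffeo_germ s" "diffeo_germ s'"
  shows "det (jacobian (\<lambda>x. s' (s x)) (at 0)) = det (jacobian s' (at 0)) * det (jacobian s (at 0))"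
  using jacobian_compose(1)[of s 0 s'] diffeo_germ_differentiable[OF assms(1)]
    diffeo_germ_differentiable[OF assms(2)] assms(1)[unfolded diffeo_germ_def] by (simp add: det_mul)

lemma jet_singleton:
  assumes "1 \<le> r" "diffeo_germ s"
  shows "jet r s [i] $ j = jacobian s (at 0) $ j $ i"
  using assms partials_single_nth[OF diffeo_germ_differentiable[OF assms(2)], of i j]
  by (simp add: jet_def jacobian_nth diffeo_germ_differentiable)

text \<open>Each derivative brings out one factor c. With b = 1/c the derivatives of order k \<ge> 1
  carry c^(k-1), which extends to c = 0.\<close>

lemma partials_scale:
  fixes s :: "real^'m::finite \<Rightarrow> real^'n::finite"
  assumes "open U" "smooth_on U s"
  shows "c *\<^sub>R x \<in> U \<Longrightarrow> partials is (\<lambda>x. b *\<^sub>R s (c *\<^sub>R x)) x = (b * c ^ length is) *\<^sub>R partials is s (c *\<^sub>R x)"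
proof (induction "is" arbitrary: x)
  case (Cons i js)
  let ?W = "{x::real^'m. c *\<^sub>R x \<in> U}"
  have "open ?W"
    using open_vimage[OF assms(1), of "\<lambda>x. c *\<^sub>R x"] by (simp add: vimage_def continuous_intros)
  then have "frechet_derivative (partials js (\<lambda>x. b *\<^sub>R s (c *\<^sub>R x))) (at x) =
      frechet_derivative (\<lambda>x. (b * c ^ length js) *\<^sub>R partials js s (c *\<^sub>R x)) (at x)"
    using Cons by (intro frechet_derivative_cong_open[of ?W]) auto
  moreover have "((\<lambda>x. (b * c ^ length js) *\<^sub>R partials js s (c *\<^sub>R x)) has_derivative
      (\<lambda>v. (b * c ^ length js) *\<^sub>R frechet_derivative (partials js s) (at (c *\<^sub>R x)) (c *\<^sub>R v))) (at x)"
  proof (intro has_derivative_scaleR_right)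
    have "(partials js s has_derivative frechet_derivative (partials js s) (at (c *\<^sub>R x))) (at (c *\<^sub>R x))"
      using assms(2) Cons.prems unfolding smooth_on_def using frechet_derivative_works by blast
    moreover have "((\<lambda>x. c *\<^sub>R x) has_derivative (\<lambda>v. c *\<^sub>R v)) (at x)"
      by (intro has_derivative_scaleR_right has_derivative_ident)
    ultimately show "((\<lambda>x. partials js s (c *\<^sub>R x)) has_derivative
        (\<lambda>v. frechet_derivative (partials js s) (at (c *\<^sub>R x)) (c *\<^sub>R v))) (at x)"
      using has_derivative_compose by blast
  qed
  ultimately have "partials (i # js) (\<lambda>x. b *\<^sub>R s (c *\<^sub>R x)) x =
     (b * c ^ length js) *\<^sub>R frechet_derivative (partials js s) (at (c *\<^sub>R x)) (c *\<^sub>R axis i 1)"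
    using frechet_derivative_at by (metis (no_types, lifting) partials.simps(2))
  also have "frechet_derivative (partials js s) (at (c *\<^sub>R x)) (c *\<^sub>R axis i 1) =
     c *\<^sub>R frechet_derivative (partials js s) (at (c *\<^sub>R x)) (axis i 1)"
    using assms(2) Cons.prems unfolding smooth_on_def
    by (intro linear_scale linear_frechet_derivative) blast
  finally show ?case by (simp add: algebra_simps)
qed simp

section \<open>Paths in the space of jets of diffeomorphisms\<close>

lemma Diff_jets_linear: "det A \<noteq> 0 \<Longrightarrow> jet r (\<lambda>x. A *v x) \<in> Diff_jets r"
  unfolding Diff_jets_def using diffeo_germ_linear by blast

text \<open>Jets carry the product topology over index lists, so continuity is checked one list at a
  time. At 0 a linear map has nonzero derivatives for lists of length one only, and these are the
  columns of A.\<close>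

lemma continuous_jet_linear:
  "continuous_on UNIV (\<lambda>A::real^'m::finite^'m. jet r (\<lambda>x. A *v x))"
proof (rule continuous_on_coordinatewise_then_product)
  fix "is" :: "'m list"
  show "continuous_on UNIV (\<lambda>A::real^'m^'m. jet r (\<lambda>x. A *v x) is)"
  proof (cases "is")
    case (Cons i js)
    have "continuous_on UNIV (\<lambda>A::real^'m^'m. column i A)"
      unfolding column_def by (intro continuous_on_vec_lambda continuous_intros)
    then show ?thesis
      using Cons
      by (cases "length is \<le> r"; cases "js = []") (simp_all add: jet_def partials_linear del: partials.simps)
  qed (auto simp: jet_def)
qed

lemma path_component_jet_linear:
  assumes "path_component GLm A B"
  shows "path_component (Diff_jets r) (jet r (\<lambda>x. A *v x)) (jet r (\<lambda>x. B *v x))"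
proof -
  obtain g where g: "path g" "path_image g \<subseteq> GLm" "pathstart g = A" "pathfinish g = B"
    using assms unfolding path_component_def by blast
  let ?F = "\<lambda>A. jet r (\<lambda>x. A *v x)"
  have "path (?F \<circ> g)"
    by (rule path_continuous_image[OF g(1)]) (rule continuous_on_subset[OF continuous_jet_linear], simp)
  moreover have "path_image (?F \<circ> g) \<subseteq> Diff_jets r"
    using g(2) by (auto simp: path_image_def GLm_def intro!: Diff_jets_linear)
  ultimately show ?thesis
    unfolding path_component_def using g(3,4) by (intro exI[of _ "?F \<circ> g"]) (auto simp: path_defs)
qed

text \<open>The rescalings \<open>x \<mapsto> s (t x) / t\<close> join a diffeomorphism to its linear part.\<close>

lemma path_component_jet_rescale:
  assumes "diffeo_germ s"
  shows "path_component (Diff_jets r) (jet r (\<lambda>x. jacobian s (at 0) *v x)) (jet r s)"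
proof -
  obtain U where *: "open U" "0 \<in> U" "s 0 = 0" "smooth_on U s"
    using assms unfolding diffeo_germ_def by blast
  \<comment> \<open>A closed formula for the jet of s(cx)/c that also makes sense at c = 0, where
    0^0 = 1 keeps the first-order terms and the higher ones vanish.\<close>
  define g where "g c = (\<lambda>is. if is = [] \<or> length is > r then 0 else c ^ (length is - 1) *\<^sub>R partials is s 0)"
    for c :: real
  have g0: "g 0 = jet r (\<lambda>x. jacobian s (at 0) *v x)"
  proof
    fix "is" :: "'a list"
    show "g 0 is = jet r (\<lambda>x. jacobian s (at 0) *v x) is"
    proof (cases "is")
      case (Cons i js)
      have "partials [i] s 0 = column i (jacobian s (at 0))"
        using diffeo_germ_differentiable[OF assms] partials_single_nth[of s 0 i]
        by (simp add: vec_eq_iff column_def jacobian_nth)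
      with Cons show ?thesis
        by (simp add: g_def jet_def partials_linear power_0_left del: partials.simps)
    qed (simp add: g_def jet_def)
  qed
  have g1: "g c = jet r (\<lambda>x. (1 / c) *\<^sub>R s (c *\<^sub>R x))" if "c > 0" for c
  proof
    fix "is" :: "'a list"
    have "partials is (\<lambda>x. (1/c) *\<^sub>R s (c *\<^sub>R x)) 0 = (1/c * c ^ length is) *\<^sub>R partials is s 0"
      using partials_scale[OF *(1,4), where c = c and x = 0 and b = "1/c" and ?is = "is"] *(2) by simp
    then show "g c is = jet r (\<lambda>x. (1 / c) *\<^sub>R s (c *\<^sub>R x)) is"
      using \<open>c > 0\<close> *(3) by (cases "is") (auto simp: g_def jet_def)
  qed
  have D: "g c \<in> Diff_jets r" if c: "c \<in> {0..1}" for c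
  proof (cases "c = 0")
    case True
    then show ?thesis using g0 Diff_jets_linear diffeo_germ_det[OF assms] by metis
  next
    case False
    with c have "c > 0" by simp
    have sc: "diffeo_germ (\<lambda>x::real^'a. d *\<^sub>R x)" if "d \<noteq> 0" for d
    proof -
      have "diffeo_germ (\<lambda>x::real^'a. (d *\<^sub>R mat 1) *v x)"
        by (rule diffeo_germ_linear) (use that in \<open>simp add: det_diagonal mat_def\<close>)
      then show ?thesis by (simp add: scaleR_matrix_vector_assoc[symmetric])
    qed
    have "diffeo_germ (\<lambda>x. (1 / c) *\<^sub>R s (c *\<^sub>R x))"
      using diffeo_germ_compose[OF diffeo_germ_compose[OF sc[of c] assms] sc[of "1/c"]] False by simp
    then show ?thesis using g1[OF \<open>c > 0\<close>] unfolding Diff_jets_def by blast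
  qed
  have "g 1 = jet r s" using g1[of 1] by simp
  moreover have "continuous_on {0..1} g"
  proof (rule continuous_on_coordinatewise_then_product)
    fix "is" :: "'a list"
    show "continuous_on {0..1} (\<lambda>c. g c is)"
      by (cases "is = [] \<or> length is > r") (auto simp: g_def intro!: continuous_intros)
  qed
  ultimately show ?thesis
    unfolding path_defs using g0 D by (intro exI[of _ g]) auto
qed

lemma jet_path_from_id:
  assumes "diffeo_germ s" "det (jacobian s (at 0)) > 0"
  obtains \<sigma> :: "real \<Rightarrow> 'm::finite list \<Rightarrow> real^'m" where "continuous_on {0..1} \<sigma>" "\<sigma> ` {0..1} \<subseteq> Diff_jets r"
    "\<sigma> 0 = jet r id" "\<sigma> 1 = jet r s"
proof -
  have "(\<lambda>x. mat 1 *v x) = (id :: real^'m \<Rightarrow> _)" by auto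
  then have "path_component (Diff_jets r) (jet r id) (jet r s)"
    using path_component_trans[OF path_component_jet_linear[OF path_component_GLm_pos[OF assms(2)]]
        path_component_jet_rescale[OF assms(1)], of r] by simp
  then obtain g where "path g" "path_image g \<subseteq> Diff_jets r" "pathstart g = jet r id" "pathfinish g = jet r s"
    unfolding path_component_def by blast
  then show ?thesis by (intro that[of g]) (simp_all add: path_defs)
qed

section \<open>Isotopy and diffeomorphisms with positive Jacobian determinant\<close>

lemma A_isotopicI:
  assumes "diffeo_germ s" "det (jacobian s (at 0)) > 0" "diffeo_germ t" "det (jacobian t (at 0)) > 0"
    and "\<forall>\<^sub>F x in nhds 0. g x = t (f (s x))"
  shows "A_isotopic r f g"
proof -
  obtain \<sigma> where s: "continuous_on {0..1::real} \<sigma>" "\<sigma> ` {0..1} \<subseteq> Diff_jets r" "\<sigma> 0 = jet r id" "\<sigma> 1 = jet r s"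
    by (rule jet_path_from_id[OF assms(1,2), of r])
  obtain \<tau> where t: "continuous_on {0..1::real} \<tau>" "\<tau> ` {0..1} \<subseteq> Diff_jets r" "\<tau> 0 = jet r id" "\<tau> 1 = jet r t"
    by (rule jet_path_from_id[OF assms(3,4), of r])
  have "jet r g = jet r (t \<circ> f \<circ> s)"
    using jet_cong[of g "t \<circ> f \<circ> s"] assms(5) by simp
  then show ?thesis
    unfolding A_isotopic_def using assms(1,3) s t
    by (intro exI[of _ \<sigma>] exI[of _ \<tau>] exI[of _ s] exI[of _ t]) simp
qed

text \<open>Since r \<ge> 1, a jet contains the Jacobian matrix, which thus moves continuously along
  the curve. Every jet on the curve is that of a diffeomorphism, so the determinant never vanishes
  and keeps the sign it has at the identity.\<close>

lemma det_pos_of_jet_path: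
  fixes s :: "real^'m::finite \<Rightarrow> real^'m"
  assumes "1 \<le> r" "continuous_on {0..1::real} \<sigma>" "\<sigma> ` {0..1} \<subseteq> Diff_jets r" "\<sigma> 0 = jet r id"
    "diffeo_germ s" "\<sigma> 1 = jet r s"
  shows "det (jacobian s (at 0)) > 0"
proof -
  define g where "g c = (\<chi> j i. \<sigma> c [i] $ j)" for c
  have gj: "g c = jacobian s' (at 0)" if "diffeo_germ s'" "\<sigma> c = jet r s'" for c s'
    using that jet_singleton[OF assms(1) that(1)] by (simp add: g_def vec_eq_iff)
  have "continuous_on {0..1} g"
  proof (rule continuous_on_matrix_entries)
    fix i j show "continuous_on {0..1} (\<lambda>c. g c $ i $ j)"
      using continuous_on_component[OF continuous_on_product_then_coordinatewise[OF assms(2)]]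
      by (simp add: g_def)
  qed
  moreover have "det (g c) \<noteq> 0" if "c \<in> {0..1}" for c
  proof -
    have "\<sigma> c \<in> Diff_jets r" using that assms(3) by (simp add: image_subset_iff)
    then obtain s' where "diffeo_germ s'" "\<sigma> c = jet r s'"
      unfolding Diff_jets_def by auto
    then show ?thesis using gj diffeo_germ_det by metis
  qed
  moreover have "det (g 0) > 0"
  proof -
    have id: "(\<lambda>x. mat 1 *v x) = (id :: real^'m \<Rightarrow> _)" by auto
    have "diffeo_germ (id :: real^'m \<Rightarrow> _)" using diffeo_germ_linear[of "mat 1 :: real^'m^'m"] id by simp
    then have "g 0 = mat 1" using gj[of id] assms(4) jacobian_linear[of "mat 1"] id by metis
    then show ?thesis by simp
  qed
  ultimately have "det (g 1) > 0" by (rule det_pos_along_path)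
  then show ?thesis using gj[OF assms(5,6)] by simp
qed

text \<open>Only the end points of the curves are kept. The outcome is an equality of jets, not of
  germs, so anything used to tell germs apart has to be readable from the jet.\<close>

lemma A_isotopicD:
  assumes "A_isotopic r f g" "1 \<le> r"
  obtains s t where "diffeo_germ s" "det (jacobian s (at 0)) > 0"
    "diffeo_germ t" "det (jacobian t (at 0)) > 0" "jet r g = jet r (\<lambda>x. t (f (s x)))"
proof -
  obtain \<sigma> \<tau> s t where *: "continuous_on {0..1::real} \<sigma>" "\<sigma> ` {0..1} \<subseteq> Diff_jets r" "\<sigma> 0 = jet r id"
    "continuous_on {0..1::real} \<tau>" "\<tau> ` {0..1} \<subseteq> Diff_jets r" "\<tau> 0 = jet r id"
    "diffeo_germ s" "\<sigma> 1 = jet r s" "diffeo_germ t" "\<tau> 1 = jet r t" "jet r g = jet r (t \<circ> f \<circ> s)"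
    using assms(1) unfolding A_isotopic_def by auto
  show ?thesis
    by (rule that[OF *(7) det_pos_of_jet_path[OF assms(2) *(1-3,7,8)] *(9) det_pos_of_jet_path[OF assms(2) *(4-6,9,10)]])
      (use *(11) in \<open>simp add: comp_def\<close>)
qed

section \<open>The Morin normal form\<close>

lemma bij_betw_pos: "bij_betw pos (UNIV :: 'n::{finite,linorder} set) {1..CARD('n)}"
proof -
  have mono: "pos i < pos j" if "i < j" for i j :: 'n
  proof -
    have "{k. k \<le> i} \<subset> {k. k \<le> j}"
    proof
      show "{k. k \<le> i} \<subseteq> {k. k \<le> j}" using that by auto
      have "j \<notin> {k. k \<le> i}" "j \<in> {k. k \<le> j}" using that by (auto simp: not_le)
      then show "{k. k \<le> i} \<noteq> {k. k \<le> j}" by metis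
    qed
    then show ?thesis unfolding pos_def by (intro psubset_card_mono) auto
  qed
  then have inj: "inj (pos :: 'n \<Rightarrow> nat)"
    by (metis (mono_tags, lifting) injI linorder_less_linear order_less_irrefl)
  have "pos ` (UNIV :: 'n set) \<subseteq> {1..CARD('n)}"
  proof safe
    fix i :: 'n
    have "card {j. j \<le> i} > 0" by (auto simp: card_gt_0_iff)
    moreover have "card {j. j \<le> i} \<le> CARD('n)" by (rule card_mono) auto
    ultimately show "pos i \<in> {1..CARD('n)}" by (simp add: pos_def)
  qed
  moreover have "card (pos ` (UNIV :: 'n set)) = card {1..CARD('n)}"
    using card_image[OF inj] by simp
  ultimately have "pos ` (UNIV :: 'n set) = {1..CARD('n)}"
    by (intro card_subset_eq) auto
  with inj show ?thesis by (simp add: bij_betw_def)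
qed

lemma pos_inject: "pos i = pos j \<longleftrightarrow> i = (j :: 'n::{finite,linorder})"
  using bij_betw_pos[where 'n='n] by (auto simp: bij_betw_def inj_def)

lemma pos_range: "1 \<le> pos i" "pos (i :: 'n::{finite,linorder}) \<le> CARD('n)"
  using bij_betw_apply[OF bij_betw_pos, of i] by auto

lemma coord_pos: "coord (pos i) = (i :: 'n::{finite,linorder})"
  unfolding coord_def by (rule the_equality) (auto simp: pos_inject)

lemma pos_coord: "1 \<le> k \<Longrightarrow> k \<le> CARD('n) \<Longrightarrow> pos (coord k :: 'n::{finite,linorder}) = k"
proof -
  assume "1 \<le> k" "k \<le> CARD('n)"
  then obtain i :: 'n where "k = pos i"
    using bij_betw_imp_surj_on[OF bij_betw_pos[where 'n='n]] by (metis atLeastAtMost_iff imageE)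
  then show ?thesis by (simp add: coord_pos)
qed

lemma pos_eq_iff: "1 \<le> k \<Longrightarrow> k \<le> CARD('n) \<Longrightarrow> pos i = k \<longleftrightarrow> i = (coord k :: 'n::{finite,linorder})"
  using pos_coord coord_pos by metis

lemma pos_eq_1_iff: "pos i = Suc 0 \<longleftrightarrow> i = (coord 1 :: 'n::{finite,linorder})"
  using pos_eq_iff[of 1 i] by simp

lemma sum_over_pos:
  "(\<Sum>i\<in>UNIV. g (pos (i::'n::{finite,linorder}))) = sum g {1..CARD('n)}"
  by (rule sum.reindex_bij_betw[OF bij_betw_pos])

lemma prod_over_pos:
  "(\<Prod>i\<in>UNIV. g (pos (i::'n::{finite,linorder}))) = prod g {1..CARD('n)}"
  by (rule prod.reindex_bij_betw[OF bij_betw_pos])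

lemma bij_betw_pos_compl:
  "bij_betw pos (- {coord 1 :: 'n::{finite,linorder}}) {2..CARD('n)}"
proof -
  have "{2..CARD('n)} = {1..CARD('n)} - {1}" by auto
  moreover have "bij_betw pos (UNIV - {coord 1 :: 'n}) ({1..CARD('n)} - {1})"
    using bij_betw_DiffI[OF bij_betw_pos[where 'n='n], of "{coord 1}" "{1}"] pos_coord[of 1, where 'n='n]
    by (simp add: bij_betw_def)
  ultimately show ?thesis by (simp add: Compl_eq_Diff_UNIV)
qed

text \<open>The i-th derivative of x^m. For i > m the falling factorial contains the factor 0, so
  the value is right although m - i is truncated.\<close>

definition power_deriv :: "nat \<Rightarrow> nat \<Rightarrow> real \<Rightarrow> real" where
  "power_deriv i m x = (\<Prod>k<i. real m - real k) * x ^ (m - i)"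

lemma power_deriv_0 [simp]: "power_deriv 0 m x = x ^ m"
  by (simp add: power_deriv_def)

lemma power_deriv_at_0: "power_deriv i m 0 = (if i = m then fact m else 0)"
proof -
  have "(\<Prod>k<m. real m - real k) = fact m"
  proof -
    have "(\<Prod>k<m. real m - real k) = (\<Prod>k = 0..<m. real (m - k))"
      by (rule prod.cong) (auto simp: of_nat_diff)
    then show ?thesis by (simp add: fact_prod_rev)
  qed
  then show ?thesis
    by (cases "m < i") (auto simp: power_deriv_def power_0_left)
qed

lemma power_deriv_deriv:
  "(power_deriv i m has_field_derivative power_deriv (Suc i) m x) (at x)"
proof (cases "i < m")
  case True
  then obtain d where "m = i + Suc d" using less_imp_Suc_add by auto
  then show ?thesis
    unfolding power_deriv_def
    using DERIV_cmult[OF DERIV_pow[of "Suc d" x], of "\<Prod>k<i. real m - real k"]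
    by (simp add: algebra_simps)
next
  case False
  then have "power_deriv i m = (\<lambda>x. \<Prod>k<i. real m - real k)" "power_deriv (Suc i) m x = 0"
    by (auto simp: power_deriv_def fun_eq_iff)
  then show ?thesis by simp
qed

text \<open>The k-th x_1-derivative of the first component of the normal form. The sum runs over the
  coordinates other than the first, with \<open>pos i\<close> in the role of j, so that partial
  derivatives need no conversion between numbers and indices.\<close>

definition morin_poly :: "nat \<Rightarrow> real^'n::{finite,linorder} \<Rightarrow> real" where
  "morin_poly k x = (\<Sum>i\<in>-{coord 1}. power_deriv k (pos i - 1) (x $ coord 1) * x $ i)
     + power_deriv k (CARD('n) + 1) (x $ coord 1)"

lemma has_derivative_power_deriv_coord:
  "((\<lambda>x::real^'m::finite. power_deriv k m (x $ c)) has_derivative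
     (\<lambda>v. v $ c * power_deriv (Suc k) m (x $ c))) (at x)"
  using has_derivative_compose[OF has_derivative_coord[of c x]
      power_deriv_deriv[of k m "x $ c", unfolded has_field_derivative_def]]
  by (simp add: mult.commute)

lemma has_derivative_morin_poly:
  fixes x :: "real^'n::{finite,linorder}"
  shows "(morin_poly k has_derivative (\<lambda>v. morin_poly (Suc k) x * v $ coord 1 +
     (\<Sum>i\<in>-{coord 1}. power_deriv k (pos i - 1) (x $ coord 1) * v $ i))) (at x)"
  unfolding morin_poly_def
  by (auto intro!: derivative_eq_intros has_derivative_power_deriv_coord has_derivative_coord
      simp: fun_eq_iff algebra_simps sum.distrib sum_distrib_left sum_distrib_right)

lemma pdv_morin_poly:
  fixes x :: "real^'n::{finite,linorder}"
  shows "pdv j (morin_poly k) x =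
    (if j = coord 1 then morin_poly (Suc k) x else power_deriv k (pos j - 1) (x $ coord 1))"
proof -
  have "(\<Sum>i\<in>-{coord 1}. power_deriv k (pos i - 1) (x $ coord 1) * axis j 1 $ i)
    = (if j = coord 1 then 0 else power_deriv k (pos j - 1) (x $ coord 1))"
  proof (cases "j = coord 1")
    case True
    then show ?thesis by (auto simp: axis_def intro!: sum.neutral)
  next
    case False
    then show ?thesis
      by (subst sum.remove[of _ j]) (auto simp: axis_def intro!: sum.neutral)
  qed
  then show ?thesis
    by (subst pdv_eqI[OF has_derivative_morin_poly]) (auto simp: axis_def)
qed

lemma sm_power_deriv: "sm U (\<lambda>x::real^'m::finite. power_deriv k m (x $ c))"
proof -
  have "sm UNIV (\<lambda>x::real^'m. power_deriv k m (x $ c))"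
    unfolding power_deriv_def by (intro sm_mult sm_const sm_power sm_coord open_UNIV)
  then show ?thesis using sm_subset by blast
qed

lemma sm_morin_poly: "sm U (morin_poly k)"
proof -
  have "sm UNIV (\<lambda>x. morin_poly k x)"
    unfolding morin_poly_def
    by (intro sm_add sm_sum sm_mult sm_const sm_coord sm_power_deriv open_UNIV)
  then show ?thesis using sm_subset by auto
qed

text \<open>The terms with a factor x_j, j \<ge> 2, vanish at 0, and what is left is the k-th
  derivative of x_1^(n+1). That the value for k = n + 1 is nonzero makes \<eta>^n \<lambda>(0)
  nonzero in the end.\<close>

lemma morin_poly_at_0:
  "morin_poly k (0 :: real^'n::{finite,linorder}) = (if k = CARD('n) + 1 then fact (CARD('n) + 1) else 0)"
  by (simp add: morin_poly_def power_deriv_at_0)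

abbreviation morin_normal :: "real^'n::{finite,linorder} \<Rightarrow> (real, 'n) vec" where
  "morin_normal \<equiv> morin_map CARD('n)"

lemma morin_map_nth:
  "morin_normal x $ i = (if i = coord 1 then morin_poly 0 x else x $ (i :: 'n::{finite,linorder}))"
proof -
  have "(\<Sum>i\<in>-{coord 1 :: 'n}. x $ coord 1 ^ (pos i - 1) * x $ coord (pos i)) =
    (\<Sum>j=2..CARD('n). x $ coord 1 ^ (j - 1) * x $ coord j)"
    by (rule sum.reindex_bij_betw[OF bij_betw_pos_compl, of "\<lambda>j. x $ coord 1 ^ (j - 1) * x $ coord j"])
  then show ?thesis by (simp add: morin_map_def pos_eq_1_iff morin_poly_def coord_pos)
qed

lemma smooth_on_morin: "smooth_on U (morin_normal :: real^'n::{finite,linorder} \<Rightarrow> _)"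
proof -
  have "sm UNIV (\<lambda>x. morin_normal x $ i)" for i :: 'n
    by (cases "i = coord 1") (simp_all add: morin_map_nth sm_morin_poly sm_coord)
  then have "smooth_on UNIV (morin_normal :: (real, 'n) vec \<Rightarrow> _)"
    by (simp add: smooth_on_iff_sm)
  then show ?thesis by (rule smooth_on_subset) simp
qed

lemma morin_at_0: "morin_normal (0 :: real^'n::{finite,linorder}) = 0"
  by (simp add: vec_eq_iff morin_map_nth morin_poly_at_0)

text \<open>Only one term of the Leibniz expansion survives. The permutation q is the identity for
  triangular patterns and a cycle for the gradients of \<open>morin_poly\<close>.\<close>

lemma det_unique_permutation:
  fixes A :: "real^'m::finite^'m"
  assumes "q permutes UNIV" "\<And>p. p permutes UNIV \<Longrightarrow> p \<noteq> q \<Longrightarrow> \<exists>i. A $ i $ p i = 0"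
  shows "det A = of_int (sign q) * (\<Prod>i\<in>UNIV. A $ i $ q i)"
proof -
  let ?t = "\<lambda>p. of_int (sign p) * (\<Prod>i\<in>UNIV. A $ i $ p i)"
  have "det A = (\<Sum>p\<in>{p. p permutes UNIV}. ?t p)" by (simp add: det_def)
  also have "\<dots> = (\<Sum>p\<in>{q}. ?t p)"
  proof (rule sum.mono_neutral_right)
    show "\<forall>p\<in>{p. p permutes UNIV} - {q}. ?t p = 0"
    proof
      fix p assume "p \<in> {p. p permutes UNIV} - {q}"
      then obtain i where "A $ i $ p i = 0" using assms(2)[of p] by auto
      then have "(\<Prod>i\<in>UNIV. A $ i $ p i) = 0" by (intro prod_zero) auto
      then show "?t p = 0" by simp
    qed
  qed (use assms(1) in auto)
  finally show ?thesis by simp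
qed

lemma det_jacobian_morin:
  "det (jacobian morin_normal (at x)) = morin_poly 1 (x :: real^'n::{finite,linorder})"
proof -
  let ?A = "jacobian morin_normal (at x)"
  have "(morin_normal :: (real, 'n) vec \<Rightarrow> _) differentiable (at x)"
    using smooth_on_differentiable[OF smooth_on_morin[of UNIV]] by simp
  note A = jacobian_nth[OF this]
  have A1: "?A $ i $ j = (if i = j then 1 else 0)" if "i \<noteq> coord 1" for i j
    using that by (auto simp: A morin_map_nth pdv_coord)
  have A2: "?A $ coord 1 $ coord 1 = morin_poly 1 x"
    by (simp add: A morin_map_nth pdv_morin_poly)
  have "det ?A = of_int (sign (id :: 'n \<Rightarrow> 'n)) * (\<Prod>i\<in>UNIV. ?A $ i $ id i)"
  proof (rule det_unique_permutation)
    fix p :: "'n \<Rightarrow> 'n" assume p: "p permutes UNIV" "p \<noteq> id"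
    \<comment> \<open>A permutation different from the identity moves at least two indices, so it
      moves one whose row is a unit vector.\<close>
    have "\<exists>i. i \<noteq> coord 1 \<and> p i \<noteq> i"
    proof (rule ccontr)
      assume "\<not> ?thesis"
      then have fixed: "p i = i" if "i \<noteq> coord 1" for i using that by blast
      moreover have "p (coord 1) = coord 1"
        using fixed[of "p (coord 1)"] permutes_inj[OF p(1)] by (metis injD)
      ultimately have "p = id" by (metis eq_id_iff)
      with p show False by simp
    qed
    then obtain i where "i \<noteq> coord 1" "p i \<noteq> i" by blast
    then have "?A $ i $ p i = 0" using A1 by (simp del: One_nat_def)
    then show "\<exists>i. ?A $ i $ p i = 0" by blast
  qed (rule permutes_id)
  also have "(\<Prod>i\<in>UNIV. ?A $ i $ id i) = ?A $ coord 1 $ coord 1"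
    by (subst prod.remove[of _ "coord 1"]) (auto simp: A1 intro!: prod.neutral)
  finally show ?thesis using A2 by simp
qed

text \<open>The cycle 1 -> m, j -> j - 1 on the positions 1, ..., m. For m = n it gives, for each
  row, the column of the one nonzero entry in the matrix of gradients of \<open>morin_poly\<close>
  at 0.\<close>

definition cyc :: "nat \<Rightarrow> 'n::{finite,linorder} \<Rightarrow> 'n" where
  "cyc m i = (if pos i = 1 then coord m else if pos i \<le> m then coord (pos i - 1) else i)"

text \<open>Passing from m to m + 1 composes the cycle with the transposition of the positions m and
  m + 1.\<close>

lemma cyc_sign:
  assumes "m \<ge> 1" "m \<le> CARD('n)"
  shows "cyc m permutes (UNIV :: 'n::{finite,linorder} set) \<and> sign (cyc m :: 'n \<Rightarrow> 'n) = (-1) ^ (m - 1)"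
  using assms
proof (induction m rule: dec_induct)
  case base
  have "cyc 1 = (id :: 'n \<Rightarrow> 'n)"
    by (auto simp: cyc_def fun_eq_iff pos_eq_1_iff) (metis le_antisym pos_eq_1_iff pos_range(1) One_nat_def)
  then show ?case by (simp only: permutes_id sign_id diff_self_eq_0 power_0 simp_thms)
next
  case (step m)
  let ?t = "Transposition.transpose (coord m) (coord (Suc m)) :: 'n \<Rightarrow> 'n"
  have eq: "cyc (Suc m) = ?t \<circ> (cyc m :: 'n \<Rightarrow> 'n)"
  proof
    fix i :: 'n
    have pc: "coord k = (coord l :: 'n) \<longleftrightarrow> k = l" if "1 \<le> k" "k \<le> CARD('n)" "1 \<le> l" "l \<le> CARD('n)" for k l
    proof
      assume "coord k = (coord l :: 'n)"
      from arg_cong[OF this, of pos] show "k = l" using that by (simp add: pos_coord)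
    qed simp
    have i: "i = coord (pos i)" "1 \<le> pos i" "pos i \<le> CARD('n)" using pos_range[of i] coord_pos[of i] by auto
    consider "pos i = 1" | "1 < pos i" "pos i \<le> m" | "pos i = Suc m" | "Suc m < pos i"
      using i by linarith
    then show "cyc (Suc m) i = (?t \<circ> cyc m) i"
    proof cases
      case 2
      then show ?thesis
        using pc[of "pos i - 1" m] pc[of "pos i - 1" "Suc m"] step.hyps step.prems i
        by (auto simp: cyc_def Transposition.transpose_def)
    next
      case 3
      then show ?thesis
        using pc[of m "Suc m"] step i by (simp add: cyc_def Transposition.transpose_def)
    next
      case 4
      then have "i \<noteq> coord m" "i \<noteq> coord (Suc m)" using step by (auto simp: pos_coord)
      then show ?thesis using 4 by (simp add: cyc_def Transposition.transpose_def)
    qed (use step in \<open>simp add: cyc_def\<close>)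
  qed
  have ne: "coord m \<noteq> (coord (Suc m) :: 'n)"
  proof
    assume "coord m = (coord (Suc m) :: 'n)"
    from arg_cong[OF this, of pos] show False using step.hyps step.prems by (simp add: pos_coord)
  qed
  have tr: "?t permutes (UNIV :: 'n set)"
    by (rule permutes_swap_id) auto
  have IH: "cyc m permutes (UNIV :: 'n set)" "sign (cyc m :: 'n \<Rightarrow> 'n) = (-1) ^ (m - 1)"
    using step by auto
  have "sign (cyc (Suc m) :: 'n \<Rightarrow> 'n) = sign ?t * sign (cyc m :: 'n \<Rightarrow> 'n)"
    unfolding eq
    by (rule sign_compose[OF permutes_imp_permutation[OF _ tr] permutes_imp_permutation[OF _ IH(1)]]) simp_all
  also have "\<dots> = (-1) ^ (Suc m - 1)"
    using IH ne step by (cases m) (auto simp: sign_swap_id)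
  finally show ?case using permutes_compose[OF IH(1) tr] unfolding eq by (simp add: comp_def)
qed

text \<open>At 0 the gradient of \<open>morin_poly k\<close> is k! e_(k+1) for k < n and (n+1)! e_1
  for k = n. The matrix is a cyclic permutation matrix with positive weights, and the sign of the
  cycle is (-1)^(n-1).\<close>

lemma det_morin_gradients:
  obtains C where "C > 0"
    "det (\<chi> i j. pdv i (morin_poly (pos j)) (0 :: real^'n::{finite,linorder})) = (-1) ^ (CARD('n) - 1) * C"
proof -
  let ?n = "CARD('n)"
  define A :: "((real, 'n) vec, 'n) vec" where "A = (\<chi> i j. pdv i (morin_poly (pos j)) 0)"
  have n: "1 \<le> ?n" by (simp add: Suc_leI)
  have A: "A $ i $ j = (if i = coord 1 then (if pos j = ?n then fact (?n + 1) else 0)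
    else if pos j = pos i - 1 then fact (pos j) else 0)" for i j
    by (simp add: A_def pdv_morin_poly morin_poly_at_0 power_deriv_at_0)
  have c: "pos (cyc ?n i) = (if i = coord 1 then ?n else pos i - 1)" for i :: 'n
    using pos_range[of i] pos_coord[of 1, where 'n='n] pos_eq_1_iff[of i] n
    by (auto simp: cyc_def intro!: pos_coord)
  have "det A = of_int (sign (cyc ?n :: 'n \<Rightarrow> 'n)) * (\<Prod>i\<in>UNIV. A $ i $ cyc ?n i)"
  proof (rule det_unique_permutation)
    show "cyc ?n permutes (UNIV :: 'n set)" using cyc_sign[of ?n] n by blast
    fix p :: "'n \<Rightarrow> 'n" assume "p permutes UNIV" "p \<noteq> cyc ?n"
    then obtain i where "p i \<noteq> cyc ?n i" by auto
    then have "pos (p i) \<noteq> pos (cyc ?n i)" by (simp add: pos_inject)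
    then have "A $ i $ p i = 0" by (auto simp: A c split: if_splits)
    then show "\<exists>i. A $ i $ p i = 0" by blast
  qed
  moreover have "sign (cyc ?n :: 'n \<Rightarrow> 'n) = (-1) ^ (?n - 1)" using cyc_sign[of ?n] n by blast
  moreover have "(\<Prod>i\<in>UNIV. A $ i $ cyc ?n i) > 0"
    by (rule prod_pos) (auto simp: A c)
  ultimately show ?thesis using that unfolding A_def by simp
qed

section \<open>Sign matrices and the symmetry of the normal form\<close>

definition diagonal_mat :: "('m::finite \<Rightarrow> real) \<Rightarrow> real^'m^'m" where
  "diagonal_mat d = (\<chi> i j. if i = j then d i else 0)"

lemma det_diagonal_mat: "det (diagonal_mat d) = (\<Prod>i\<in>UNIV. d i)"
  by (subst det_diagonal) (auto simp: diagonal_mat_def)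

lemma diagonal_mat_mult_nth: "(diagonal_mat d *v x) $ i = d i * x $ i"
  by (simp add: diagonal_mat_def matrix_vector_mult_def if_distrib[of "\<lambda>c. c * _"] cong: if_cong)

text \<open>If k exceeds the dimension, this is the identity; it happens for k = 2 on the
  line.\<close>

definition sign_at :: "nat \<Rightarrow> real \<Rightarrow> real^'n::{finite,linorder}^'n::{finite,linorder}" where
  "sign_at k e = diagonal_mat (\<lambda>i. if pos i = k then e else 1)"

lemma det_sign_at:
  assumes "1 \<le> k" "k \<le> CARD('n)"
  shows "det (sign_at k e :: real^'n::{finite,linorder}^'n::{finite,linorder}) = e"
proof -
  have "(\<Prod>i\<in>(UNIV::'n set). if pos i = k then e else 1) = (\<Prod>j=1..CARD('n). if j = k then e else 1)"
    by (rule prod_over_pos)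
  also have "\<dots> = e" using assms by simp
  finally show ?thesis by (simp add: sign_at_def det_diagonal_mat)
qed

lemma sign_at_1: "sign_at k 1 = (mat 1 :: real^'n::{finite,linorder}^'n::{finite,linorder})"
  by (simp add: sign_at_def diagonal_mat_def mat_def vec_eq_iff)

text \<open>Exhibits the signed germ as a linear target map, the normal form and a linear source
  map. So \<open>e1\<close> is the determinant in the target and \<open>e2\<close> the one in the
  source; \<open>e2\<close> shows up in two components because it is substituted for x_2.\<close>

lemma morin_sgn_eq:
  assumes "2 \<le> CARD('n)"
  shows "morin_sgn CARD('n) e1 e2 x =
    sign_at 1 e1 *v morin_normal (sign_at 2 e2 *v (x :: real^'n::{finite,linorder}))"
proof -
  have c: "pos (coord 1 :: 'n) = 1" "pos (coord 2 :: 'n) = 2"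
    using assms by (auto intro!: pos_coord)
  let ?y = "sign_at 2 e2 *v x"
  have y: "?y $ i = (if pos i = 2 then e2 else 1) * x $ i" for i
    by (simp add: sign_at_def diagonal_mat_mult_nth)
  have "(\<Sum>j=2..CARD('n). ?y $ coord 1 ^ (j - 1) * ?y $ coord j) =
    e2 * x $ coord 2 * x $ coord 1 + (\<Sum>j=3..CARD('n). x $ coord j * x $ coord 1 ^ (j - 1))"
  proof -
    have "(\<Sum>j=2..CARD('n). ?y $ coord 1 ^ (j - 1) * ?y $ coord j) =
      ?y $ coord 1 * ?y $ coord 2 + (\<Sum>j=3..CARD('n). ?y $ coord 1 ^ (j - 1) * ?y $ coord j)"
      using assms by (subst sum.atLeast_Suc_atMost) (auto simp: numeral_3_eq_3)
    also have "(\<Sum>j=3..CARD('n). ?y $ coord 1 ^ (j - 1) * ?y $ coord j) =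
      (\<Sum>j=3..CARD('n). x $ coord j * x $ coord 1 ^ (j - 1))"
      by (rule sum.cong) (auto simp: y c pos_coord simp del: One_nat_def)
    finally show ?thesis by (simp add: y c del: One_nat_def)
  qed
  moreover have "?y $ coord 1 = x $ coord 1" by (simp add: y c del: One_nat_def)
  ultimately have m: "morin_normal ?y $ i = (if pos i = 1 then e2 * x $ coord 2 * x $ coord 1 +
      (\<Sum>j=3..CARD('n). x $ coord j * x $ coord 1 ^ (j - 1)) + x $ coord 1 ^ (CARD('n) + 1)
      else (if pos i = 2 then e2 else 1) * x $ i)" for i
    by (simp add: morin_map_def y c del: One_nat_def)
  show ?thesis
    by (simp add: vec_eq_iff morin_sgn_def sign_at_def[of 1] diagonal_mat_mult_nth m del: One_nat_def)
qed

lemma fold_sgn_eq: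
  assumes "CARD('n) = 1"
  shows "fold_sgn e1 x = sign_at 1 e1 *v morin_normal (x :: real^'n::{finite,linorder})"
proof -
  have "pos i = 1" for i :: 'n using pos_range[of i] assms by simp
  then have "i = coord 1" for i :: 'n using coord_pos[of i] by metis
  then have "x $ i = x $ coord 1" for i by metis
  then have sq: "(x $ i)\<^sup>2 = x $ coord (Suc 0) * x $ coord (Suc 0)" for i
    by (metis One_nat_def power2_eq_square)
  show ?thesis
    using assms \<open>\<And>i :: 'n. pos i = 1\<close>
    by (simp add: vec_eq_iff fold_sgn_def sign_at_def diagonal_mat_mult_nth morin_map_def sq)
qed

definition sym_source :: "real^'n::{finite,linorder}^'n::{finite,linorder}" where
  "sym_source = diagonal_mat (\<lambda>i. if pos i = 1 then -1 else (-1) ^ (CARD('n) + 2 - pos i))"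

definition sym_target :: "real^'n::{finite,linorder}^'n::{finite,linorder}" where
  "sym_target = diagonal_mat (\<lambda>i. if pos i = 1 then (-1) ^ (CARD('n) + 1) else (-1) ^ (CARD('n) + 2 - pos i))"

text \<open>The normal form is weighted homogeneous, with weight \<open>1\<close> for \<open>x\<^sub>1\<close> and \<open>n + 2 - j\<close> for \<open>x\<^sub>j\<close>;
  this is the scaling by \<open>-1\<close>.\<close>

lemma morin_symmetry:
  "sym_target *v morin_normal (sym_source *v x) = morin_normal (x :: real^'n::{finite,linorder})"
proof -
  let ?n = "CARD('n)"
  have y1: "(sym_source *v x) $ coord 1 = - x $ coord 1"
    by (simp add: sym_source_def diagonal_mat_mult_nth pos_eq_1_iff)
  have y: "(sym_source *v x) $ i = (-1) ^ (?n + 2 - pos i) * x $ i" if "i \<noteq> coord 1" for i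
    using that by (simp add: sym_source_def diagonal_mat_mult_nth pos_eq_1_iff)
  \<comment> \<open>Each monomial x_1^(j-1) x_j has weight (j-1) + (n+2-j) = n+1, like
    x_1^(n+1).\<close>
  have t: "(- x $ coord 1) ^ (pos i - 1) * ((-1) ^ (?n + 2 - pos i) * x $ i) =
     (-1) ^ (?n + 1) * (x $ coord 1 ^ (pos i - 1) * x $ i)" for i
  proof -
    have "(- x $ coord 1) ^ (pos i - 1) * (-1) ^ (?n + 2 - pos i) =
      ((-1) ^ (pos i - 1) * (-1) ^ (?n + 2 - pos i)) * x $ coord 1 ^ (pos i - 1)"
      by (subst power_minus) simp
    also have "(-1) ^ (pos i - 1) * (-1) ^ (?n + 2 - pos i) = (-1 :: real) ^ (?n + 1)"
      using pos_range[of i] by (subst power_add[symmetric]) (rule arg_cong[of _ _ "\<lambda>m. (-1) ^ m"], linarith)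
    finally show ?thesis by (simp add: algebra_simps)
  qed
  have "morin_poly 0 (sym_source *v x) = (-1) ^ (?n + 1) * morin_poly 0 x"
  proof -
    have "(\<Sum>i\<in>-{coord 1}. (sym_source *v x) $ coord 1 ^ (pos i - 1) * (sym_source *v x) $ i) =
      (\<Sum>i\<in>-{coord 1}. (-1) ^ (?n + 1) * (x $ coord 1 ^ (pos i - 1) * x $ i))"
      unfolding y1 by (rule sum.cong) (use y t in auto)
    moreover have "(- x $ coord 1) ^ (?n + 1) = (-1) ^ (?n + 1) * x $ coord 1 ^ (?n + 1)"
      by (rule power_minus)
    ultimately show ?thesis
      unfolding morin_poly_def power_deriv_0 y1 by (simp only: sum_distrib_left[symmetric] distrib_left)
  qed
  moreover have "(-1) ^ k * ((-1) ^ k * z) = (z :: real)" for k z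
    by (simp add: mult.assoc[symmetric] power_mult_distrib[symmetric])
  ultimately show ?thesis
    by (auto simp: vec_eq_iff sym_target_def diagonal_mat_mult_nth morin_map_nth pos_eq_1_iff y
        simp del: power_Suc)
qed

text \<open>The source weights are 1 and n, ..., 2, with sum n(n+1)/2. In the target the first
  weight is n + 1 instead of 1, which adds n.\<close>

lemma det_sym:
  "det (sym_source :: real^'n::{finite,linorder}^'n::{finite,linorder}) = (-1) ^ (CARD('n) * (CARD('n) + 1) div 2)"
  "det (sym_target :: ((real, 'n) vec, 'n) vec) = (-1) ^ (CARD('n) * (CARD('n) + 1) div 2 + CARD('n))"
proof -
  let ?n = "CARD('n)"
  have n: "1 \<le> ?n" by (simp add: Suc_leI)
  have *: "(\<Prod>j=1..?n. if j = 1 then e else (-1) ^ (?n + 2 - j)) = e * (-1) ^ (\<Sum>j=2..?n. j)" for e :: real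
  proof -
    have "(\<Prod>j=1..?n. if j = 1 then e else (-1) ^ (?n + 2 - j)) = e * (\<Prod>j=2..?n. (-1) ^ (?n + 2 - j))"
      using n by (subst prod.atLeast_Suc_atMost) (auto simp: numeral_2_eq_2)
    also have "(\<Prod>j=2..?n. (-1::real) ^ (?n + 2 - j)) = (-1) ^ (\<Sum>j=2..?n. ?n + 2 - j)"
      by (simp add: power_sum)
    also have "(\<Sum>j=2..?n. ?n + 2 - j) = (\<Sum>j=2..?n. j)"
      by (subst sum.atLeastAtMost_rev) (rule sum.cong, auto)
    finally show ?thesis .
  qed
  have s: "?n * (?n + 1) div 2 = Suc (\<Sum>j=2..?n. j)"
  proof -
    have "(\<Sum>j=1..?n. j) = 1 + (\<Sum>j=2..?n. j)"
      using n by (subst sum.atLeast_Suc_atMost) (auto simp: numeral_2_eq_2)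
    then show ?thesis using Sum_Icc_nat[of 1 ?n] by simp
  qed
  have "(\<Prod>i\<in>(UNIV :: 'n set). if pos i = 1 then e else (-1) ^ (?n + 2 - pos i)) = e * (-1) ^ (\<Sum>j=2..?n. j)"
    for e :: real
    using prod_over_pos[where 'n='n and g="\<lambda>j. if j = 1 then e else (-1) ^ (?n + 2 - j)"] * by simp
  note ** = this[unfolded One_nat_def]
  show "det (sym_source :: ((real, 'n) vec, 'n) vec) = (-1) ^ (?n * (?n + 1) div 2)"
    unfolding sym_source_def det_diagonal_mat s unfolding One_nat_def ** by simp
  show "det (sym_target :: ((real, 'n) vec, 'n) vec) = (-1) ^ (?n * (?n + 1) div 2 + ?n)"
    unfolding sym_target_def det_diagonal_mat s unfolding One_nat_def ** by (simp add: power_add)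
qed

section \<open>Derivatives along an approximate null field\<close>

lemma along_pdv:
  fixes h :: "real^'m::finite \<Rightarrow> real"
  shows "h differentiable (at x) \<Longrightarrow> along \<eta> h x = (\<Sum>i\<in>UNIV. \<eta> x $ i * pdv i h x)"
  unfolding along_def by (rule frechet_pdv)

lemma along_cong_open:
  assumes "open U" "x \<in> U" "\<And>y. y \<in> U \<Longrightarrow> f y = g y"
  shows "along \<eta> f x = along \<eta> g x"
  unfolding along_def using frechet_derivative_cong_open[OF assms] by simp

lemma along_iter_cong_open:
  assumes "open U" "\<And>y. y \<in> U \<Longrightarrow> f y = g y"
  shows "x \<in> U \<Longrightarrow> (along \<eta> ^^ k) f x = (along \<eta> ^^ k) g x"
proof (induction k arbitrary: x)
  case (Suc k)
  have "along \<eta> ((along \<eta> ^^ k) f) x = along \<eta> ((along \<eta> ^^ k) g) x"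
    by (rule along_cong_open[OF assms(1) Suc.prems]) (rule Suc.IH)
  then show ?case by simp
qed (simp add: assms)

lemma grad_nth: "grad h x $ i = pdv i h x"
  by (simp add: grad_def pdv_def)

section \<open>Smooth fields as derivations\<close>

locale smooth_field =
  fixes X :: "(real^'m::finite) set" and \<eta> :: "real^'m \<Rightarrow> real^'m"
  assumes open_X: "open X" and zero_X: "0 \<in> X" and sm_field: "\<And>i. sm X (\<lambda>x. \<eta> x $ i)"
begin

lemmas sm_rules = sm_add[OF open_X] sm_mult[OF open_X] sm_diff[OF open_X] sm_sum[OF open_X]
  sm_power[OF open_X] sm_const sm_pdv

lemma sm_along: "sm X h \<Longrightarrow> sm X (along \<eta> h)"
  by (subst sm_cong[OF open_X, of _ "\<lambda>x. \<Sum>i\<in>UNIV. \<eta> x $ i * pdv i h x"])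
     (auto intro!: sm_rules sm_field along_pdv sm_differentiable)

lemma sm_along_iter: "sm X h \<Longrightarrow> sm X ((along \<eta> ^^ k) h)"
  by (induction k) (auto intro: sm_along)

lemma along_add:
  "sm X f \<Longrightarrow> sm X g \<Longrightarrow> x \<in> X \<Longrightarrow> along \<eta> (\<lambda>x. f x + g x) x = along \<eta> f x + along \<eta> g x"
  by (simp add: along_pdv sm_differentiable sm_rules pdv_add sum.distrib algebra_simps)

lemma along_diff:
  "sm X f \<Longrightarrow> sm X g \<Longrightarrow> x \<in> X \<Longrightarrow> along \<eta> (\<lambda>x. f x - g x) x = along \<eta> f x - along \<eta> g x"
  by (simp add: along_pdv sm_differentiable sm_rules pdv_diff sum_subtractf algebra_simps)

lemma along_mult:
  "sm X f \<Longrightarrow> sm X g \<Longrightarrow> x \<in> X \<Longrightarrow> along \<eta> (\<lambda>x. f x * g x) x = f x * along \<eta> g x + along \<eta> f x * g x"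
  by (simp add: along_pdv sm_differentiable sm_rules pdv_mult sum.distrib sum_distrib_left
      sum_distrib_right algebra_simps)

lemma along_zero: "along \<eta> (\<lambda>x. 0 :: real) x = 0"
  by (simp add: along_pdv pdv_const)

lemma along_sum:
  "(\<And>i. i \<in> A \<Longrightarrow> sm X (f i)) \<Longrightarrow> x \<in> X \<Longrightarrow> along \<eta> (\<lambda>x. \<Sum>i\<in>A. f i x) x = (\<Sum>i\<in>A. along \<eta> (f i) x)"
  by (induction A rule: infinite_finite_induct) (simp_all add: along_zero along_add sm_rules)

lemma Zo_along: "sm X w \<Longrightarrow> Zo (Suc m) w \<Longrightarrow> Zo m (along \<eta> w)"
  by (subst Zo_cong[OF open_X zero_X, of _ "\<lambda>x. \<Sum>i\<in>UNIV. \<eta> x $ i * pdv i w x"])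
     (auto intro!: Zo_sum[OF open_X zero_X] Zo_mult[OF open_X zero_X] sm_rules sm_field along_pdv sm_differentiable)

text \<open>One order of contact is lost per derivative, whatever the field is.\<close>

lemma Zo_along_iter_diff:
  assumes "sm X f" "sm X g" "Zo (m + k) (\<lambda>x. f x - g x)"
  shows "Zo m (\<lambda>x. (along \<eta> ^^ k) f x - (along \<eta> ^^ k) g x)"
  using assms(3)
proof (induction k arbitrary: m)
  case (Suc k)
  have "Zo m (along \<eta> (\<lambda>x. (along \<eta> ^^ k) f x - (along \<eta> ^^ k) g x))"
    using Suc.IH[of "Suc m"] Suc.prems by (intro Zo_along sm_rules sm_along_iter assms) simp
  then show ?case
    by (subst Zo_cong[OF open_X zero_X, of _ "along \<eta> (\<lambda>x. (along \<eta> ^^ k) f x - (along \<eta> ^^ k) g x)"])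
       (auto simp: along_diff sm_along_iter assms)
qed simp

end

text \<open>Later p_k is \<open>morin_poly k\<close> composed with S, and a is \<eta>(S_1). The
  assumption \<open>tangent\<close> is the first-order consequence of divisibility j = c p_1; it
  suffices because each function vanishing on {p_1 = 0} is differentiated once and the result is
  expressed by a new such function.\<close>

locale null_flag = smooth_field X \<eta>
  for X :: "(real^'m::finite) set" and \<eta> :: "real^'m \<Rightarrow> real^'m" +
  fixes n :: nat and p :: "nat \<Rightarrow> real^'m \<Rightarrow> real" and a :: "real^'m \<Rightarrow> real"
  assumes n_pos: "1 \<le> n" and sm_p: "\<And>k. sm X (p k)" and sm_a: "sm X a"
    and p_zero: "\<And>k. 1 \<le> k \<Longrightarrow> k \<le> n \<Longrightarrow> p k 0 = 0"
    and tangent: "\<And>j. sm X j \<Longrightarrow> (\<And>x. x \<in> X \<Longrightarrow> p 1 x = 0 \<Longrightarrow> j x = 0) \<Longrightarrow>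
      \<exists>c. sm X c \<and> (\<forall>x\<in>X. p 1 x = 0 \<longrightarrow> (\<forall>i. pdv i j x = c x * pdv i (p 1) x))"
begin

text \<open>The ideal of functions vanishing on {p_1 = 0} plus the functions of order m at 0. An
  exact null field leaves remainders of the first kind; a field taken over from another germ with
  the same jet leaves both kinds.\<close>

definition van :: "nat \<Rightarrow> (real^'m \<Rightarrow> real) \<Rightarrow> bool" where
  "van m h \<longleftrightarrow> (\<exists>j w. sm X j \<and> (\<forall>x\<in>X. p 1 x = 0 \<longrightarrow> j x = 0) \<and> sm X w \<and> Zo m w \<and> (\<forall>x\<in>X. h x = j x + w x))"

lemma van_cong: "(\<And>x. x \<in> X \<Longrightarrow> f x = g x) \<Longrightarrow> van m f \<longleftrightarrow> van m g"
  unfolding van_def by simp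

lemma van_sm:
  assumes "van m h"
  shows "sm X h"
proof -
  obtain j w where "sm X j" "sm X w" "\<And>x. x \<in> X \<Longrightarrow> h x = j x + w x"
    using assms unfolding van_def by blast
  then show ?thesis using sm_cong[OF open_X, of h "\<lambda>x. j x + w x"] sm_add[OF open_X] by simp
qed

lemma van_mono: "van m h \<Longrightarrow> l \<le> m \<Longrightarrow> van l h"
  unfolding van_def by (elim exE conjE) (metis Zo_mono)

lemma van_zero: "van m (\<lambda>x. 0)"
  unfolding van_def by (rule exI[of _ "\<lambda>x. 0"])+ (simp add: sm_const Zo_zero)

lemma van_vanishing: "sm X j \<Longrightarrow> (\<And>x. x \<in> X \<Longrightarrow> p 1 x = 0 \<Longrightarrow> j x = 0) \<Longrightarrow> van m j"
  unfolding van_def by (rule exI[of _ j], rule exI[of _ "\<lambda>x. 0"]) (simp add: sm_const Zo_zero)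

lemma van_order: "sm X w \<Longrightarrow> Zo m w \<Longrightarrow> van m w"
  unfolding van_def by (rule exI[of _ "\<lambda>x. 0"], rule exI[of _ w]) (simp add: sm_const)

lemma van_add:
  assumes "van m f" "van m g"
  shows "van m (\<lambda>x. f x + g x)"
proof -
  obtain j w j' w' where "sm X j" "\<forall>x\<in>X. p 1 x = 0 \<longrightarrow> j x = 0" "sm X w" "Zo m w" "\<forall>x\<in>X. f x = j x + w x"
    "sm X j'" "\<forall>x\<in>X. p 1 x = 0 \<longrightarrow> j' x = 0" "sm X w'" "Zo m w'" "\<forall>x\<in>X. g x = j' x + w' x"
    using assms unfolding van_def by blast
  then show ?thesis
    unfolding van_def
    by (intro exI[of _ "\<lambda>x. j x + j' x"] exI[of _ "\<lambda>x. w x + w' x"])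
      (simp add: sm_rules Zo_add[OF open_X zero_X])
qed

lemma van_mult:
  assumes "sm X c" "van m f"
  shows "van m (\<lambda>x. c x * f x)"
proof -
  obtain j w where "sm X j" "\<forall>x\<in>X. p 1 x = 0 \<longrightarrow> j x = 0" "sm X w" "Zo m w" "\<forall>x\<in>X. f x = j x + w x"
    using assms unfolding van_def by blast
  then show ?thesis
    unfolding van_def using assms(1)
    by (intro exI[of _ "\<lambda>x. c x * j x"] exI[of _ "\<lambda>x. c x * w x"])
      (simp add: sm_rules Zo_mult[OF open_X zero_X] distrib_left)
qed

lemma van_sum: "(\<And>i. i \<in> A \<Longrightarrow> van m (f i)) \<Longrightarrow> van m (\<lambda>x. \<Sum>i\<in>A. f i x)"
  by (induction A rule: infinite_finite_induct) (simp_all add: van_zero van_add)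

lemma van_at_0: "van (Suc m) h \<Longrightarrow> h 0 = 0"
  unfolding van_def using zero_X p_zero[of 1] n_pos by fastforce

text \<open>The origin lies on {p_1 = 0}, so \<open>tangent\<close> applies there to j, and order at
  least two kills the gradient of w.\<close>

lemma van_pdv_at_0:
  assumes "van (Suc (Suc m)) h"
  obtains c where "\<And>i. pdv i h 0 = c * pdv i (p 1) 0"
proof -
  obtain j w where j: "sm X j" "\<And>x. x \<in> X \<Longrightarrow> p 1 x = 0 \<Longrightarrow> j x = 0"
    and w: "sm X w" "Zo (Suc (Suc m)) w" and h: "\<And>x. x \<in> X \<Longrightarrow> h x = j x + w x"
    using assms unfolding van_def by blast
  obtain c where "\<forall>x\<in>X. p 1 x = 0 \<longrightarrow> (\<forall>i. pdv i j x = c x * pdv i (p 1) x)"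
    using tangent[OF j] by blast
  then have c: "pdv i j 0 = c 0 * pdv i (p 1) 0" for i
    using zero_X p_zero[of 1] n_pos by blast
  have "pdv i h 0 = c 0 * pdv i (p 1) 0" for i
  proof -
    have "pdv i h 0 = pdv i (\<lambda>x. j x + w x) 0" by (rule pdv_cong_open[OF open_X zero_X h])
    also have "\<dots> = pdv i j 0 + pdv i w 0"
      by (rule pdv_add) (use j(1) w(1) zero_X sm_differentiable in auto)
    finally show ?thesis using c w(2) by simp
  qed
  then show ?thesis by (rule that)
qed

text \<open>The ideal generated by p_1, ..., p_k, modulo \<open>van m\<close>. The coefficients are
  indexed from 0, hence \<open>p (Suc i)\<close>.\<close>

definition flag :: "nat \<Rightarrow> nat \<Rightarrow> (real^'m \<Rightarrow> real) \<Rightarrow> bool" where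
  "flag k m h \<longleftrightarrow> (\<exists>c z. (\<forall>i. sm X (c i)) \<and> van m z \<and>
     (\<forall>x\<in>X. h x = (\<Sum>i<k. c i x * p (Suc i) x) + z x))"

lemma flag_cong: "(\<And>x. x \<in> X \<Longrightarrow> f x = g x) \<Longrightarrow> flag k m f \<longleftrightarrow> flag k m g"
  unfolding flag_def by simp

lemma flag_van: "van m z \<Longrightarrow> flag k m z"
  unfolding flag_def by (rule exI[of _ "\<lambda>i x. 0"], rule exI[of _ z]) (simp add: sm_const)

lemma flag_gen: "i < k \<Longrightarrow> flag k m (p (Suc i))"
  unfolding flag_def
  by (rule exI[of _ "\<lambda>l x. if l = i then 1 else 0"], rule exI[of _ "\<lambda>x. 0"])
    (simp add: sm_const van_zero if_distrib[of "\<lambda>c. c * _"] cong: if_cong)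

lemma flag_add:
  assumes "flag k m f" "flag k m g"
  shows "flag k m (\<lambda>x. f x + g x)"
proof -
  obtain c z d y where "\<forall>i. sm X (c i)" "van m z" "\<forall>x\<in>X. f x = (\<Sum>i<k. c i x * p (Suc i) x) + z x"
    "\<forall>i. sm X (d i)" "van m y" "\<forall>x\<in>X. g x = (\<Sum>i<k. d i x * p (Suc i) x) + y x"
    using assms unfolding flag_def by blast
  then show ?thesis
    unfolding flag_def
    by (intro exI[of _ "\<lambda>i x. c i x + d i x"] exI[of _ "\<lambda>x. z x + y x"])
      (simp add: sm_rules van_add distrib_right sum.distrib)
qed

lemma flag_mult:
  assumes "sm X b" "flag k m f"
  shows "flag k m (\<lambda>x. b x * f x)"
proof -
  obtain c z where "\<forall>i. sm X (c i)" "van m z" "\<forall>x\<in>X. f x = (\<Sum>i<k. c i x * p (Suc i) x) + z x"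
    using assms unfolding flag_def by blast
  then show ?thesis
    unfolding flag_def using assms(1)
    by (intro exI[of _ "\<lambda>i x. b x * c i x"] exI[of _ "\<lambda>x. b x * z x"])
      (simp add: sm_rules van_mult distrib_left sum_distrib_left mult.assoc)
qed

lemma flag_sum: "(\<And>i. i \<in> A \<Longrightarrow> flag k m (f i)) \<Longrightarrow> flag k m (\<lambda>x. \<Sum>i\<in>A. f i x)"
  by (induction A rule: infinite_finite_induct) (simp_all add: flag_van van_zero flag_add)

lemma flag_at_0: "flag k (Suc m) h \<Longrightarrow> k \<le> n \<Longrightarrow> h 0 = 0"
  unfolding flag_def using zero_X van_at_0 p_zero by (fastforce intro!: sum.neutral)

text \<open>The generators vanish at 0, so in the product rule the derivatives of the coefficients
  drop out.\<close>

lemma flag_pdv_at_0: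
  assumes "flag k (Suc (Suc m)) h" "1 \<le> k" "k \<le> n"
  obtains t where "\<And>i. pdv i h 0 = (\<Sum>l<k. t l * pdv i (p (Suc l)) 0)"
proof -
  obtain c z where c: "\<And>i. sm X (c i)" and z: "van (Suc (Suc m)) z"
    and h: "\<And>x. x \<in> X \<Longrightarrow> h x = (\<Sum>i<k. c i x * p (Suc i) x) + z x"
    using assms unfolding flag_def by blast
  obtain d where d: "\<And>i. pdv i z 0 = d * pdv i (p 1) 0" using van_pdv_at_0[OF z] by blast
  have "pdv i h 0 = (\<Sum>l<k. (c l 0 + (if l = 0 then d else 0)) * pdv i (p (Suc l)) 0)" for i
  proof -
    have s: "pdv i (\<lambda>x. \<Sum>l<k'. c l x * p (Suc l) x) 0 = (\<Sum>l<k'. c l 0 * pdv i (p (Suc l)) 0)"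
      if "k' \<le> n" for k'
      using that
    proof (induction k')
      case (Suc k')
      have "pdv i (\<lambda>x. \<Sum>l<Suc k'. c l x * p (Suc l) x) 0 =
        pdv i (\<lambda>x. \<Sum>l<k'. c l x * p (Suc l) x) 0 + pdv i (\<lambda>x. c k' x * p (Suc k') x) 0"
        by (simp, rule pdv_add) (rule sm_differentiable[OF _ zero_X], intro sm_rules c sm_p)+
      also have "pdv i (\<lambda>x. c k' x * p (Suc k') x) 0 = c k' 0 * pdv i (p (Suc k')) 0"
        using Suc.prems p_zero[of "Suc k'"] sm_differentiable[OF _ zero_X]
        by (subst pdv_mult) (auto intro: c sm_p)
      finally show ?case using Suc by simp
    qed (simp add: pdv_const)
    have "pdv i h 0 = pdv i (\<lambda>x. (\<Sum>l<k. c l x * p (Suc l) x) + z x) 0"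
      by (rule pdv_cong_open[OF open_X zero_X h])
    also have "\<dots> = (\<Sum>l<k. c l 0 * pdv i (p (Suc l)) 0) + d * pdv i (p 1) 0"
      by (subst pdv_add) (auto intro!: sm_differentiable[OF _ zero_X] sm_rules c sm_p van_sm[OF z] simp: s assms d)
    \<comment> \<open>The remainder contributes a multiple of grad p_1, which joins the coefficient
      with index 0; it exists because k \<ge> 1.\<close>
    also have "d * pdv i (p 1) 0 = (\<Sum>l<k. (if l = 0 then d else 0) * pdv i (p (Suc l)) 0)"
      using assms(2) by (simp add: if_distrib[of "\<lambda>c. c * _"] cong: if_cong)
    finally show ?thesis by (simp add: sum.distrib distrib_right)
  qed
  then show ?thesis by (rule that)
qed

end

text \<open>All that the nullity of the field contributes: up to \<open>van n\<close>, it sends each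
  p_k to the next one with the same factor a.\<close>

locale null_chain = null_flag +
  assumes chain: "\<And>k. 1 \<le> k \<Longrightarrow> k \<le> n \<Longrightarrow> van n (\<lambda>x. along \<eta> (p k) x - a x * p (Suc k) x)"
begin

text \<open>On {p_1 = 0} the gradient of j is c grad p_1, so \<eta> j - c \<eta> p_1 vanishes there
  again, while \<eta> p_1 is a p_2 up to \<open>van n\<close>. The index \<open>Suc (Suc k)\<close>
  ensures that p_2 is among the generators. The part of finite order loses one order.\<close>

lemma van_along:
  assumes "van (Suc m) z" "m \<le> n"
  shows "flag (Suc (Suc k)) m (along \<eta> z)"
proof -
  obtain j w where j: "sm X j" "\<And>x. x \<in> X \<Longrightarrow> p 1 x = 0 \<Longrightarrow> j x = 0"
    and w: "sm X w" "Zo (Suc m) w" and z: "\<And>x. x \<in> X \<Longrightarrow> z x = j x + w x"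
    using assms unfolding van_def by blast
  obtain c where c: "sm X c" "\<And>x i. x \<in> X \<Longrightarrow> p 1 x = 0 \<Longrightarrow> pdv i j x = c x * pdv i (p 1) x"
    using tangent[OF j] by blast
  have v: "van m (\<lambda>x. along \<eta> j x - c x * along \<eta> (p 1) x)"
  proof (rule van_vanishing)
    show "sm X (\<lambda>x. along \<eta> j x - c x * along \<eta> (p 1) x)"
      by (intro sm_rules sm_along j c sm_p)
    fix x assume x: "x \<in> X" "p 1 x = 0"
    show "along \<eta> j x - c x * along \<eta> (p 1) x = 0"
      using x by (simp add: along_pdv sm_differentiable[OF j(1)] sm_differentiable[OF sm_p] c(2)
          sum_distrib_left algebra_simps del: One_nat_def)
  qed
  have "flag (Suc (Suc k)) m (\<lambda>x. (along \<eta> j x - c x * along \<eta> (p 1) x) +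
     (c x * (along \<eta> (p 1) x - a x * p (Suc 1) x) + (c x * a x) * p (Suc 1) x) + along \<eta> w x)"
    by (intro flag_add flag_van[OF v] flag_mult flag_gen sm_rules c(1) sm_a
        flag_van[OF van_mono[OF chain assms(2)]] flag_van[OF van_order] Zo_along w sm_along)
      (use n_pos in auto)
  then show ?thesis
    by (subst flag_cong[where g="\<lambda>x. (along \<eta> j x - c x * along \<eta> (p 1) x) +
     (c x * (along \<eta> (p 1) x - a x * p (Suc 1) x) + (c x * a x) * p (Suc 1) x) + along \<eta> w x"])
      (simp_all add: along_cong_open[OF open_X _ z] along_add j w algebra_simps)
qed

text \<open>By Leibniz, differentiating a generator leads to the next one up to
  \<open>van n\<close>, and differentiating a coefficient stays in the ideal. Since k \<ge> 1, the
  generator p_2 coming from the remainder is among the first k + 1.\<close>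

lemma flag_along:
  assumes "flag k (Suc m) h" "1 \<le> k" "k \<le> n" "m \<le> n"
  shows "flag (Suc k) m (along \<eta> h)"
proof -
  obtain c z where c: "\<And>i. sm X (c i)" and z: "van (Suc m) z"
    and h: "\<And>x. x \<in> X \<Longrightarrow> h x = (\<Sum>i<k. c i x * p (Suc i) x) + z x"
    using assms unfolding flag_def by blast
  obtain k' where k': "k = Suc k'" using assms(2) by (cases k) auto
  have "flag (Suc k) m (\<lambda>x. (\<Sum>i<k. (c i x * (along \<eta> (p (Suc i)) x - a x * p (Suc (Suc i)) x)
      + (c i x * a x) * p (Suc (Suc i)) x) + along \<eta> (c i) x * p (Suc i) x) + along \<eta> z x)"
    by (intro flag_add flag_sum flag_mult flag_gen sm_rules c sm_a sm_along
        flag_van[OF van_mono[OF chain assms(4)]] van_along[OF z assms(4), of k', folded k'])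
      (use assms in auto)
  moreover have "along \<eta> h x = (\<Sum>i<k. (c i x * (along \<eta> (p (Suc i)) x - a x * p (Suc (Suc i)) x)
      + (c i x * a x) * p (Suc (Suc i)) x) + along \<eta> (c i) x * p (Suc i) x) + along \<eta> z x"
    if x: "x \<in> X" for x
  proof -
    have "along \<eta> h x = along \<eta> (\<lambda>x. (\<Sum>i<k. c i x * p (Suc i) x) + z x) x"
      by (rule along_cong_open[OF open_X x h])
    also have "\<dots> = (\<Sum>i<k. c i x * along \<eta> (p (Suc i)) x + along \<eta> (c i) x * p (Suc i) x) + along \<eta> z x"
      using x by (simp add: along_add along_sum along_mult sm_rules c sm_p van_sm[OF z])
    finally show ?thesis by (simp add: algebra_simps)
  qed
  ultimately show ?thesis by (subst flag_cong) auto
qed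

text \<open>The leading term collects a factor a with each derivative. The order n + 1 - k records
  the loss of one order per derivative: at least 2 is left for k < n, enough for gradients at 0, and
  1 for k = n, enough for the value.\<close>

lemma along_iter_flag:
  assumes u: "sm X u" and "k \<le> n"
  shows "flag k (Suc n - k) (\<lambda>x. (along \<eta> ^^ k) (\<lambda>x. u x * p 1 x) x - u x * a x ^ k * p (Suc k) x)"
  using assms(2)
proof (induction k)
  case 0
  then show ?case by (simp add: flag_van van_zero)
next
  case (Suc k)
  let ?h = "(along \<eta> ^^ k) (\<lambda>x. u x * p 1 x)"
  have sh: "sm X ?h" "sm X (\<lambda>x. u x * a x ^ k)"
    by (intro sm_along_iter sm_rules u sm_p sm_a)+
  \<comment> \<open>For k = 0 the difference is identically 0, so \<open>flag_along\<close> with its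
    condition k \<ge> 1 enters from the second derivative on.\<close>
  have 1: "flag (Suc k) (n - k) (along \<eta> (\<lambda>x. ?h x - u x * a x ^ k * p (Suc k) x))"
  proof (cases "k = 0")
    case True
    then show ?thesis by (simp add: flag_van van_zero along_zero cong: flag_cong)
  next
    case False
    have "flag k (Suc (n - k)) (\<lambda>x. ?h x - u x * a x ^ k * p (Suc k) x)"
      using Suc by (simp add: Suc_diff_le)
    then show ?thesis using False Suc.prems by (intro flag_along) auto
  qed
  have "flag (Suc k) (n - k) (\<lambda>x. along \<eta> (\<lambda>x. ?h x - u x * a x ^ k * p (Suc k) x) x +
      ((u x * a x ^ k) * (along \<eta> (p (Suc k)) x - a x * p (Suc (Suc k)) x) +
       along \<eta> (\<lambda>x. u x * a x ^ k) x * p (Suc k) x))"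
    by (intro flag_add 1 flag_mult flag_gen sh sm_along flag_van[OF van_mono[OF chain]])
      (use Suc.prems in auto)
  moreover have "(along \<eta> ^^ Suc k) (\<lambda>x. u x * p 1 x) x - u x * a x ^ Suc k * p (Suc (Suc k)) x =
      along \<eta> (\<lambda>x. ?h x - u x * a x ^ k * p (Suc k) x) x +
      ((u x * a x ^ k) * (along \<eta> (p (Suc k)) x - a x * p (Suc (Suc k)) x) +
       along \<eta> (\<lambda>x. u x * a x ^ k) x * p (Suc k) x)" if "x \<in> X" for x
    using that along_mult[OF sh(2) sm_p[of "Suc k"] that] along_diff[OF sh(1) sm_rules(2)[OF sh(2) sm_p[of "Suc k"]] that]
    by (simp add: algebra_simps)
  ultimately show ?case by (subst flag_cong) auto
qed

lemma along_iter_at_0: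
  assumes "sm X u"
  shows "(along \<eta> ^^ n) (\<lambda>x. u x * p 1 x) 0 = u 0 * a 0 ^ n * p (Suc n) 0"
  using flag_at_0[of n 0 "\<lambda>x. (along \<eta> ^^ n) (\<lambda>x. u x * p 1 x) x - u x * a x ^ n * p (Suc n) x"]
    along_iter_flag[OF assms, of n] by simp

text \<open>The multiples of earlier gradients disappear by column operations in the determinant, so
  their coefficients t are left unspecified.\<close>

lemma pdv_along_iter_at_0:
  assumes u: "sm X u" and "k < n"
  obtains t where "\<And>i. pdv i ((along \<eta> ^^ k) (\<lambda>x. u x * p 1 x)) 0 =
    u 0 * a 0 ^ k * pdv i (p (Suc k)) 0 + (\<Sum>l<k. t l * pdv i (p (Suc l)) 0)"
proof -
  let ?h = "(along \<eta> ^^ k) (\<lambda>x. u x * p 1 x)"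
  let ?g = "\<lambda>x. u x * a x ^ k * p (Suc k) x"
  have sh: "sm X ?h" "sm X (\<lambda>x. u x * a x ^ k)"
    by (intro sm_along_iter sm_rules u sm_p sm_a)+
  have sg: "sm X ?g" by (intro sm_rules sh sm_p)
  have g: "pdv i ?g 0 = u 0 * a 0 ^ k * pdv i (p (Suc k)) 0" for i
    using pdv_mult[OF sm_differentiable[OF sh(2) zero_X] sm_differentiable[OF sm_p zero_X]]
      p_zero[of "Suc k"] assms(2) by simp
  obtain t where t: "\<And>i. pdv i (\<lambda>x. ?h x - ?g x) 0 = (\<Sum>l<k. t l * pdv i (p (Suc l)) 0)"
  proof (cases "k = 0")
    case True
    then show ?thesis using that by (simp add: pdv_const)
  next
    case False
    have "flag k (Suc (Suc (n - Suc k))) (\<lambda>x. ?h x - ?g x)"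
      using along_iter_flag[OF u, of k] assms(2) by (simp add: Suc_diff_Suc Suc_diff_le)
    moreover have "1 \<le> k" "k \<le> n" using False assms(2) by auto
    ultimately obtain t where "\<And>i. pdv i (\<lambda>x. ?h x - ?g x) 0 = (\<Sum>l<k. t l * pdv i (p (Suc l)) 0)"
      by (rule flag_pdv_at_0) blast
    then show ?thesis by (rule that)
  qed
  have "pdv i ?h 0 = u 0 * a 0 ^ k * pdv i (p (Suc k)) 0 + (\<Sum>l<k. t l * pdv i (p (Suc l)) 0)" for i
    using t[of i] g[of i]
      pdv_diff[OF sm_differentiable[OF sh(1) zero_X] sm_differentiable[OF sg zero_X], of i] by simp
  then show ?thesis by (rule that)
qed

end

section \<open>Invariants of germs in Morin form\<close>

text \<open>G is P times a matrix that is upper triangular in the order of positions, so only the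
  diagonal factors d matter and the coefficients t do not.\<close>

lemma det_triangular_combination:
  fixes P G :: "real^'n::{finite,linorder}^'n::{finite,linorder}"
  assumes "\<And>i j. G $ i $ j = d (pos j - 1) * P $ i $ j + (\<Sum>l<pos j - 1. t j l * P $ i $ coord (Suc l))"
  shows "det G = det P * (\<Prod>k<CARD('n). d k)"
proof -
  define T :: "((real, 'n) vec, 'n) vec" where "T = (\<chi> k j. if pos k < pos j then t j (pos k - 1) else if k = j then d (pos j - 1) else 0)"
  have "G $ i $ j = (\<Sum>k\<in>UNIV. P $ i $ k * T $ k $ j)" for i j
  proof -
    have T: "P $ i $ k * T $ k $ j = (if k = j then d (pos j - 1) * P $ i $ j else 0) +
        (if pos k < pos j then t j (pos k - 1) * P $ i $ coord (pos k) else 0)" for k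
      by (auto simp: T_def coord_pos)
    have "(\<Sum>k\<in>UNIV. P $ i $ k * T $ k $ j) = d (pos j - 1) * P $ i $ j +
        (\<Sum>k\<in>(UNIV :: 'n set). if pos k < pos j then t j (pos k - 1) * P $ i $ coord (pos k) else 0)"
      unfolding T sum.distrib by simp
    also have "(\<Sum>k\<in>(UNIV :: 'n set). if pos k < pos j then t j (pos k - 1) * P $ i $ coord (pos k) else 0) =
        (\<Sum>m=1..CARD('n). if m < pos j then t j (m - 1) * P $ i $ coord m else 0)"
      by (rule sum_over_pos)
    also have "\<dots> = (\<Sum>m\<in>{1..<pos j}. t j (m - 1) * P $ i $ coord m)"
      using pos_range(2)[of j] by (intro sum.mono_neutral_cong_right) auto
    also have "\<dots> = (\<Sum>l<pos j - 1. t j l * P $ i $ coord (Suc l))"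
      by (rule sum.reindex_bij_witness[of _ Suc "\<lambda>m. m - 1"]) auto
    finally show ?thesis using assms by simp
  qed
  then have "G = P ** T" by (simp add: matrix_matrix_mult_def vec_eq_iff)
  moreover have "det T = (\<Prod>k<CARD('n). d k)"
  proof -
    have "det T = of_int (sign (id :: 'n \<Rightarrow> 'n)) * (\<Prod>i\<in>UNIV. T $ i $ id i)"
    proof (rule det_unique_permutation)
      fix q :: "'n \<Rightarrow> 'n" assume q: "q permutes UNIV" "q \<noteq> id"
      \<comment> \<open>A permutation preserves the sum of all positions, so one that lowers no
        position fixes every index.\<close>
      have "\<exists>i. pos (q i) < pos i"
      proof (rule ccontr)
        assume "\<not> ?thesis"
        then have le: "pos i \<le> pos (q i)" for i by (simp add: not_less)
        obtain i where "q i \<noteq> i" using q(2) by (metis eq_id_iff)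
        then have "pos i \<noteq> pos (q i)" by (simp add: pos_inject eq_commute)
        then have "pos i < pos (q i)" using le[of i] by linarith
        then have "(\<Sum>i\<in>(UNIV :: 'n set). pos i) < (\<Sum>i\<in>UNIV. pos (q i))"
          using le by (intro sum_strict_mono_ex1) auto
        moreover have "(\<Sum>i\<in>UNIV. pos (q i)) = (\<Sum>i\<in>(UNIV :: 'n set). pos i)"
          by (rule sum.reindex_bij_betw[OF permutes_imp_bij[OF q(1)]])
        ultimately show False by simp
      qed
      then obtain i where "pos (q i) < pos i" by blast
      then have "T $ i $ q i = 0" by (auto simp: T_def)
      then show "\<exists>i. T $ i $ q i = 0" by blast
    qed (rule permutes_id)
    also have "\<dots> = (\<Prod>i\<in>(UNIV :: 'n set). d (pos i - 1))" by (simp add: T_def)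
    also have "\<dots> = (\<Prod>m=1..CARD('n). d (m - 1))" by (rule prod_over_pos)
    also have "\<dots> = (\<Prod>k<CARD('n). d k)"
      by (rule prod.reindex_bij_witness[of _ Suc "\<lambda>m. m - 1"]) auto
    finally show ?thesis .
  qed
  ultimately show ?thesis by (simp add: det_mul)
qed

text \<open>The monomial x_1 x_2 makes x_2 enter \<open>morin_poly 1\<close> linearly with
  coefficient 1. Subtracting the value of \<open>morin_poly 1\<close> from x_2 therefore projects
  onto its zero set, and this projection is what proves \<open>tangent\<close>.\<close>

lemma morin_poly_shift:
  fixes y :: "real^'n::{finite,linorder}"
  assumes "2 \<le> CARD('n)"
  shows "morin_poly 1 (y - s *\<^sub>R axis (coord 2) 1) = morin_poly 1 y - s"
proof -
  have c: "pos (coord 1 :: 'n) = 1" "pos (coord 2 :: 'n) = 2"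
    using assms by (auto intro!: pos_coord)
  have ne: "coord 2 \<noteq> (coord 1 :: 'n)"
  proof
    assume "coord 2 = (coord 1 :: 'n)"
    from arg_cong[OF this, of pos] show False using c by simp
  qed
  let ?y = "y - s *\<^sub>R axis (coord 2) 1"
  have y: "?y $ i = y $ i - (if i = coord 2 then s else 0)" for i by (simp add: axis_def)
  have 1: "?y $ coord 1 = y $ coord 1" using ne y[of "coord 1"] by (simp del: One_nat_def)
  have "(\<Sum>i\<in>-{coord 1}. power_deriv 1 (pos i - 1) (y $ coord 1) * ?y $ i) =
    (\<Sum>i\<in>-{coord 1}. power_deriv 1 (pos i - 1) (y $ coord 1) * y $ i) -
    (\<Sum>i\<in>-{coord 1 :: 'n}. if i = coord 2 then power_deriv 1 (pos i - 1) (y $ coord 1) * s else 0)"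
    unfolding sum_subtractf[symmetric]
  proof (rule sum.cong[OF refl])
    fix i :: 'n
    show "power_deriv 1 (pos i - 1) (y $ coord 1) * ?y $ i =
      power_deriv 1 (pos i - 1) (y $ coord 1) * y $ i -
      (if i = coord 2 then power_deriv 1 (pos i - 1) (y $ coord 1) * s else 0)"
      unfolding y by (simp add: algebra_simps)
  qed
  also have "(\<Sum>i\<in>-{coord 1 :: 'n}. if i = coord 2 then power_deriv 1 (pos i - 1) (y $ coord 1) * s else 0) = s"
    using ne by (subst sum.delta) (auto simp: c power_deriv_def)
  finally show ?thesis unfolding morin_poly_def 1 by simp
qed

text \<open>The chain rule for T \<circ> M \<circ> S. It brings \<lambda> into the shape u p_1 of
  the computation along the field, with u = det T' det S' taken at the matching points.\<close>

lemma morin_form: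
  fixes f S T :: "real^'n::{finite,linorder} \<Rightarrow> (real, 'n) vec"
  assumes X: "open X" "open V" and smS: "smooth_on X S" and smT: "smooth_on V T"
    and XM: "\<And>x. x \<in> X \<Longrightarrow> morin_normal (S x) \<in> V"
    and fX: "\<And>x. x \<in> X \<Longrightarrow> f x = T (morin_normal (S x))"
  shows "smooth_on X f"
    and "x \<in> X \<Longrightarrow> jacobian f (at x) =
      jacobian T (at (morin_normal (S x))) ** (jacobian morin_normal (at (S x)) ** jacobian S (at x))"
    and "x \<in> X \<Longrightarrow> jac_det f x =
      det (jacobian T (at (morin_normal (S x)))) * det (jacobian S (at x)) * morin_poly 1 (S x)"
    and "sm X (\<lambda>x. det (jacobian T (at (morin_normal (S x)))) * det (jacobian S (at x)))"
proof -
  let ?M = "morin_normal :: (real, 'n) vec \<Rightarrow> (real, 'n) vec"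
  have smMS: "smooth_on X (\<lambda>x. ?M (S x))"
    by (rule smooth_on_compose[OF X(1) open_UNIV smS smooth_on_morin]) simp
  have dS: "S differentiable (at x)" and dMS: "(\<lambda>x. ?M (S x)) differentiable (at x)" if "x \<in> X" for x
    using that smooth_on_differentiable smS smMS by blast+
  have dM: "?M differentiable (at x)" for x
    using smooth_on_differentiable[OF smooth_on_morin[of UNIV]] by simp
  have dT: "T differentiable (at x)" if "x \<in> V" for x
    using that smooth_on_differentiable smT by blast
  have smf: "sm X (\<lambda>x. f x $ i)" for i
  proof -
    have "smooth_on X (\<lambda>x. T (?M (S x)))"
      by (rule smooth_on_compose[OF X smMS smT]) (use XM in auto)
    then have "sm X (\<lambda>x. T (?M (S x)) $ i)" by (rule smooth_on_nth[OF X(1)])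
    then show ?thesis
      using sm_cong[OF X(1), of "\<lambda>x. f x $ i" "\<lambda>x. T (?M (S x)) $ i"] fX by simp
  qed
  then show "smooth_on X f" by (rule smooth_onI_nth[OF X(1)])
  show jac: "jacobian f (at x) = jacobian T (at (?M (S x))) ** (jacobian ?M (at (S x)) ** jacobian S (at x))"
    if "x \<in> X" for x
  proof -
    have "jacobian f (at x) = jacobian (\<lambda>x. T (?M (S x))) (at x)"
      by (rule jacobian_cong_open[OF X(1) that fX])
    also have "\<dots> = jacobian T (at (?M (S x))) ** (jacobian ?M (at (S x)) ** jacobian S (at x))"
      using jacobian_compose(1)[OF dMS[OF that] dT[OF XM[OF that]]]
        jacobian_compose(1)[OF dS[OF that] dM] by simp
    finally show ?thesis .
  qed
  show "jac_det f x = det (jacobian T (at (?M (S x)))) * det (jacobian S (at x)) * morin_poly 1 (S x)"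
    if "x \<in> X"
    by (simp add: jac_det_def det_mul det_jacobian_morin jac[OF that] del: One_nat_def)
  have "sm X (\<lambda>x. pdv j (\<lambda>x. T x $ i) (?M (S x)))" for i j
    by (rule sm_compose[OF X(1), of V])
      (use XM in \<open>auto intro: sm_pdv smooth_on_nth[OF X(2) smT] smooth_on_nth[OF X(1) smMS]\<close>)
  then have 1: "sm X (\<lambda>x. jacobian T (at (?M (S x))) $ i $ j)" for i j
    using sm_cong[OF X(1), of "\<lambda>x. jacobian T (at (?M (S x))) $ i $ j" "\<lambda>x. pdv j (\<lambda>x. T x $ i) (?M (S x))"]
      jacobian_nth[OF dT[OF XM]] by simp
  have 2: "sm X (\<lambda>x. jacobian S (at x) $ i $ j)" for i j
    using sm_cong[OF X(1), of "\<lambda>x. jacobian S (at x) $ i $ j" "pdv j (\<lambda>x. S x $ i)"]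
      jacobian_nth[OF dS] sm_pdv[OF smooth_on_nth[OF X(1) smS]] by simp
  show "sm X (\<lambda>x. det (jacobian T (at (?M (S x)))) * det (jacobian S (at x)))"
    by (intro sm_mult sm_det X(1) 1 2)
qed

lemma morin_form_neighbourhood:
  fixes f S T :: "real^'n::{finite,linorder} \<Rightarrow> (real, 'n) vec"
  assumes S: "smooth_inverse U1 V1 S R" and T: "smooth_inverse U2 V2 T T'"
    and f: "\<forall>\<^sub>F x in nhds 0. f x = T (morin_normal (S x))"
  obtains X where "open X" "0 \<in> X" "X \<subseteq> U1" "smooth_on X S" "\<forall>x\<in>X. morin_normal (S x) \<in> U2"
    "\<forall>x\<in>X. f x = T (morin_normal (S x))"
proof -
  note S1 = smooth_inverseD[OF S] and T1 = smooth_inverseD[OF T]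
  obtain W where W: "open W" "0 \<in> W" "\<And>x. x \<in> W \<Longrightarrow> f x = T (morin_normal (S x))"
    using f unfolding eventually_nhds by blast
  let ?X = "W \<inter> {x \<in> U1. morin_normal (S x) \<in> U2}"
  have "smooth_on U1 (\<lambda>x. morin_normal (S x))"
    by (rule smooth_on_compose[OF S1(1) open_UNIV S1(11) smooth_on_morin]) simp
  from open_vimage_smooth[OF S1(1) this T1(1)] have "open ?X" using W(1) by blast
  moreover have "0 \<in> ?X" using W(2) S1(3,5) T1(3) by (simp add: morin_at_0)
  moreover have "?X \<subseteq> U1" by blast
  moreover have "smooth_on ?X S" by (rule smooth_on_subset[OF S1(11)]) blast
  ultimately show ?thesis by (rule that) (use W(3) in simp_all)
qed

lemma sgn_power_real: "sgn (x ^ k) = sgn (x :: real) ^ k"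
  by (induction k) (auto simp: sgn_mult)

text \<open>With b = \<eta>(S_1)(0) and u = det T' det S' at 0, the first quantity is u b^n (n+1)!
  and the second is det S' (-1)^(n-1) C u^n b^(0+1+...+(n-1)) for some C > 0; \<beta> is the sign of
  b. Nullity of the field is assumed modulo order n only, component by component, so that one field
  can be used for two germs with equal jets.\<close>

lemma morin_invariants:
  fixes f \<eta> S T :: "real^'n::{finite,linorder} \<Rightarrow> (real, 'n) vec"
  assumes S: "diffeo_germ S" and T: "diffeo_germ T"
    and f: "\<forall>\<^sub>F x in nhds 0. f x = T (morin_normal (S x))"
    and U: "open U" "0 \<in> U" and \<eta>: "smooth_on U \<eta>" "\<eta> 0 \<noteq> 0"
    and null: "\<And>i. \<exists>j w. sm U j \<and> (\<forall>x\<in>U. jac_det f x = 0 \<longrightarrow> j x = 0) \<and> sm U w \<and> Zo CARD('n) w \<and>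
      (\<forall>x\<in>U. frechet_derivative f (at x) (\<eta> x) $ i = j x + w x)"
  obtains \<beta> where "\<beta> \<in> {1, -1}"
    "sgn ((along \<eta> ^^ CARD('n)) (jac_det f) 0) =
      sgn (det (jacobian T (at 0))) * sgn (det (jacobian S (at 0))) * \<beta> ^ CARD('n)"
    "sgn (grad_det \<eta> (jac_det f) 0) = (-1) ^ (CARD('n) - 1) * sgn (det (jacobian S (at 0))) *
      (sgn (det (jacobian T (at 0))) * sgn (det (jacobian S (at 0)))) ^ CARD('n) * \<beta> ^ (\<Sum>k<CARD('n). k)"
proof -
  let ?M = "morin_normal :: (real, 'n) vec \<Rightarrow> (real, 'n) vec"
  let ?n = "CARD('n)"
  let ?c1 = "coord 1 :: 'n"
  have n: "1 \<le> ?n" by (simp add: Suc_leI)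
  obtain U1 V1 R where SR: "smooth_inverse U1 V1 S R" by (rule diffeo_germE[OF S])
  note S1 = smooth_inverseD[OF SR]
  obtain U2 V2 T' where TT: "smooth_inverse U2 V2 T T'" by (rule diffeo_germE[OF T])
  note T1 = smooth_inverseD[OF TT]
  obtain Y where Y: "open Y" "0 \<in> Y" "Y \<subseteq> U1" "smooth_on Y S" "\<forall>x\<in>Y. ?M (S x) \<in> U2"
    "\<forall>x\<in>Y. f x = T (?M (S x))"
    by (rule morin_form_neighbourhood[OF SR TT f])
  define X where "X = U \<inter> Y"
  have X: "open X" "0 \<in> X" using U Y(1,2) by (auto simp: X_def)
  have XU: "X \<subseteq> U" "X \<subseteq> U1" and XM: "\<And>x. x \<in> X \<Longrightarrow> ?M (S x) \<in> U2"
    and fX: "\<And>x. x \<in> X \<Longrightarrow> f x = T (?M (S x))" and smS: "smooth_on X S"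
    using Y(3,5,6) smooth_on_subset[OF Y(4)] by (auto simp: X_def)
  have SX: "S ` X \<subseteq> V1" using S1(7) XU(2) by blast
  have fV: "f ` X \<subseteq> V2" using fX XM T1(7) by auto
  have smS': "sm X (\<lambda>x. S x $ i)" for i using smooth_on_nth[OF X(1) smS] .
  define u where "u x = det (jacobian T (at (?M (S x)))) * det (jacobian S (at x))" for x
  note form = morin_form[where T=T, OF X(1) T1(1) smS T1(11) XM fX]
  have fsm: "smooth_on X f" by (rule form(1))
  have smf: "sm X (\<lambda>x. f x $ i)" for i by (rule smooth_on_nth[OF X(1) fsm])
  have jac: "jac_det f x = u x * morin_poly 1 (S x)" if "x \<in> X" for x
    unfolding u_def by (rule form(3)[OF _ _ that])
  have smu: "sm X u" unfolding u_def[abs_def] by (rule form(4))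
  have dS: "S differentiable (at x)" and df: "f differentiable (at x)" if "x \<in> X" for x
    using that smooth_on_differentiable smS fsm by blast+
  have dR: "R differentiable (at x)" if "x \<in> V1" for x
    using that smooth_on_differentiable S1(12) by blast
  define p where "p k x = morin_poly k (S x)" for k x
  have smp: "sm X (p k)" for k
    unfolding p_def by (rule sm_compose[OF X(1) sm_morin_poly[of UNIV] smS']) simp
  have DS: "((\<lambda>x. S x) has_derivative (\<lambda>v. jacobian S (at x) *v v)) (at x)" if "x \<in> X" for x
    using has_derivative_jacobian[OF dS[OF that]] .
  have Dp: "(p k has_derivative (\<lambda>v. morin_poly (Suc k) (S x) * (jacobian S (at x) *v v) $ ?c1 +
     (\<Sum>i\<in>-{?c1}. power_deriv k (pos i - 1) (S x $ ?c1) * (jacobian S (at x) *v v) $ i))) (at x)"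
    if "x \<in> X" for x k
    unfolding p_def using has_derivative_compose[OF DS[OF that] has_derivative_morin_poly] .
  have smeta: "sm X (\<lambda>x. \<eta> x $ i)" for i
    by (rule smooth_on_nth[OF X(1) smooth_on_subset[OF \<eta>(1) XU(1)]])
  have alS: "along \<eta> (\<lambda>x. S x $ i) x = (jacobian S (at x) *v \<eta> x) $ i" if "x \<in> X" for i x
    by (simp add: along_def jacobian_mult_nth[OF dS[OF that]])
  have alp: "along \<eta> (p k) x = morin_poly (Suc k) (S x) * along \<eta> (\<lambda>x. S x $ ?c1) x +
     (\<Sum>i\<in>-{?c1}. power_deriv k (pos i - 1) (S x $ ?c1) * along \<eta> (\<lambda>x. S x $ i) x)"
    if "x \<in> X" for x k
    unfolding along_def[of _ "p k"] frechet_derivative_at[OF Dp[OF that], symmetric] alS[OF that] ..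
  have pdvp: "pdv i (p k) x = morin_poly (Suc k) (S x) * pdv i (\<lambda>x. S x $ ?c1) x +
     (\<Sum>l\<in>-{?c1}. power_deriv k (pos l - 1) (S x $ ?c1) * pdv i (\<lambda>x. S x $ l) x)"
    if "x \<in> X" for x k i
    using pdv_eqI[OF Dp[OF that, of k], of i] jacobian_nth[OF dS[OF that]]
    by (simp add: matrix_vector_mult_basis column_def del: One_nat_def)
  interpret smooth_field X \<eta> by unfold_locales (use X smeta in auto)
  \<comment> \<open>For n = 1 the set {p_1 = 0} is the origin and p_1 has nonzero derivative there,
    so a constant c works. For n \<ge> 2 the map R(S x' - p_1(x') e_2) takes values in {p_1 = 0}
    near each of its points x and fixes x. Differentiating j along it gives dj(v) = dp_1(v) dj(R'
    e_2), so c is the derivative of j along R' e_2.\<close>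
  have tangent: "\<exists>c. sm X c \<and> (\<forall>x\<in>X. p 1 x = 0 \<longrightarrow> (\<forall>i. pdv i j x = c x * pdv i (p 1) x))"
    if j: "sm X j" "\<And>x. x \<in> X \<Longrightarrow> p 1 x = 0 \<Longrightarrow> j x = 0" for j
  proof (cases "?n = 1")
    case True
    have all: "i = ?c1" for i :: 'n
      using pos_range[of i] True coord_pos[of i] by (metis le_antisym)
    have zero: "x = 0" if x: "x \<in> X" "p 1 x = 0" for x
    proof -
      have "- {?c1} = {}" using all by auto
      then have "S x $ ?c1 = 0"
        using x(2) True unfolding p_def morin_poly_def by (simp add: power_deriv_def)
      then have "S x = 0" using all by (metis vec_eq_iff zero_index)
      then show "x = 0" using S1(6,9) x(1) XU(2) by (metis subsetD)
    qed
    have "pdv ?c1 (p 1) 0 \<noteq> 0"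
    proof
      assume z: "pdv ?c1 (p 1) 0 = 0"
      have "- {?c1} = {}" using all by auto
      moreover have "morin_poly (Suc 1) (S 0) \<noteq> 0"
        using S1(5) morin_poly_at_0[of "Suc 1", where 'n='n] True by simp
      ultimately have "pdv ?c1 (\<lambda>x. S x $ ?c1) 0 = 0" using pdvp[OF X(2), of ?c1 1] z by simp
      then have "jacobian S (at 0) $ ?c1 $ i = 0" for i
        using jacobian_nth[OF dS[OF X(2)], of ?c1 i] all[of i] by metis
      then have "row ?c1 (jacobian S (at 0)) = 0" by (simp add: row_def vec_eq_iff)
      then show False using det_zero_row(2) diffeo_germ_det[OF S] by blast
    qed
    then have "pdv ?c1 j 0 = pdv ?c1 j 0 / pdv ?c1 (p 1) 0 * pdv ?c1 (p 1) 0" by simp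
    then have "pdv i j 0 = pdv ?c1 j 0 / pdv ?c1 (p 1) 0 * pdv i (p 1) 0" for i
      using all[of i] by metis
    then have "pdv i j x = pdv ?c1 j 0 / pdv ?c1 (p 1) 0 * pdv i (p 1) x" if "x \<in> X" "p 1 x = 0" for x i
      unfolding zero[OF that] .
    then show ?thesis
      by (intro exI[of _ "\<lambda>x. pdv ?c1 j 0 / pdv ?c1 (p 1) 0"] conjI sm_const ballI impI allI)
  next
    case False
    then have n2: "2 \<le> ?n" using n by linarith
    let ?e = "axis (coord 2) 1 :: (real, 'n) vec"
    let ?c = "\<lambda>x. \<Sum>k\<in>UNIV. pdv (coord 2) (\<lambda>y. R y $ k) (S x) * pdv k j x"
    have smR: "sm V1 (\<lambda>y. R y $ k)" for k by (rule smooth_on_nth[OF S1(2,12)])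
    have "sm X ?c"
      by (intro sm_rules j sm_compose[OF X(1) sm_pdv[OF smR] smS' SX])
    moreover have "pdv i j x = ?c x * pdv i (p 1) x" if x: "x \<in> X" "p 1 x = 0" for x i
    proof -
      let ?Q = "\<lambda>x'. S x' - p 1 x' *\<^sub>R ?e"
      let ?dp = "frechet_derivative (p 1) (at x)"
      have Qx: "?Q x = S x" using x by simp
      have Sx: "S x \<in> V1" using SX x by blast
      have DQ: "(?Q has_derivative (\<lambda>v. jacobian S (at x) *v v - ?dp v *\<^sub>R ?e)) (at x)"
        by (intro has_derivative_diff DS x(1) has_derivative_scaleR_left)
          (use sm_differentiable[OF smp x(1)] frechet_derivative_works in blast)
      let ?JR = "jacobian R (at (S x))"
      have DRQ: "((\<lambda>x'. R (?Q x')) has_derivative (\<lambda>v. ?JR *v (jacobian S (at x) *v v - ?dp v *\<^sub>R ?e))) (at x)"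
        by (rule has_derivative_compose[OF DQ], unfold Qx, rule has_derivative_jacobian[OF dR[OF Sx]])
      have RQ: "R (?Q x) = x" unfolding Qx using S1(9) XU(2) x(1) by blast
      have "((\<lambda>x'. j (R (?Q x'))) has_derivative (\<lambda>v. frechet_derivative j (at x) (?JR *v (jacobian S (at x) *v v - ?dp v *\<^sub>R ?e)))) (at x)"
        by (rule has_derivative_compose[OF DRQ], unfold RQ)
          (use sm_differentiable[OF j(1) x(1)] frechet_derivative_works in blast)
      \<comment> \<open>By continuity the projected points remain in the domains of R and j for x'
        near x, and p_1 is 0 at them, so j vanishes there identically.\<close>
      moreover have "((\<lambda>x'. j (R (?Q x'))) has_derivative (\<lambda>v. 0)) (at x)"
      proof -
        have cQ: "isCont ?Q x" using DQ has_derivative_continuous by blast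
        have cRQ: "isCont (\<lambda>x'. R (?Q x')) x" using DRQ has_derivative_continuous by blast
        have "\<forall>\<^sub>F x' in nhds x. ?Q x' \<in> V1"
          using cQ S1(2) Sx Qx unfolding continuous_at_open eventually_nhds by metis
        moreover have "\<forall>\<^sub>F x' in nhds x. R (?Q x') \<in> X"
        proof -
          have "R (?Q x) \<in> X" unfolding RQ by (rule x(1))
          then show ?thesis
            using cRQ X(1) unfolding continuous_at_open eventually_nhds by metis
        qed
        ultimately have "\<forall>\<^sub>F x' in nhds x. j (R (?Q x')) = 0"
        proof eventually_elim
          case (elim x')
          have "p 1 (R (?Q x')) = 0"
            using elim(1) S1(10) morin_poly_shift[OF n2, of "S x'" "p 1 x'"] by (simp add: p_def)
          then show ?case using j(2) elim(2) by blast
        qed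
        then obtain N where "open N" "x \<in> N" "\<And>x'. x' \<in> N \<Longrightarrow> j (R (?Q x')) = 0"
          unfolding eventually_nhds by blast
        then show ?thesis
          using has_derivative_cong_open[of N x "\<lambda>x'. j (R (?Q x'))" "\<lambda>x'. 0"] by auto
      qed
      ultimately have "frechet_derivative j (at x) (?JR *v (jacobian S (at x) *v v - ?dp v *\<^sub>R ?e)) = 0" for v
        using fun_cong[OF has_derivative_unique] by blast
      moreover have "?JR *v (jacobian S (at x) *v v) = v" for v
        using det_jacobian_left_inverse(1)[of U1 x S R] S1(1,9) XU(2) x dS dR[OF Sx]
        by (simp add: matrix_vector_mul_assoc subsetD)
      ultimately have 0: "frechet_derivative j (at x) (v - ?dp v *\<^sub>R (?JR *v ?e)) = 0" for v
        by (metis matrix_vector_mult_diff_distrib matrix_vector_mult_scaleR)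
      have lin: "linear (frechet_derivative j (at x))"
        by (rule linear_frechet_derivative[OF sm_differentiable[OF j(1) x(1)]])
      have "frechet_derivative j (at x) v = ?dp v * frechet_derivative j (at x) (?JR *v ?e)" for v
        using 0[of v] by (simp add: linear_diff[OF lin] linear_scale[OF lin])
      from this[of "axis i 1"]
      have "pdv i j x = pdv i (p 1) x * frechet_derivative j (at x) (?JR *v ?e)"
        unfolding pdv_def .
      moreover have "frechet_derivative j (at x) (?JR *v ?e) = ?c x"
        using jacobian_nth[OF dR[OF Sx]]
        by (simp add: frechet_pdv[OF sm_differentiable[OF j(1) x(1)]] matrix_vector_mult_basis column_def)
      ultimately show ?thesis by (simp only: mult.commute)
    qed
    ultimately show ?thesis by blast
  qed
  interpret null_flag X \<eta> ?n p "along \<eta> (\<lambda>x. S x $ ?c1)"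
  proof unfold_locales
    fix k assume "1 \<le> k" "k \<le> ?n"
    then show "p k 0 = 0" by (simp add: p_def S1(5) morin_poly_at_0)
  qed (use n smp sm_along[OF smS'] tangent in auto)
  \<comment> \<open>The normal form fixes the coordinates other than the first, so S_i is a
    component of T' \<circ> f, and \<eta>(S_i) is a combination of the components of df(\<eta>) with
    smooth coefficients.\<close>
  have vanS: "van ?n (along \<eta> (\<lambda>x. S x $ i))" if i: "i \<noteq> ?c1" for i
  proof -
    have "along \<eta> (\<lambda>x. S x $ i) x = (\<Sum>k\<in>UNIV. pdv k (\<lambda>y. T' y $ i) (f x) * frechet_derivative f (at x) (\<eta> x) $ k)"
      if x: "x \<in> X" for x
    proof -
      have fx: "f x \<in> V2" using fV x by blast
      have "S y $ i = T' (f y) $ i" if "y \<in> X" for y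
        using fX[OF that] T1(9)[OF XM[OF that]] i by (simp add: morin_map_nth del: One_nat_def)
      then have eq: "along \<eta> (\<lambda>x. S x $ i) x = along \<eta> (\<lambda>x. T' (f x) $ i) x"
        by (rule along_cong_open[OF X(1) x])
      have D: "((\<lambda>x. T' (f x) $ i) has_derivative
          (\<lambda>v. \<Sum>k\<in>UNIV. frechet_derivative f (at x) v $ k * pdv k (\<lambda>y. T' y $ i) (f x))) (at x)"
      proof (rule has_derivative_compose[of f "frechet_derivative f (at x)" x UNIV "\<lambda>y. T' y $ i"])
        show "(f has_derivative frechet_derivative f (at x)) (at x)"
          using df[OF x] frechet_derivative_works by blast
        show "((\<lambda>y. T' y $ i) has_derivative (\<lambda>v. \<Sum>k\<in>UNIV. v $ k * pdv k (\<lambda>y. T' y $ i) (f x))) (at (f x))"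
          by (rule has_derivative_pdv[OF sm_differentiable[OF smooth_on_nth[OF T1(2,12)] fx]])
      qed
      show ?thesis
        unfolding eq along_def[of _ "\<lambda>x. T' (f x) $ i"] frechet_derivative_at[OF D, symmetric]
        by (simp add: mult.commute)
    qed
    moreover have "van ?n (\<lambda>x. \<Sum>k\<in>UNIV. pdv k (\<lambda>y. T' y $ i) (f x) * frechet_derivative f (at x) (\<eta> x) $ k)"
    proof (rule van_sum, rule van_mult)
      fix k
      have "sm V2 (\<lambda>y. T' y $ i)" by (rule smooth_on_nth[OF T1(2,12)])
      then show "sm X (\<lambda>x. pdv k (\<lambda>y. T' y $ i) (f x))"
        by (intro sm_compose[OF X(1) sm_pdv _ fV] smf)
      obtain j w where jw: "sm U j" "\<forall>x\<in>U. jac_det f x = 0 \<longrightarrow> j x = 0" "sm U w" "Zo ?n w"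
        "\<forall>x\<in>U. frechet_derivative f (at x) (\<eta> x) $ k = j x + w x"
        using null[of k] by blast
      have "van ?n (\<lambda>x. j x + w x)"
      proof (rule van_add[OF van_vanishing van_order])
        show "j x = 0" if "x \<in> X" "p 1 x = 0" for x
          using jw(2) that jac XU(1) by (auto simp: p_def)
      qed (rule sm_subset[OF jw(1) XU(1)] sm_subset[OF jw(3) XU(1)] jw(4))+
      then show "van ?n (\<lambda>x. frechet_derivative f (at x) (\<eta> x) $ k)"
        using van_cong[of "\<lambda>x. frechet_derivative f (at x) (\<eta> x) $ k" "\<lambda>x. j x + w x"] jw(5) XU(1) by auto
    qed
    ultimately show ?thesis by (subst van_cong) auto
  qed
  \<comment> \<open>In the chain rule for \<eta> p_k only the term of \<eta>(S_1) lies outside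
    \<open>van n\<close>, and it is a p_(k+1).\<close>
  interpret null_chain X \<eta> ?n p "along \<eta> (\<lambda>x. S x $ ?c1)"
  proof unfold_locales
    fix k
    have "van ?n (\<lambda>x. \<Sum>i\<in>-{?c1}. power_deriv k (pos i - 1) (S x $ ?c1) * along \<eta> (\<lambda>x. S x $ i) x)"
      by (intro van_sum van_mult vanS sm_compose[OF X(1) sm_power_deriv[of UNIV] smS']) auto
    then show "van ?n (\<lambda>x. along \<eta> (p k) x - along \<eta> (\<lambda>x. S x $ ?c1) x * p (Suc k) x)"
      by (subst van_cong) (auto simp: alp p_def algebra_simps)
  qed
  let ?b = "along \<eta> (\<lambda>x. S x $ ?c1) 0"
  \<comment> \<open>The other components \<eta>(S_i) vanish at 0 by \<open>van_at_0\<close>, so with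
    b = 0 the invertible matrix S'(0) would annihilate \<eta>(0).\<close>
  have b: "?b \<noteq> 0"
  proof
    assume b0: "?b = 0"
    have "along \<eta> (\<lambda>x. S x $ i) 0 = 0" for i
    proof (cases "i = ?c1")
      case False
      then show ?thesis using van_at_0[OF van_mono[OF vanS]] n by (metis One_nat_def)
    qed (use b0 in simp)
    then have "jacobian S (at 0) *v \<eta> 0 = 0" using alS[OF X(2)] by (simp add: vec_eq_iff)
    moreover have "invertible (jacobian S (at 0))"
      using diffeo_germ_det[OF S] invertible_det_nz by blast
    ultimately have "\<eta> 0 = 0"
      by (metis invertible_def matrix_vector_mul_assoc matrix_vector_mul_lid matrix_vector_mult_0_right)
    then show False using \<eta>(2) by simp
  qed
  have u0: "u 0 = det (jacobian T (at 0)) * det (jacobian S (at 0))"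
    by (simp add: u_def S1(5) morin_at_0)
  have it: "(along \<eta> ^^ k) (jac_det f) x = (along \<eta> ^^ k) (\<lambda>x. u x * p 1 x) x" if "x \<in> X" for k x
    by (rule along_iter_cong_open[OF X(1) _ that]) (simp add: jac p_def del: One_nat_def)
  have A: "(along \<eta> ^^ ?n) (jac_det f) 0 = u 0 * ?b ^ ?n * fact (?n + 1)"
    using along_iter_at_0[OF smu] it[OF X(2)] by (simp add: p_def S1(5) morin_poly_at_0)
  define P :: "((real, 'n) vec, 'n) vec" where "P = (\<chi> i j. pdv i (p (pos j)) 0)"
  have "\<forall>k. \<exists>t. k < ?n \<longrightarrow> (\<forall>i. pdv i ((along \<eta> ^^ k) (\<lambda>x. u x * p 1 x)) 0 =
    u 0 * ?b ^ k * pdv i (p (Suc k)) 0 + (\<Sum>l<k. t l * pdv i (p (Suc l)) 0))"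
  proof
    fix k
    show "\<exists>t. k < ?n \<longrightarrow> (\<forall>i. pdv i ((along \<eta> ^^ k) (\<lambda>x. u x * p 1 x)) 0 =
      u 0 * ?b ^ k * pdv i (p (Suc k)) 0 + (\<Sum>l<k. t l * pdv i (p (Suc l)) 0))"
    proof (cases "k < ?n")
      case True
      from pdv_along_iter_at_0[OF smu True] obtain t where
        "\<And>i. pdv i ((along \<eta> ^^ k) (\<lambda>x. u x * p 1 x)) 0 =
          u 0 * ?b ^ k * pdv i (p (Suc k)) 0 + (\<Sum>l<k. t l * pdv i (p (Suc l)) 0)" by blast
      then show ?thesis by (intro exI[of _ t]) simp
    qed simp
  qed
  then obtain t where t: "\<And>k i. k < ?n \<Longrightarrow> pdv i ((along \<eta> ^^ k) (\<lambda>x. u x * p 1 x)) 0 =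
    u 0 * ?b ^ k * pdv i (p (Suc k)) 0 + (\<Sum>l<k. t k l * pdv i (p (Suc l)) 0)"
    using choice[of "\<lambda>k t. k < ?n \<longrightarrow> (\<forall>i. pdv i ((along \<eta> ^^ k) (\<lambda>x. u x * p 1 x)) 0 =
      u 0 * ?b ^ k * pdv i (p (Suc k)) 0 + (\<Sum>l<k. t l * pdv i (p (Suc l)) 0))"] by auto
  have G: "grad_det \<eta> (jac_det f) 0 = det P * (\<Prod>k<?n. u 0 * ?b ^ k)"
    unfolding grad_det_def
  proof (rule det_triangular_combination[where t="\<lambda>j. t (pos j - 1)"])
    fix i j :: 'n
    have k: "pos j - 1 < ?n" "Suc (pos j - 1) = pos j" using pos_range[of j] by auto
    have "grad ((along \<eta> ^^ (pos j - 1)) (jac_det f)) 0 $ i = pdv i ((along \<eta> ^^ (pos j - 1)) (\<lambda>x. u x * p 1 x)) 0"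
      unfolding grad_nth by (rule pdv_cong_open[OF X it])
    also have "\<dots> = u 0 * ?b ^ (pos j - 1) * P $ i $ j + (\<Sum>l<pos j - 1. t (pos j - 1) l * pdv i (p (Suc l)) 0)"
      unfolding t[OF k(1)] k(2) P_def by simp
    also have "(\<Sum>l<pos j - 1. t (pos j - 1) l * pdv i (p (Suc l)) 0) =
      (\<Sum>l<pos j - 1. t (pos j - 1) l * P $ i $ coord (Suc l))"
      by (rule sum.cong) (use k(1) in \<open>auto simp: P_def pos_coord\<close>)
    finally show "(\<chi> i j. grad ((along \<eta> ^^ (pos j - 1)) (jac_det f)) 0 $ i) $ i $ j =
      u 0 * ?b ^ (pos j - 1) * P $ i $ j + (\<Sum>l<pos j - 1. t (pos j - 1) l * P $ i $ coord (Suc l))"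
      by simp
  qed
  obtain C where C: "C > 0" "det P = det (jacobian S (at 0)) * ((-1) ^ (?n - 1) * C)"
  proof -
    obtain C where C: "C > 0"
      "det (\<chi> i j. pdv i (morin_poly (pos j)) (0 :: (real, 'n) vec)) = (-1) ^ (?n - 1) * C"
      by (rule det_morin_gradients)
    \<comment> \<open>Gradients are pulled back by the transpose of S'(0). This is the origin of the
      factor det S'(0) that stands outside the power of u.\<close>
    have "P = transpose (jacobian S (at 0)) ** (\<chi> i j. pdv i (morin_poly (pos j)) 0)"
    proof -
      have "pdv i (p (pos j)) 0 = (\<Sum>l\<in>UNIV. jacobian S (at 0) $ l $ i * pdv l (morin_poly (pos j)) 0)" for i and j :: 'n
        unfolding p_def
        using pdv_compose[of S 0 "morin_poly (pos j)" i] sm_differentiable[OF smS' X(2)] jacobian_nth[OF dS[OF X(2)]]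
          sm_differentiable[OF sm_morin_poly[of UNIV], of "S 0"] S1(5) by simp
      then show ?thesis by (simp add: P_def matrix_matrix_mult_def transpose_def vec_eq_iff)
    qed
    then show ?thesis using that C by (simp add: det_mul det_transpose)
  qed
  have prod: "(\<Prod>k<?n. u 0 * ?b ^ k) = u 0 ^ ?n * ?b ^ (\<Sum>k<?n. k)"
    by (simp add: prod.distrib power_sum)
  show ?thesis
  proof (rule that)
    show "sgn ?b \<in> {1, -1}" using b by (auto simp: sgn_if)
  qed (unfold A G C(2) prod, unfold u0 sgn_mult sgn_power_real, use C(1) in simp_all)
qed

section \<open>Classification up to isotopy\<close>

lemma diffeo_germ_inverse_det:
  assumes "diffeo_germ s" "diffeo_germ t" "\<forall>\<^sub>F x in nhds 0. t (s x) = x"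
  shows "det (jacobian t (at 0)) * det (jacobian s (at 0)) = 1"
proof -
  obtain N where N: "open N" "0 \<in> N" "\<And>x. x \<in> N \<Longrightarrow> t (s x) = x"
    using assms(3) unfolding eventually_nhds by blast
  have "jacobian (\<lambda>x. t (s x)) (at 0) = jacobian (\<lambda>x. mat 1 *v x) (at 0)"
    by (rule jacobian_cong_open[OF N(1,2)]) (simp add: N(3))
  then have "det (jacobian (\<lambda>x. t (s x)) (at 0)) = 1" by (simp only: jacobian_linear det_I)
  then show ?thesis using diffeo_germ_compose_det[OF assms(1,2)] by simp
qed

lemma differentiable_tendsto_0:
  assumes "f differentiable (at 0)" "f 0 = 0"
  shows "filterlim f (nhds 0) (nhds 0)"
  using differentiable_imp_continuous_within[OF assms(1)] tendsto_at_iff_tendsto_nhds[of f 0] assms(2)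
  by (simp add: continuous_within)

lemma diffeo_germ_tendsto: "diffeo_germ s \<Longrightarrow> filterlim s (nhds 0) (nhds 0)"
  by (rule differentiable_tendsto_0[OF diffeo_germ_differentiable]) (simp_all add: diffeo_germ_def)

text \<open>\<sigma> belongs to the source, \<tau> to the target. The factorization is not unique,
  and a germ can have two types.\<close>

definition morin_type :: "real \<Rightarrow> real \<Rightarrow> (real^'n::{finite,linorder} \<Rightarrow> (real, 'n) vec) \<Rightarrow> bool" where
  "morin_type \<sigma> \<tau> f \<longleftrightarrow> (\<exists>S T. diffeo_germ S \<and> diffeo_germ T \<and>
     (\<forall>\<^sub>F x in nhds 0. f x = T (morin_normal (S x))) \<and>
     sgn (det (jacobian S (at 0))) = \<sigma> \<and> sgn (det (jacobian T (at 0))) = \<tau>)"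

text \<open>A representative of the type (\<sigma>, \<tau>) with its signs where the germs of the
  statement have them: \<epsilon>_2 = \<sigma> and \<epsilon>_1 = \<tau>, in reversed order of
  arguments. On the line there is no x_2, and \<sigma> = 1 is used.\<close>

definition morin_model :: "real \<Rightarrow> real \<Rightarrow> real^'n::{finite,linorder} \<Rightarrow> (real, 'n) vec" where
  "morin_model \<sigma> \<tau> x = sign_at 1 \<tau> *v morin_normal (sign_at 2 \<sigma> *v x)"

lemma morin_tendsto:
  "filterlim (morin_normal :: real^'n::{finite,linorder} \<Rightarrow> (real, 'n) vec) (nhds 0) (nhds 0)"
proof -
  have "(morin_normal :: (real, 'n) vec \<Rightarrow> (real, 'n) vec) differentiable (at 0)"
    using smooth_on_differentiable[OF smooth_on_morin[of UNIV]] by simp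
  then show ?thesis by (rule differentiable_tendsto_0) (rule morin_at_0)
qed

text \<open>\<open>A_equivalent\<close> presents the normal form as t \<circ> f \<circ> s, and local
  inverses solve for f. Continuity of f at 0 is needed to cancel t after f.\<close>

lemma Morin_singularity_type:
  fixes f :: "real^'n::{finite,linorder} \<Rightarrow> (real, 'n) vec"
  assumes "Morin_singularity CARD('n) f"
  obtains \<sigma> \<tau> where "\<sigma> \<in> {1, -1}" "\<tau> \<in> {1, -1}" "morin_type \<sigma> \<tau> f"
proof -
  obtain s t where st: "diffeo_germ s" "diffeo_germ t" "\<forall>\<^sub>F x in nhds 0. morin_normal x = t (f (s x))"
    using assms unfolding Morin_singularity_def A_equivalent_def by blast
  obtain S where S: "diffeo_germ S" "\<forall>\<^sub>F x in nhds 0. s (S x) = x"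
    using diffeo_germ_inverse[OF st(1)] by metis
  obtain T where T: "diffeo_germ T" "\<forall>\<^sub>F x in nhds 0. T (t x) = x"
    using diffeo_germ_inverse[OF st(2)] by metis
  have f0: "filterlim f (nhds 0) (nhds 0)"
  proof -
    obtain U where U: "open U" "0 \<in> U" "smooth_on U f" "f 0 = 0"
      using assms unfolding Morin_singularity_def map_germ_def by blast
    show ?thesis by (rule differentiable_tendsto_0[OF smooth_on_differentiable[OF U(3,2)] U(4)])
  qed
  have "\<forall>\<^sub>F x in nhds 0. morin_normal (S x) = t (f (s (S x)))"
    by (rule eventually_compose_filterlim[OF st(3) diffeo_germ_tendsto[OF S(1)]])
  moreover have "\<forall>\<^sub>F x in nhds 0. T (t (f x)) = f x"
    by (rule eventually_compose_filterlim[OF T(2) f0])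
  ultimately have "\<forall>\<^sub>F x in nhds 0. f x = T (morin_normal (S x))"
    using S(2) by eventually_elim simp
  then have "morin_type (sgn (det (jacobian S (at 0)))) (sgn (det (jacobian T (at 0)))) f"
    unfolding morin_type_def using S(1) T(1) by blast
  moreover have "sgn x \<in> {1, -1}" if "x \<noteq> 0" for x :: real using that by (auto simp: sgn_if)
  ultimately show ?thesis
    using that diffeo_germ_det[OF S(1)] diffeo_germ_det[OF T(1)] by blast
qed

text \<open>The symmetry is inserted between T and S. It changes nothing for n = 4l, reverses
  \<sigma> alone for n = 4l+1, both signs for n = 4l+2, and \<tau> alone for n = 4l+3. Hence four
  classes in the first case and two in each of the others.\<close>

lemma morin_type_flip:
  fixes f :: "real^'n::{finite,linorder} \<Rightarrow> (real, 'n) vec"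
  assumes "morin_type \<sigma> \<tau> f"
  shows "morin_type ((-1) ^ (CARD('n) * (CARD('n) + 1) div 2) * \<sigma>)
    ((-1) ^ (CARD('n) * (CARD('n) + 1) div 2 + CARD('n)) * \<tau>) f"
proof -
  obtain S T where ST: "diffeo_germ S" "diffeo_germ T" "\<forall>\<^sub>F x in nhds 0. f x = T (morin_normal (S x))"
    "sgn (det (jacobian S (at 0))) = \<sigma>" "sgn (det (jacobian T (at 0))) = \<tau>"
    using assms unfolding morin_type_def by blast
  let ?K1 = "sym_source :: ((real, 'n) vec, 'n) vec"
  let ?K2 = "sym_target :: ((real, 'n) vec, 'n) vec"
  have d: "diffeo_germ (\<lambda>x. ?K1 *v x)" "diffeo_germ (\<lambda>x. ?K2 *v x)"
    by (rule diffeo_germ_linear, simp add: det_sym)+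
  have sg: "sgn ((-1) ^ k * x) = (-1) ^ k * sgn x" for k and x :: real
    by (cases "even k") (auto simp: sgn_minus)
  have "det (jacobian (\<lambda>x. ?K1 *v S x) (at 0)) = det ?K1 * det (jacobian S (at 0))"
    "det (jacobian (\<lambda>x. T (?K2 *v x)) (at 0)) = det ?K2 * det (jacobian T (at 0))"
    using diffeo_germ_compose_det[OF ST(1) d(1)] diffeo_germ_compose_det[OF d(2) ST(2)]
    by (simp_all only: jacobian_linear mult.commute)
  then show ?thesis
    unfolding morin_type_def using ST(3-5) diffeo_germ_compose[OF ST(1) d(1)] diffeo_germ_compose[OF d(2) ST(2)]
    by (intro exI[of _ "\<lambda>x. ?K1 *v S x"] exI[of _ "\<lambda>x. T (?K2 *v x)"])
      (simp add: det_sym sg morin_symmetry del: power_Suc)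
qed

lemma det_sign_at_2:
  assumes "2 \<le> CARD('n) \<or> \<sigma> = 1"
  shows "det (sign_at 2 \<sigma> :: real^'n::{finite,linorder}^'n::{finite,linorder}) = \<sigma>"
  using assms det_sign_at[of 2, where 'n='n] by (auto simp: sign_at_1)

lemma det_sign_at_1: "det (sign_at 1 \<tau> :: real^'n::{finite,linorder}^'n::{finite,linorder}) = \<tau>"
  by (rule det_sign_at) (auto simp: Suc_leI)

text \<open>The source map is the inverse of S after the sign matrix of \<sigma>, the target map is
  the sign matrix of \<tau> after the inverse of T. The sign matrices make both determinants
  positive.\<close>

lemma A_isotopic_model:
  fixes f :: "real^'n::{finite,linorder} \<Rightarrow> (real, 'n) vec"
  assumes "morin_type \<sigma> \<tau> f" "\<sigma> \<in> {1, -1}" "\<tau> \<in> {1, -1}" "2 \<le> CARD('n) \<or> \<sigma> = 1"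
  shows "A_isotopic r f (morin_model \<sigma> \<tau>)"
proof -
  obtain S T where ST: "diffeo_germ S" "diffeo_germ T" "\<forall>\<^sub>F x in nhds 0. f x = T (morin_normal (S x))"
    "sgn (det (jacobian S (at 0))) = \<sigma>" "sgn (det (jacobian T (at 0))) = \<tau>"
    using assms(1) unfolding morin_type_def by blast
  obtain s where s: "diffeo_germ s" "\<forall>\<^sub>F x in nhds 0. s (S x) = x" "\<forall>\<^sub>F x in nhds 0. S (s x) = x"
    using diffeo_germ_inverse[OF ST(1)] .
  obtain t where t: "diffeo_germ t" "\<forall>\<^sub>F x in nhds 0. t (T x) = x" "\<forall>\<^sub>F x in nhds 0. T (t x) = x"
    using diffeo_germ_inverse[OF ST(2)] .
  let ?E1 = "sign_at 2 \<sigma> :: ((real, 'n) vec, 'n) vec"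
  let ?E2 = "sign_at 1 \<tau> :: ((real, 'n) vec, 'n) vec"
  have d: "det ?E1 = \<sigma>" "det ?E2 = \<tau>" using det_sign_at_2[OF assms(4)] det_sign_at_1 by auto
  have E: "diffeo_germ (\<lambda>x. ?E1 *v x)" "diffeo_germ (\<lambda>x. ?E2 *v x)"
    by (rule diffeo_germ_linear, use d assms(2,3) in force)+
  have pos: "x * y > 0" if "sgn z = x" "y * z = 1" "x \<in> {1, -1}" for x y z :: real
  proof -
    have "0 < y \<and> 0 < z \<or> y < 0 \<and> z < 0" using that(2) zero_less_mult_iff[of y z] by simp
    then show ?thesis using that by (auto simp: zero_less_mult_iff sgn_if split: if_splits)
  qed
  show ?thesis
  proof (rule A_isotopicI)
    show "diffeo_germ (\<lambda>x. s (?E1 *v x))" by (rule diffeo_germ_compose[OF E(1) s(1)])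
    show "diffeo_germ (\<lambda>x. ?E2 *v t x)" by (rule diffeo_germ_compose[OF t(1) E(2)])
    show "det (jacobian (\<lambda>x. s (?E1 *v x)) (at 0)) > 0"
      using diffeo_germ_compose_det[OF E(1) s(1)] d pos[OF ST(4) diffeo_germ_inverse_det[OF ST(1) s(1,2)] assms(2)]
      by (simp add: jacobian_linear mult.commute)
    show "det (jacobian (\<lambda>x. ?E2 *v t x) (at 0)) > 0"
      using diffeo_germ_compose_det[OF t(1) E(2)] d pos[OF ST(5) diffeo_germ_inverse_det[OF ST(2) t(1,2)] assms(3)]
      by (simp add: jacobian_linear mult.commute)
    have sE: "filterlim (\<lambda>x. s (?E1 *v x)) (nhds 0) (nhds 0)"
      by (rule diffeo_germ_tendsto[OF diffeo_germ_compose[OF E(1) s(1)]])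
    have "\<forall>\<^sub>F x in nhds 0. f (s (?E1 *v x)) = T (morin_normal (S (s (?E1 *v x))))"
      by (rule eventually_compose_filterlim[OF ST(3) sE])
    moreover have "\<forall>\<^sub>F x in nhds 0. S (s (?E1 *v x)) = ?E1 *v x"
      by (rule eventually_compose_filterlim[OF s(3) diffeo_germ_tendsto[OF E(1)]])
    moreover have "\<forall>\<^sub>F x in nhds 0. t (T (morin_normal (?E1 *v x))) = morin_normal (?E1 *v x)"
      by (rule eventually_compose_filterlim[OF t(2) filterlim_compose[OF morin_tendsto diffeo_germ_tendsto[OF E(1)]]])
    ultimately show "\<forall>\<^sub>F x in nhds 0. morin_model \<sigma> \<tau> x = ?E2 *v t (f (s (?E1 *v x)))"
      by eventually_elim (simp add: morin_model_def)
  qed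
qed

text \<open>For an exact null field the components of df(\<eta>) themselves vanish on the singular
  set, so the part of finite order is 0. The last two conclusions prepare the case n = 1, which is
  stated with second derivatives of f.\<close>

lemma null_field_invariants:
  fixes f \<eta> :: "real^'n::{finite,linorder} \<Rightarrow> (real, 'n) vec"
  assumes "morin_type \<sigma> \<tau> f" "null_vector_field f \<eta>"
  obtains \<beta> where "\<beta> \<in> {1, -1}"
    "sgn ((along \<eta> ^^ CARD('n)) (jac_det f) 0) = \<tau> * \<sigma> * \<beta> ^ CARD('n)"
    "sgn (grad_det \<eta> (jac_det f) 0) = (-1) ^ (CARD('n) - 1) * \<sigma> * (\<tau> * \<sigma>) ^ CARD('n) * \<beta> ^ (\<Sum>k<CARD('n). k)"
    "jac_det f 0 = 0"
    "\<exists>X. open X \<and> 0 \<in> X \<and> smooth_on X f \<and> smooth_on X \<eta> \<and> \<eta> 0 \<noteq> 0"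
proof -
  obtain S T where ST: "diffeo_germ S" "diffeo_germ T" "\<forall>\<^sub>F x in nhds 0. f x = T (morin_normal (S x))"
    "sgn (det (jacobian S (at 0))) = \<sigma>" "sgn (det (jacobian T (at 0))) = \<tau>"
    using assms(1) unfolding morin_type_def by blast
  obtain U where U: "open U" "0 \<in> U" "smooth_on U \<eta>" "\<And>p. p \<in> U \<Longrightarrow> \<eta> p \<noteq> 0"
    "\<And>p. p \<in> U \<Longrightarrow> jac_det f p = 0 \<Longrightarrow> frechet_derivative f (at p) (\<eta> p) = 0"
    using assms(2) unfolding null_vector_field_def by blast
  obtain U1 V1 R where SR: "smooth_inverse U1 V1 S R" by (rule diffeo_germE[OF ST(1)])
  obtain U2 V2 T' where TT: "smooth_inverse U2 V2 T T'" by (rule diffeo_germE[OF ST(2)])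
  obtain Y where Y: "open Y" "0 \<in> Y" "Y \<subseteq> U1" "smooth_on Y S" "\<forall>x\<in>Y. morin_normal (S x) \<in> U2"
    "\<forall>x\<in>Y. f x = T (morin_normal (S x))"
    by (rule morin_form_neighbourhood[OF SR TT ST(3)])
  note form = morin_form[where T=T, OF Y(1) smooth_inverseD(1)[OF TT] Y(4) smooth_inverseD(11)[OF TT] Y(5,6)[rule_format]]
  define X where "X = U \<inter> Y"
  have X: "open X" "0 \<in> X" "X \<subseteq> U" using U(1,2) Y(1,2) by (auto simp: X_def)
  have fsm: "smooth_on X f" using smooth_on_subset[OF form(1)] by (simp add: X_def)
  have esm: "smooth_on X \<eta>" by (rule smooth_on_subset[OF U(3) X(3)])
  have "\<exists>j w. sm X j \<and> (\<forall>x\<in>X. jac_det f x = 0 \<longrightarrow> j x = 0) \<and> sm X w \<and> Zo CARD('n) w \<and>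
      (\<forall>x\<in>X. frechet_derivative f (at x) (\<eta> x) $ i = j x + w x)" for i
  proof (intro exI conjI ballI impI)
    show "sm X (\<lambda>x. \<Sum>k\<in>UNIV. \<eta> x $ k * pdv k (\<lambda>x. f x $ i) x)"
      by (intro sm_sum sm_mult sm_pdv smooth_on_nth[OF X(1)] X(1) fsm esm)
    fix x assume x: "x \<in> X"
    have df: "f differentiable (at x)" by (rule smooth_on_differentiable[OF fsm x])
    show eq: "frechet_derivative f (at x) (\<eta> x) $ i = (\<Sum>k\<in>UNIV. \<eta> x $ k * pdv k (\<lambda>x. f x $ i) x) + 0"
      by (simp add: frechet_vec_nth[OF df] frechet_pdv[OF sm_differentiable[OF smooth_on_nth[OF X(1) fsm] x]])
    show "(\<Sum>k\<in>UNIV. \<eta> x $ k * pdv k (\<lambda>x. f x $ i) x) = 0" if "jac_det f x = 0"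
      using eq U(5)[OF _ that] x X(3) by auto
  qed (rule sm_const Zo_zero)+
  from morin_invariants[OF ST(1-3) X(1,2) esm U(4)[OF U(2)] this, unfolded ST(4,5)]
  obtain \<beta> where \<beta>: "\<beta> \<in> {1, -1}"
    "sgn ((along \<eta> ^^ CARD('n)) (jac_det f) 0) = \<tau> * \<sigma> * \<beta> ^ CARD('n)"
    "sgn (grad_det \<eta> (jac_det f) 0) = (-1) ^ (CARD('n) - 1) * \<sigma> * (\<tau> * \<sigma>) ^ CARD('n) * \<beta> ^ (\<Sum>k<CARD('n). k)"
    by blast
  show ?thesis
  proof (rule that[OF \<beta>])
    show "jac_det f 0 = 0"
      using form(3)[OF _ _ Y(2)] smooth_inverseD(5)[OF SR] by (simp add: morin_poly_at_0)
    show "\<exists>X. open X \<and> 0 \<in> X \<and> smooth_on X f \<and> smooth_on X \<eta> \<and> \<eta> 0 \<noteq> 0"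
      using X(1,2) fsm esm U(2,4) by blast
  qed
qed

text \<open>The exact null field of \<open>h = T \<circ> M \<circ> S\<close>, scaled so that \<open>dh(\<eta>)\<close> is a multiple of the Jacobian
  determinant, is an approximate null field of every germ with the same jet.\<close>

lemma invariants_of_equal_jets:
  fixes g h S T E1 E2 :: "real^'n::{finite,linorder} \<Rightarrow> (real, 'n) vec"
  assumes S: "diffeo_germ S" and T: "diffeo_germ T" and h: "\<And>x. h x = T (morin_normal (S x))"
    and E: "diffeo_germ E1" "diffeo_germ E2" and g: "\<And>x. g x = E2 (morin_normal (E1 x))"
    and jets: "jet r g = jet r h" and r: "CARD('n) + 1 \<le> r"
    and gsm: "smooth_on UNIV g"
  obtains \<beta> \<beta>' where "\<beta> \<in> {1, -1}" "\<beta>' \<in> {1, -1}"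
    "sgn (det (jacobian T (at 0))) * sgn (det (jacobian S (at 0))) * \<beta> ^ CARD('n) =
     sgn (det (jacobian E2 (at 0))) * sgn (det (jacobian E1 (at 0))) * \<beta>' ^ CARD('n)"
    "sgn (det (jacobian S (at 0))) * (sgn (det (jacobian T (at 0))) * sgn (det (jacobian S (at 0)))) ^ CARD('n) *
       \<beta> ^ (\<Sum>k<CARD('n). k) =
     sgn (det (jacobian E1 (at 0))) * (sgn (det (jacobian E2 (at 0))) * sgn (det (jacobian E1 (at 0)))) ^ CARD('n) *
       \<beta>' ^ (\<Sum>k<CARD('n). k)"
proof -
  let ?n = "CARD('n)"
  let ?M = "morin_normal :: (real, 'n) vec \<Rightarrow> (real, 'n) vec"
  let ?c = "coord 1 :: 'n"
  have n: "1 \<le> ?n" by (simp add: Suc_leI)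
  obtain U1 V1 R where SR: "smooth_inverse U1 V1 S R" by (rule diffeo_germE[OF S])
  note S1 = smooth_inverseD[OF SR]
  obtain U2 V2 T' where TT: "smooth_inverse U2 V2 T T'" by (rule diffeo_germE[OF T])
  note T1 = smooth_inverseD[OF TT]
  obtain X where X: "open X" "0 \<in> X" and XU: "X \<subseteq> U1" and smS: "smooth_on X S"
    and XM: "\<forall>x\<in>X. ?M (S x) \<in> U2" and hX: "\<forall>x\<in>X. h x = T (?M (S x))"
    by (rule morin_form_neighbourhood[OF SR TT always_eventually[OF allI[OF h]]])
  note XM = XM[rule_format] and hX = hX[rule_format]
  have SX: "S ` X \<subseteq> V1" using S1(7) XU by blast
  have smMS: "smooth_on X (\<lambda>x. ?M (S x))"
    by (rule smooth_on_compose[OF X(1) open_UNIV smS smooth_on_morin]) simp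
  note form = morin_form[where T=T, OF X(1) T1(1) smS T1(11) XM hX]
  have hsm: "smooth_on X h" by (rule form(1))
  have gsm: "smooth_on X g" by (rule smooth_on_subset[OF gsm]) simp
  define u where "u x = det (jacobian T (at (?M (S x)))) * det (jacobian S (at x))" for x
  have smu: "sm X u" unfolding u_def[abs_def] by (rule form(4))
  \<comment> \<open>v is the field that S carries to e_1, so dh(v) is p_1 \<circ> S times T' e_1.
    The factor u in \<eta> turns p_1 \<circ> S into the Jacobian determinant of h, which can be
    compared with that of g.\<close>
  define v where "v x = (\<chi> i. pdv ?c (\<lambda>y. R y $ i) (S x))" for x
  define \<eta> where "\<eta> x = u x *\<^sub>R v x" for x
  define q where "q i x = pdv ?c (\<lambda>y. T y $ i) (?M (S x))" for i x
  have smv: "sm X (\<lambda>x. v x $ i)" for i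
    unfolding v_def by (simp, rule sm_compose[OF X(1) sm_pdv[OF smooth_on_nth[OF S1(2,12)]] smooth_on_nth[OF X(1) smS] SX])
  have smeta: "sm X (\<lambda>x. \<eta> x $ i)" for i
    unfolding \<eta>_def by (simp, intro sm_mult X(1) smu smv)
  have etasm: "smooth_on X \<eta>" by (rule smooth_onI_nth[OF X(1) smeta])
  have smq: "sm X (q i)" for i
    unfolding q_def[abs_def]
    by (rule sm_compose[OF X(1) sm_pdv[OF smooth_on_nth[OF T1(1,11)]] smooth_on_nth[OF X(1) smMS]]) (use XM in auto)
  have JSv: "jacobian S (at x) *v v x = axis ?c 1" if x: "x \<in> X" for x
  proof -
    have Sx: "S x \<in> V1" using SX x by blast
    have dR: "R differentiable (at (S x))" by (rule smooth_on_differentiable[OF S1(12) Sx])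
    have RS: "R (S x) = x" using S1(9) XU x by blast
    have "S differentiable (at (R (S x)))" unfolding RS by (rule smooth_on_differentiable[OF smS x])
    from det_jacobian_left_inverse(1)[OF S1(2) Sx dR this S1(10)]
    have "jacobian S (at x) ** jacobian R (at (S x)) = mat 1" by (simp add: RS)
    moreover have "v x = jacobian R (at (S x)) *v axis ?c 1"
      by (simp add: v_def matrix_vector_mult_basis column_def jacobian_nth[OF dR])
    ultimately show ?thesis by (simp add: matrix_vector_mul_assoc)
  qed
  have dh: "frechet_derivative h (at x) (\<eta> x) $ i = jac_det h x * q i x" if x: "x \<in> X" for x i
  proof -
    have dM: "?M differentiable (at (S x))"
      using smooth_on_differentiable[OF smooth_on_morin[of UNIV]] by simp
    have JM: "jacobian ?M (at (S x)) *v axis ?c 1 = morin_poly 1 (S x) *\<^sub>R axis ?c 1"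
      unfolding matrix_vector_mult_basis vec_eq_iff
      by (simp add: column_def jacobian_nth[OF dM] morin_map_nth pdv_morin_poly pdv_coord axis_def)
    have dT: "T differentiable (at (?M (S x)))" by (rule smooth_on_differentiable[OF T1(11) XM[OF x]])
    have Jh: "jacobian h (at x) = jacobian T (at (?M (S x))) ** (jacobian ?M (at (S x)) ** jacobian S (at x))"
      by (rule form(2)[OF _ _ x])
    have "frechet_derivative h (at x) (\<eta> x) = jacobian h (at x) *v \<eta> x"
      using frechet_derivative_at[OF has_derivative_jacobian[OF smooth_on_differentiable[OF hsm x]]] by metis
    also have "\<dots> = u x *\<^sub>R (jacobian T (at (?M (S x))) *v (jacobian ?M (at (S x)) *v (jacobian S (at x) *v v x)))"
      unfolding Jh \<eta>_def by (simp add: matrix_vector_mul_assoc matrix_vector_mult_scaleR matrix_mul_assoc)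
    also have "\<dots> = (u x * morin_poly 1 (S x)) *\<^sub>R (jacobian T (at (?M (S x))) *v axis ?c 1)"
      unfolding JSv[OF x] JM by (simp add: matrix_vector_mult_scaleR)
    finally show ?thesis
      using form(3)[OF _ _ x]
      by (simp add: u_def q_def matrix_vector_mult_basis column_def jacobian_nth[OF dT] del: One_nat_def)
  qed
  have jsm: "sm X (jac_det k)" if k: "smooth_on X k" for k :: "(real, 'n) vec \<Rightarrow> (real, 'n) vec"
  proof -
    have "sm X (\<lambda>x. jacobian k (at x) $ i $ j)" for i j
      using sm_cong[OF X(1), of "\<lambda>x. jacobian k (at x) $ i $ j" "pdv j (\<lambda>x. k x $ i)"]
        jacobian_nth[OF smooth_on_differentiable[OF k]] sm_pdv[OF smooth_on_nth[OF X(1) k]] by simp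
    then show ?thesis unfolding jac_det_def[abs_def] by (rule sm_det[OF X(1)])
  qed
  have smg: "sm X (\<lambda>x. g x $ i)" and smh: "sm X (\<lambda>x. h x $ i)" for i
    by (rule smooth_on_nth[OF X(1) gsm] smooth_on_nth[OF X(1) hsm])+
  \<comment> \<open>Equality of r-jets with r \<ge> n + 1 is contact of order n + 2, hence n + 1 for
    first derivatives and for Jacobian determinants. After n more derivatives order 1 is left, after
    n - 1 order 2, as value and gradients require.\<close>
  have Z: "Zo (?n + 2) (\<lambda>x. g x $ i - h x $ i)" for i
  proof (rule Zo_mono)
    show "Zo (Suc r) (\<lambda>x. g x $ i - h x $ i)"
    proof (rule Zo_of_partials_eq[OF X gsm hsm])
      fix js :: "'n list" assume "length js < Suc r"
      then show "partials js g 0 = partials js h 0" using fun_cong[OF jets, of js] by (simp add: jet_def)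
    qed
  qed (use r in simp)
  have Zp: "Zo (?n + 1) (\<lambda>x. pdv k (\<lambda>x. g x $ i) x - pdv k (\<lambda>x. h x $ i) x)" for k i
  proof -
    have "Zo (?n + 1) (pdv k (\<lambda>x. g x $ i - h x $ i))" using Z[of i] by simp
    then show ?thesis
      by (subst Zo_cong[OF X, of _ "pdv k (\<lambda>x. g x $ i - h x $ i)"])
        (auto simp: pdv_diff sm_differentiable[OF smg] sm_differentiable[OF smh])
  qed
  have Zj: "Zo (?n + 1) (\<lambda>x. jac_det g x - jac_det h x)"
  proof -
    have eq: "jacobian k (at x) = (\<chi> i j. pdv j (\<lambda>x. k x $ i) x)" if "smooth_on X k" "x \<in> X"
      for k :: "(real, 'n) vec \<Rightarrow> (real, 'n) vec" and x
      using jacobian_nth[OF smooth_on_differentiable[OF that]] by (simp add: vec_eq_iff)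
    have "Zo (?n + 1) (\<lambda>x. det (\<chi> i j. pdv j (\<lambda>x. g x $ i) x) - det (\<chi> i j. pdv j (\<lambda>x. h x $ i) x))"
      by (rule Zo_diff_det[OF X]) (simp_all add: sm_pdv smg smh Zp del: Zo.simps add_Suc_right One_nat_def)
    then show ?thesis
      by (subst Zo_cong[OF X, of _ "\<lambda>x. det (\<chi> i j. pdv j (\<lambda>x. g x $ i) x) - det (\<chi> i j. pdv j (\<lambda>x. h x $ i) x)"])
        (simp_all add: jac_det_def eq gsm hsm)
  qed
  have eta0: "\<eta> 0 \<noteq> 0"
  proof
    assume "\<eta> 0 = 0"
    moreover have "u 0 \<noteq> 0"
      using diffeo_germ_det[OF S] diffeo_germ_det[OF T] by (simp add: u_def S1(5) morin_at_0)
    ultimately have "v 0 = 0" by (simp add: \<eta>_def)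
    then show False using JSv[OF X(2)] by (simp add: axis_eq_0_iff)
  qed
  have hn: "\<exists>j w. sm X j \<and> (\<forall>x\<in>X. jac_det h x = 0 \<longrightarrow> j x = 0) \<and> sm X w \<and> Zo ?n w \<and>
      (\<forall>x\<in>X. frechet_derivative h (at x) (\<eta> x) $ i = j x + w x)" for i
  proof (intro exI conjI ballI impI)
    show "sm X (\<lambda>x. jac_det h x * q i x)" by (intro sm_mult X(1) jsm hsm smq)
    show "frechet_derivative h (at x) (\<eta> x) $ i = jac_det h x * q i x + 0" if "x \<in> X" for x
      using dh[OF that] by simp
  qed (simp_all add: sm_const Zo_zero)
  have gn: "\<exists>j w. sm X j \<and> (\<forall>x\<in>X. jac_det g x = 0 \<longrightarrow> j x = 0) \<and> sm X w \<and> Zo ?n w \<and>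
      (\<forall>x\<in>X. frechet_derivative g (at x) (\<eta> x) $ i = j x + w x)" for i
  proof (intro exI conjI ballI impI)
    \<comment> \<open>The sum is the error of replacing dh by dg, the other term that of replacing
      the determinant of h by that of g in dh(\<eta>) = \<open>jac_det h\<close> q. Both have order
      n + 1.\<close>
    let ?w = "\<lambda>x. (\<Sum>k\<in>UNIV. \<eta> x $ k * (pdv k (\<lambda>x. g x $ i) x - pdv k (\<lambda>x. h x $ i) x))
      - q i x * (jac_det g x - jac_det h x)"
    show "sm X (\<lambda>x. jac_det g x * q i x)" by (intro sm_mult X(1) jsm gsm smq)
    have s1: "sm X (\<lambda>x. \<Sum>k\<in>UNIV. \<eta> x $ k * (pdv k (\<lambda>x. g x $ i) x - pdv k (\<lambda>x. h x $ i) x))"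
      by (intro sm_sum sm_mult sm_diff X(1) smeta sm_pdv smg smh)
    have s2: "sm X (\<lambda>x. (- q i x) * (jac_det g x - jac_det h x))"
      using sm_mult[OF X(1) sm_diff[OF X(1) sm_const[of _ 0] smq[of i]] sm_diff[OF X(1) jsm[OF gsm] jsm[OF hsm]]] by simp
    show "sm X ?w" using sm_add[OF X(1) s1 s2] by simp
    have "Zo (?n + 1) (\<lambda>x. (\<Sum>k\<in>UNIV. \<eta> x $ k * (pdv k (\<lambda>x. g x $ i) x - pdv k (\<lambda>x. h x $ i) x)) +
      (- q i x) * (jac_det g x - jac_det h x))"
    proof (rule Zo_add[OF X s1 s2])
      show "Zo (?n + 1) (\<lambda>x. \<Sum>k\<in>UNIV. \<eta> x $ k * (pdv k (\<lambda>x. g x $ i) x - pdv k (\<lambda>x. h x $ i) x))"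
        by (intro Zo_sum[OF X] Zo_mult[OF X] sm_mult sm_diff X(1) smeta sm_pdv smg smh Zp)
      show "Zo (?n + 1) (\<lambda>x. (- q i x) * (jac_det g x - jac_det h x))"
        using Zo_mult[OF X sm_diff[OF X(1) sm_const[of _ 0] smq[of i]] sm_diff[OF X(1) jsm[OF gsm] jsm[OF hsm]] Zj] by simp
    qed
    moreover have "(\<lambda>x. (\<Sum>k\<in>UNIV. \<eta> x $ k * (pdv k (\<lambda>x. g x $ i) x - pdv k (\<lambda>x. h x $ i) x)) +
      (- q i x) * (jac_det g x - jac_det h x)) = ?w" by (simp add: fun_eq_iff)
    ultimately have "Zo (?n + 1) ?w" by (simp only:)
    then show "Zo ?n ?w" by (rule Zo_mono) simp
    fix x assume x: "x \<in> X"
    have "frechet_derivative k (at x) (\<eta> x) $ i = (\<Sum>l\<in>UNIV. \<eta> x $ l * pdv l (\<lambda>x. k x $ i) x)"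
      if k: "smooth_on X k" for k :: "(real, 'n) vec \<Rightarrow> (real, 'n) vec"
      by (simp add: frechet_vec_nth[OF smooth_on_differentiable[OF k x]]
          frechet_pdv[OF sm_differentiable[OF smooth_on_nth[OF X(1) k] x]])
    from this[OF gsm] this[OF hsm] dh[OF x, of i]
    show "frechet_derivative g (at x) (\<eta> x) $ i = jac_det g x * q i x + ?w x"
      by (simp add: sum_subtractf right_diff_distrib algebra_simps)
  qed simp
  interpret smooth_field X \<eta> by unfold_locales (use X smeta in auto)
  have Zk: "Zo m (\<lambda>x. (along \<eta> ^^ k) (jac_det g) x - (along \<eta> ^^ k) (jac_det h) x)" if "m + k \<le> ?n + 1" for m k
    by (rule Zo_along_iter_diff[OF jsm[OF gsm] jsm[OF hsm] Zo_mono[OF Zj that]])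
  have A: "(along \<eta> ^^ ?n) (jac_det g) 0 = (along \<eta> ^^ ?n) (jac_det h) 0"
    using Zk[of 1 ?n] by simp
  have G: "grad_det \<eta> (jac_det g) 0 = grad_det \<eta> (jac_det h) 0"
  proof -
    have "grad ((along \<eta> ^^ (pos j - 1)) (jac_det g)) 0 $ i = grad ((along \<eta> ^^ (pos j - 1)) (jac_det h)) 0 $ i" for i and j :: 'n
    proof -
      have "Zo (Suc (Suc 0)) (\<lambda>x. (along \<eta> ^^ (pos j - 1)) (jac_det g) x - (along \<eta> ^^ (pos j - 1)) (jac_det h) x)"
        by (rule Zk) (use pos_range[of j] in linarith)
      then have "pdv i (\<lambda>x. (along \<eta> ^^ (pos j - 1)) (jac_det g) x - (along \<eta> ^^ (pos j - 1)) (jac_det h) x) 0 = 0"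
        by simp
      then show ?thesis
        unfolding grad_nth
        by (subst (asm) pdv_diff) (auto intro!: sm_differentiable[OF _ X(2)] sm_along_iter jsm gsm hsm)
    qed
    then show ?thesis unfolding grad_det_def by simp
  qed
  have hr: "\<forall>\<^sub>F x in nhds 0. h x = T (?M (S x))" "\<forall>\<^sub>F x in nhds 0. g x = E2 (?M (E1 x))"
    using h g by simp_all
  \<comment> \<open>One field \<eta> serves both factorizations, so the two quantities agree; each
    factorization brings its own sign \<beta>, and the common (-1)^(n-1) cancels.\<close>
  show ?thesis
    by (rule morin_invariants[OF S T hr(1) X etasm eta0 hn], rule morin_invariants[OF E hr(2) X etasm eta0 gn],
        rule that) (use A G in \<open>simp_all add: mult.assoc\<close>)
qed

text \<open>Composing with s and t of positive determinant keeps the signs of the first model. Since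
  nothing relates \<beta> to \<beta>', the two equations separate models only through the parities
  of their exponents.\<close>

lemma A_isotopic_models:
  assumes iso: "A_isotopic r (morin_model \<sigma> \<tau> :: real^'n::{finite,linorder} \<Rightarrow> (real, 'n) vec) (morin_model \<sigma>' \<tau>')"
    and r: "CARD('n) + 1 \<le> r"
    and s: "\<sigma> \<in> {1, -1}" "\<tau> \<in> {1, -1}" "\<sigma>' \<in> {1, -1}" "\<tau>' \<in> {1, -1}"
    and n: "2 \<le> CARD('n) \<or> \<sigma> = 1 \<and> \<sigma>' = 1"
  obtains \<beta> \<beta>' where "\<beta> \<in> {1, -1}" "\<beta>' \<in> {1, -1}"
    "\<tau> * \<sigma> * \<beta> ^ CARD('n) = \<tau>' * \<sigma>' * \<beta>' ^ CARD('n)"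
    "\<sigma> * (\<tau> * \<sigma>) ^ CARD('n) * \<beta> ^ (\<Sum>k<CARD('n). k) = \<sigma>' * (\<tau>' * \<sigma>') ^ CARD('n) * \<beta>' ^ (\<Sum>k<CARD('n). k)"
proof -
  let ?M = "morin_normal :: (real, 'n) vec \<Rightarrow> (real, 'n) vec"
  let ?E = "\<lambda>k e. sign_at k e :: ((real, 'n) vec, 'n) vec"
  obtain s t where st: "diffeo_germ s" "det (jacobian s (at 0)) > 0"
    "diffeo_germ t" "det (jacobian t (at 0)) > 0"
    "jet r (morin_model \<sigma>' \<tau>') = jet r (\<lambda>x. t (morin_model \<sigma> \<tau> (s x)) :: (real, 'n) vec)"
    using A_isotopicD[OF iso] r by auto
  have d: "det (?E 2 \<sigma>) = \<sigma>" "det (?E 2 \<sigma>') = \<sigma>'" "det (?E 1 \<tau>) = \<tau>" "det (?E 1 \<tau>') = \<tau>'"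
    using n by (auto intro!: det_sign_at_2 det_sign_at_1 simp del: One_nat_def)
  have E: "diffeo_germ (\<lambda>x. ?E 2 \<sigma> *v x)" "diffeo_germ (\<lambda>x. ?E 2 \<sigma>' *v x)"
    "diffeo_germ (\<lambda>x. ?E 1 \<tau> *v x)" "diffeo_germ (\<lambda>x. ?E 1 \<tau>' *v x)"
    by (rule diffeo_germ_linear, use d s in force)+
  have sg: "sgn x = x" if "x \<in> {1, -1}" for x :: real using that by auto
  have sm: "smooth_on UNIV (\<lambda>x. ?E 1 \<tau>' *v ?M (?E 2 \<sigma>' *v x))"
    by (rule smooth_on_compose[OF open_UNIV open_UNIV
          smooth_on_compose[OF open_UNIV open_UNIV smooth_on_linear smooth_on_morin] smooth_on_linear]) auto
  have jets: "jet r (\<lambda>x. ?E 1 \<tau>' *v ?M (?E 2 \<sigma>' *v x)) = jet r (\<lambda>x. t (?E 1 \<tau> *v ?M (?E 2 \<sigma> *v s x)))"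
    using st(5) by (simp only: morin_model_def[abs_def])
  have sgns: "sgn (det (jacobian (\<lambda>x. t (?E 1 \<tau> *v x)) (at 0))) = \<tau>"
    "sgn (det (jacobian (\<lambda>x. ?E 2 \<sigma> *v s x) (at 0))) = \<sigma>"
    using diffeo_germ_compose_det[OF E(3) st(3)] diffeo_germ_compose_det[OF st(1) E(1)] st(2,4) s sg d
    by (simp_all add: jacobian_linear sgn_mult)
  have sgns': "sgn (det (?E 1 \<tau>')) = \<tau>'" "sgn (det (?E 2 \<sigma>')) = \<sigma>'" using s sg d by simp_all
  show ?thesis
    by (rule invariants_of_equal_jets[OF diffeo_germ_compose[OF st(1) E(1)] diffeo_germ_compose[OF E(3) st(3)]
        refl E(2) E(4) refl jets r sm, unfolded sgns jacobian_linear sgns']) (rule that)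
qed

section \<open>Parities of the exponents\<close>

lemma sign_power: "b \<in> {1, -1 :: real} \<Longrightarrow> b ^ k = (if even k then 1 else b)"
  by auto

lemma sum_lessThan_double: "2 * (\<Sum>k<n. k) = n * (n - 1 :: nat)"
  by (induction n) (auto simp: algebra_simps)

text \<open>The exponent of \<beta> in the determinant of the gradients is n(n-1)/2.\<close>

lemma sum_lessThan_parity:
  fixes n l :: nat
  shows
  "n = 4 * l \<Longrightarrow> even (\<Sum>k<n. k)" "n = 4 * l + 1 \<Longrightarrow> even (\<Sum>k<n. k)"
  "n = 4 * l + 2 \<Longrightarrow> odd (\<Sum>k<n. k)" "n = 4 * l + 3 \<Longrightarrow> odd (\<Sum>k<n. k)"
proof -
  have *: "(\<Sum>k<n. k) = m" if "n * (n - 1) = 2 * m" for m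
    using sum_lessThan_double[of n] that by simp
  show "even (\<Sum>k<n. k)" if "n = 4 * l"
  proof -
    have eq: "(\<Sum>k<n. k) = 2 * (l * (4 * l - 1))" by (rule *) (simp add: that algebra_simps)
    show ?thesis unfolding eq by simp
  qed
  show "even (\<Sum>k<n. k)" if "n = 4 * l + 1"
  proof -
    have eq: "(\<Sum>k<n. k) = 2 * ((4 * l + 1) * l)" by (rule *) (simp add: that algebra_simps)
    show ?thesis unfolding eq by simp
  qed
  show "odd (\<Sum>k<n. k)" if "n = 4 * l + 2"
  proof -
    have eq: "(\<Sum>k<n. k) = (2 * l + 1) * (4 * l + 1)" by (rule *) (simp add: that algebra_simps)
    show ?thesis unfolding eq by simp
  qed
  show "odd (\<Sum>k<n. k)" if "n = 4 * l + 3"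
  proof -
    have eq: "(\<Sum>k<n. k) = (4 * l + 3) * (2 * l + 1)" by (rule *) (simp add: that algebra_simps)
    show ?thesis unfolding eq by simp
  qed
qed

text \<open>The exponent n(n+1)/2 is the one in the determinants of the symmetry.\<close>

lemma triangle_parity:
  fixes n l :: nat
  shows
  "n = 4 * l + 1 \<Longrightarrow> odd (n * (n + 1) div 2)"
  "n = 4 * l + 2 \<Longrightarrow> odd (n * (n + 1) div 2)"
  "n = 4 * l + 3 \<Longrightarrow> even (n * (n + 1) div 2)"
proof -
  have *: "n * (n + 1) div 2 = m" if "n * (n + 1) = 2 * m" for m
    using that by simp
  show "odd (n * (n + 1) div 2)" if "n = 4 * l + 1"
    using *[of "(4 * l + 1) * (2 * l + 1)"] that by (simp add: algebra_simps)
  show "odd (n * (n + 1) div 2)" if "n = 4 * l + 2"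
    using *[of "(2 * l + 1) * (4 * l + 3)"] that by (simp add: algebra_simps)
  show "even (n * (n + 1) div 2)" if "n = 4 * l + 3"
    using *[of "2 * ((4 * l + 3) * (l + 1))"] that by (simp add: algebra_simps)
qed

text \<open>For these n the flip reverses \<sigma>; \<tau> may change with it, so it is only claimed
  to be some sign.\<close>

lemma Morin_singularity_source_sign:
  fixes f :: "real^'n::{finite,linorder} \<Rightarrow> (real, 'n) vec"
  assumes "Morin_singularity CARD('n) f" "CARD('n) = 4 * l + 1 \<or> CARD('n) = 4 * l + 2"
  obtains \<tau> where "\<tau> \<in> {1, -1}" "morin_type 1 \<tau> f"
proof -
  obtain \<sigma> \<tau> where st: "\<sigma> \<in> {1, -1}" "\<tau> \<in> {1, -1}" "morin_type \<sigma> \<tau> f"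
    by (rule Morin_singularity_type[OF assms(1)])
  show ?thesis
  proof (cases "\<sigma> = 1")
    case True
    then show ?thesis using that st by blast
  next
    case False
    then have "\<sigma> = -1" using st by simp
    moreover have "odd (CARD('n) * (CARD('n) + 1) div 2)"
      using triangle_parity(1,2)[of "CARD('n)" l] assms(2) by blast
    ultimately have "morin_type 1 ((-1) ^ (CARD('n) * (CARD('n) + 1) div 2 + CARD('n)) * \<tau>) f"
      using morin_type_flip[OF st(3)] by simp
    moreover have "(-1) ^ k * \<tau> \<in> {1, -1}" for k using st(2) by (cases "even k") auto
    ultimately show ?thesis using that by blast
  qed
qed

text \<open>Here n(n+1)/2 is even and n is odd, so the flip reverses \<tau> and keeps
  \<sigma>.\<close>

lemma Morin_singularity_target_sign:
  fixes f :: "real^'n::{finite,linorder} \<Rightarrow> (real, 'n) vec"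
  assumes "Morin_singularity CARD('n) f" "CARD('n) = 4 * l + 3"
  obtains \<sigma> where "\<sigma> \<in> {1, -1}" "morin_type \<sigma> 1 f"
proof -
  obtain \<sigma> \<tau> where st: "\<sigma> \<in> {1, -1}" "\<tau> \<in> {1, -1}" "morin_type \<sigma> \<tau> f"
    by (rule Morin_singularity_type[OF assms(1)])
  show ?thesis
  proof (cases "\<tau> = 1")
    case True
    then show ?thesis using that st by blast
  next
    case False
    then have "\<tau> = -1" using st by simp
    moreover have "even (CARD('n) * (CARD('n) + 1) div 2)" "odd CARD('n)"
      using triangle_parity(3)[OF assms(2)] assms(2) by auto
    ultimately have "morin_type \<sigma> 1 f"
      using morin_type_flip[OF st(3)] by simp
    then show ?thesis using that st by blast
  qed
qed

lemma morin_sgn_model: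
  "2 \<le> CARD('n) \<Longrightarrow> morin_sgn CARD('n) e1 e2 =
    (morin_model e2 e1 :: real^'n::{finite,linorder} \<Rightarrow> (real, 'n) vec)"
  using morin_sgn_eq[where 'n='n] by (simp add: fun_eq_iff morin_model_def)

lemma fold_sgn_model:
  "CARD('n) = 1 \<Longrightarrow> fold_sgn e1 =
    (morin_model 1 e1 :: real^'n::{finite,linorder} \<Rightarrow> (real, 'n) vec)"
  using fold_sgn_eq[where 'n='n] by (simp add: fun_eq_iff morin_model_def sign_at_1)

text \<open>For \<open>n = 1\<close> the Jacobian determinant is \<open>f'\<close>, so second derivatives of \<open>f\<close> are first derivatives of it.\<close>

lemma fold_second_derivative:
  fixes f \<eta> :: "real^'n::{finite,linorder} \<Rightarrow> (real, 'n) vec"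
  assumes n: "CARD('n) = 1" and X: "open X" "0 \<in> X" and f: "smooth_on X f" and \<eta>: "smooth_on X \<eta>" "\<eta> 0 \<noteq> 0"
    and 0: "jac_det f 0 = 0"
  shows "sgn ((along \<eta> ^^ 2) f 0 $ coord 1) = sgn (grad_det \<eta> (jac_det f) 0)"
    and "sgn (partials [coord 1, coord 1] f 0 $ coord 1) = sgn (grad_det \<eta> (jac_det f) 0)"
proof -
  let ?c = "coord 1 :: 'n"
  have all: "i = ?c" for i :: 'n
    using pos_range[of i] n coord_pos[of i] by (metis le_antisym)
  have U: "UNIV = {?c}" using all by auto
  have d1: "det A = A $ ?c $ ?c" for A :: "((real, 'n) vec, 'n) vec"
  proof -
    have "det A = (\<Prod>i\<in>UNIV. A $ i $ i)" by (rule det_diagonal) (metis all)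
    then show ?thesis unfolding U by simp
  qed
  have pc: "pos ?c = 1" using n by (intro pos_coord) auto
  have smf: "sm X (\<lambda>x. f x $ i)" and sme: "sm X (\<lambda>x. \<eta> x $ i)" for i
    by (rule smooth_on_nth[OF X(1) f] smooth_on_nth[OF X(1) \<eta>(1)])+
  have df: "f differentiable (at x)" if "x \<in> X" for x by (rule smooth_on_differentiable[OF f that])
  define L where "L = pdv ?c (\<lambda>x. f x $ ?c)"
  have smL: "sm X L" unfolding L_def by (rule sm_pdv[OF smf])
  have jL: "jac_det f x = L x" if "x \<in> X" for x
    unfolding jac_det_def d1 jacobian_nth[OF df[OF that]] L_def ..
  have G: "grad_det \<eta> (jac_det f) 0 = pdv ?c L 0"
    unfolding grad_det_def d1 using pdv_cong_open[OF X jL, where i = ?c] pc by (simp add: grad_nth)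
  have P: "partials [?c] f x $ ?c = L x" if "x \<in> X" for x
    unfolding L_def by (rule partials_single_nth[OF df[OF that]])
  have "partials [?c, ?c] f 0 $ ?c = frechet_derivative (\<lambda>x. partials [?c] f x) (at 0) (axis ?c 1) $ ?c" by simp
  also have "\<dots> = pdv ?c (\<lambda>x. partials [?c] f x $ ?c) 0"
    unfolding pdv_def
  proof (rule frechet_vec_nth)
    show "(\<lambda>x. partials [?c] f x) differentiable (at 0)"
      using f X(2) unfolding smooth_on_def by blast
  qed
  also have "\<dots> = pdv ?c L 0" by (rule pdv_cong_open[OF X P])
  finally show "sgn (partials [?c, ?c] f 0 $ ?c) = sgn (grad_det \<eta> (jac_det f) 0)" using G by simp
  have al: "along \<eta> f x $ ?c = \<eta> x $ ?c * L x" if "x \<in> X" for x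
    using sm_differentiable[OF smf that]
    by (simp add: along_def frechet_vec_nth[OF df[OF that]] frechet_pdv U L_def)
  have smal: "sm X (\<lambda>x. along \<eta> f x $ i)" for i
  proof -
    have "sm X (\<lambda>x. along \<eta> f x $ ?c)"
      using sm_cong[OF X(1), of "\<lambda>x. along \<eta> f x $ ?c" "\<lambda>x. \<eta> x $ ?c * L x"] al
        sm_mult[OF X(1) sme[of ?c] smL] by simp
    then show ?thesis using all[of i] by metis
  qed
  have "(along \<eta> ^^ 2) f 0 $ ?c = frechet_derivative (along \<eta> f) (at 0) (\<eta> 0) $ ?c"
    by (simp add: along_def numeral_2_eq_2)
  also have "\<dots> = frechet_derivative (\<lambda>x. along \<eta> f x $ ?c) (at 0) (\<eta> 0)"
    by (rule frechet_vec_nth[OF smooth_on_differentiable[OF smooth_onI_nth[OF X(1) smal] X(2)]])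
  also have "\<dots> = \<eta> 0 $ ?c * pdv ?c (\<lambda>x. along \<eta> f x $ ?c) 0"
    by (simp add: frechet_pdv[OF sm_differentiable[OF smal X(2)]] U)
  also have "pdv ?c (\<lambda>x. along \<eta> f x $ ?c) 0 = pdv ?c (\<lambda>x. \<eta> x $ ?c * L x) 0"
    by (rule pdv_cong_open[OF X al])
  \<comment> \<open>The derivative of the field is multiplied by L(0) = f'(0) = 0, so the field
    enters the result through the square of its value at 0 only.\<close>
  also have "\<dots> = \<eta> 0 $ ?c * pdv ?c L 0"
    using 0 jL[OF X(2)] by (simp add: pdv_mult sm_differentiable[OF sme X(2)] sm_differentiable[OF smL X(2)])
  finally have "(along \<eta> ^^ 2) f 0 $ ?c = (\<eta> 0 $ ?c)\<^sup>2 * pdv ?c L 0" by (simp add: power2_eq_square)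
  moreover have "\<eta> 0 $ ?c \<noteq> 0" using \<eta>(2) all by (metis vec_eq_iff zero_index)
  then have "sgn ((\<eta> 0 $ ?c)\<^sup>2) = 1" by (intro sgn_pos) simp
  ultimately show "sgn ((along \<eta> ^^ 2) f 0 $ ?c) = sgn (grad_det \<eta> (jac_det f) 0)"
    using G by (simp only: sgn_mult mult_1)
qed

theorem mainTheorem2:
  fixes f \<eta> :: "real^'n::{finite,linorder} \<Rightarrow> real^'n::{finite,linorder}" and r :: nat
  assumes "Morin_singularity CARD('n) f"
    and "null_vector_field f \<eta>"
    and "CARD('n) + 1 \<le> r"
  shows
    "(CARD('n) = 1 \<longrightarrow>
       (\<exists>\<epsilon>1\<in>{1, -1}.
          \<epsilon>1 = sgn ((along \<eta> ^^ 2) f 0 $ coord 1) \<and>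
          \<epsilon>1 = sgn (partials [coord 1, coord 1] f 0 $ coord 1) \<and>
          A_isotopic r f (fold_sgn \<epsilon>1)) \<and>
       \<not> A_isotopic r (fold_sgn 1 :: real^'n::{finite,linorder} \<Rightarrow> _) (fold_sgn (-1))) \<and>
     ((\<exists>l\<ge>1. CARD('n) = 4 * l) \<longrightarrow>
       (\<exists>\<epsilon>1\<in>{1, -1}. \<exists>\<epsilon>2\<in>{1, -1}.
          sgn ((along \<eta> ^^ CARD('n)) (jac_det f) 0) = \<epsilon>1 * \<epsilon>2 \<and>
          sgn (grad_det \<eta> (jac_det f) 0) = - \<epsilon>2 \<and>
          A_isotopic r f (morin_sgn CARD('n) \<epsilon>1 \<epsilon>2)) \<and>
       (\<forall>\<epsilon>1\<in>{1, -1}. \<forall>\<epsilon>2\<in>{1, -1}. \<forall>\<delta>1\<in>{1, -1}. \<forall>\<delta>2\<in>{1, -1}.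
          (\<epsilon>1, \<epsilon>2) \<noteq> (\<delta>1, \<delta>2) \<longrightarrow>
          \<not> A_isotopic r (morin_sgn CARD('n) \<epsilon>1 \<epsilon>2 :: real^'n::{finite,linorder} \<Rightarrow> _)
                         (morin_sgn CARD('n) \<delta>1 \<delta>2))) \<and>
     ((\<exists>l\<ge>1. CARD('n) = 4 * l + 1) \<longrightarrow>
       (\<exists>\<epsilon>1\<in>{1, -1}.
          \<epsilon>1 = sgn (grad_det \<eta> (jac_det f) 0) \<and>
          A_isotopic r f (morin_sgn CARD('n) \<epsilon>1 1)) \<and>
       \<not> A_isotopic r (morin_sgn CARD('n) 1 1 :: real^'n::{finite,linorder} \<Rightarrow> _)
                      (morin_sgn CARD('n) (-1) 1)) \<and>
     ((\<exists>l\<ge>0. CARD('n) = 4 * l + 2) \<longrightarrow>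
       (\<exists>\<epsilon>1\<in>{1, -1}.
          \<epsilon>1 = sgn ((along \<eta> ^^ CARD('n)) (jac_det f) 0) \<and>
          A_isotopic r f (morin_sgn CARD('n) \<epsilon>1 1)) \<and>
       \<not> A_isotopic r (morin_sgn CARD('n) 1 1 :: real^'n::{finite,linorder} \<Rightarrow> _)
                      (morin_sgn CARD('n) (-1) 1)) \<and>
     ((\<exists>l\<ge>0. CARD('n) = 4 * l + 3) \<longrightarrow>
       (\<exists>\<epsilon>2\<in>{1, -1}.
          \<epsilon>2 = sgn ((along \<eta> ^^ CARD('n)) (jac_det f) 0 * grad_det \<eta> (jac_det f) 0) \<and>
          A_isotopic r f (morin_sgn CARD('n) 1 \<epsilon>2)) \<and>
       \<not> A_isotopic r (morin_sgn CARD('n) 1 1 :: real^'n::{finite,linorder} \<Rightarrow> _)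
                      (morin_sgn CARD('n) 1 (-1)))"
proof -
  let ?n = "CARD('n)"
  let ?A = "sgn ((along \<eta> ^^ ?n) (jac_det f) 0)" and ?G = "sgn (grad_det \<eta> (jac_det f) 0)"
  note inv = null_field_invariants[OF _ assms(2)]
  note iso = A_isotopic_models[OF _ assms(3)]
  \<comment> \<open>Common to (a) and (c). With \<sigma> = 1, n odd and n(n-1)/2 even, \<beta>
    cancels and the determinant has the sign \<tau>^n = \<tau>.\<close>
  have one: "\<exists>\<epsilon>1\<in>{1, -1}. \<epsilon>1 = ?G \<and> A_isotopic r f (morin_model 1 \<epsilon>1)" if l: "?n = 4 * l + 1" for l
  proof -
    obtain \<tau> where t: "\<tau> \<in> {1, -1}" "morin_type 1 \<tau> f"
      using Morin_singularity_source_sign[OF assms(1)] l by blast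
    obtain \<beta> where b: "\<beta> \<in> {1, -1}" "?G = (-1) ^ (?n - 1) * 1 * (\<tau> * 1) ^ ?n * \<beta> ^ (\<Sum>k<?n. k)"
      by (rule inv[OF t(2)])
    have "odd ?n" "even (?n - 1)" using l by auto
    then have "?G = \<tau>"
      using b(2) sum_lessThan_parity(2)[OF l] by (simp add: sign_power[OF b(1)] sign_power[OF t(1)])
    then show ?thesis using A_isotopic_model[OF t(2) _ t(1)] t(1) by blast
  qed
  \<comment> \<open>\<beta> and \<beta>' have an even exponent, and an isotopy would give 1 = (-1)^n
    with n odd.\<close>
  have not_one: "\<not> A_isotopic r (morin_model 1 1 :: (real, 'n) vec \<Rightarrow> _) (morin_model 1 (-1))"
    if l: "?n = 4 * l + 1" for l
  proof
    assume "A_isotopic r (morin_model 1 1 :: (real, 'n) vec \<Rightarrow> _) (morin_model 1 (-1))"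
    then obtain \<beta> \<beta>' :: real where b: "\<beta> \<in> {1, -1}" "\<beta>' \<in> {1, -1}"
      "1 * (1 * 1) ^ ?n * \<beta> ^ (\<Sum>k<?n. k) = 1 * (-1 * 1) ^ ?n * \<beta>' ^ (\<Sum>k<?n. k)"
      by (rule iso) auto
    moreover have "odd ?n" using l by simp
    ultimately show False
      using sum_lessThan_parity(2)[OF l] by (simp add: sign_power[OF b(1)] sign_power[OF b(2)])
  qed
  have a: "(\<exists>\<epsilon>1\<in>{1, -1}. \<epsilon>1 = sgn ((along \<eta> ^^ 2) f 0 $ coord 1) \<and>
      \<epsilon>1 = sgn (partials [coord 1, coord 1] f 0 $ coord 1) \<and> A_isotopic r f (fold_sgn \<epsilon>1)) \<and>
      \<not> A_isotopic r (fold_sgn 1 :: (real, 'n) vec \<Rightarrow> _) (fold_sgn (-1))" if n: "?n = 1"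
  proof -
    obtain \<sigma> \<tau> where "morin_type \<sigma> \<tau> f" using Morin_singularity_type[OF assms(1)] by blast
    from inv[OF this] obtain X where X: "open X" "0 \<in> X" "smooth_on X f" "smooth_on X \<eta>" "\<eta> 0 \<noteq> 0"
      and "jac_det f 0 = 0" by blast
    note d = fold_second_derivative[OF n this]
    show ?thesis
      using one[of 0] not_one[of 0] n unfolding fold_sgn_model[OF n] d by simp
  qed
  \<comment> \<open>Both n and n(n-1)/2 are even, so the two signs are \<tau> \<sigma> and
    -\<sigma>, with the minus sign from (-1)^(n-1). They determine \<sigma> and \<tau>.\<close>
  have b: "(\<exists>\<epsilon>1\<in>{1, -1}. \<exists>\<epsilon>2\<in>{1, -1}. ?A = \<epsilon>1 * \<epsilon>2 \<and> ?G = - \<epsilon>2 \<and> A_isotopic r f (morin_sgn ?n \<epsilon>1 \<epsilon>2)) \<and>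
       (\<forall>\<epsilon>1\<in>{1, -1}. \<forall>\<epsilon>2\<in>{1, -1}. \<forall>\<delta>1\<in>{1, -1}. \<forall>\<delta>2\<in>{1, -1}.
          (\<epsilon>1, \<epsilon>2) \<noteq> (\<delta>1, \<delta>2) \<longrightarrow>
          \<not> A_isotopic r (morin_sgn ?n \<epsilon>1 \<epsilon>2 :: (real, 'n) vec \<Rightarrow> _) (morin_sgn ?n \<delta>1 \<delta>2))"
    if l: "l \<ge> 1" "?n = 4 * l" for l
  proof (intro conjI ballI impI)
    have n2: "2 \<le> ?n" using l by linarith
    obtain \<sigma> \<tau> where st: "\<sigma> \<in> {1, -1}" "\<tau> \<in> {1, -1}" "morin_type \<sigma> \<tau> f"
      by (rule Morin_singularity_type[OF assms(1)])
    obtain \<beta> where b: "\<beta> \<in> {1, -1}" "?A = \<tau> * \<sigma> * \<beta> ^ ?n"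
      "?G = (-1) ^ (?n - 1) * \<sigma> * (\<tau> * \<sigma>) ^ ?n * \<beta> ^ (\<Sum>k<?n. k)"
      by (rule inv[OF st(3)])
    have ts: "\<tau> * \<sigma> \<in> {1, -1}" using st by auto
    have ev: "even ?n" "odd (?n - 1)" using l by auto
    have "?A = \<tau> * \<sigma>" using b(2) ev by (simp add: sign_power[OF b(1)])
    moreover have "?G = - \<sigma>"
      using b(3) sum_lessThan_parity(1)[OF l(2)] ev by (simp add: sign_power[OF b(1)] sign_power[OF ts])
    moreover have "A_isotopic r f (morin_sgn ?n \<tau> \<sigma>)"
      unfolding morin_sgn_model[OF n2] using A_isotopic_model[OF st(3,1,2)] n2 by blast
    ultimately show "\<exists>\<epsilon>1\<in>{1, -1}. \<exists>\<epsilon>2\<in>{1, -1}. ?A = \<epsilon>1 * \<epsilon>2 \<and> ?G = - \<epsilon>2 \<and> A_isotopic r f (morin_sgn ?n \<epsilon>1 \<epsilon>2)"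
      using st(1,2) by blast
    fix e1 e2 d1 d2 :: real
    assume e: "e1 \<in> {1, -1}" "e2 \<in> {1, -1}" "d1 \<in> {1, -1}" "d2 \<in> {1, -1}" "(e1, e2) \<noteq> (d1, d2)"
    show "\<not> A_isotopic r (morin_sgn ?n e1 e2 :: (real, 'n) vec \<Rightarrow> _) (morin_sgn ?n d1 d2)"
    proof
      assume "A_isotopic r (morin_sgn ?n e1 e2 :: (real, 'n) vec \<Rightarrow> _) (morin_sgn ?n d1 d2)"
      then have "A_isotopic r (morin_model e2 e1 :: (real, 'n) vec \<Rightarrow> _) (morin_model d2 d1)"
        by (simp only: morin_sgn_model[OF n2])
      then obtain \<beta> \<beta>' :: real where b: "\<beta> \<in> {1, -1}" "\<beta>' \<in> {1, -1}"
        "e1 * e2 * \<beta> ^ ?n = d1 * d2 * \<beta>' ^ ?n"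
        "e2 * (e1 * e2) ^ ?n * \<beta> ^ (\<Sum>k<?n. k) = d2 * (d1 * d2) ^ ?n * \<beta>' ^ (\<Sum>k<?n. k)"
        by (rule iso) (use e n2 in auto)
      have "e1 * e2 \<in> {1, -1}" "d1 * d2 \<in> {1, -1}" using e by auto
      note s = sign_power[OF this(1)] sign_power[OF this(2)] sign_power[OF b(1)] sign_power[OF b(2)]
      have "e1 * e2 = d1 * d2" "e2 = d2"
        using b(3,4) sum_lessThan_parity(1)[OF l(2)] ev by (simp_all add: s)
      then show False using e by auto
    qed
  qed
  \<comment> \<open>For even n the sign of \<eta>^n \<lambda>(0) is \<tau> once \<sigma> = 1. The
    determinant has the sign -\<beta> here, which changes with the field.\<close>
  have d: "(\<exists>\<epsilon>1\<in>{1, -1}. \<epsilon>1 = ?A \<and> A_isotopic r f (morin_sgn ?n \<epsilon>1 1)) \<and>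
      \<not> A_isotopic r (morin_sgn ?n 1 1 :: (real, 'n) vec \<Rightarrow> _) (morin_sgn ?n (-1) 1)"
    if l: "?n = 4 * l + 2" for l
  proof -
    have n2: "2 \<le> ?n" using l by linarith
    obtain \<tau> where t: "\<tau> \<in> {1, -1}" "morin_type 1 \<tau> f"
      using Morin_singularity_source_sign[OF assms(1)] l by blast
    obtain \<beta> where b: "\<beta> \<in> {1, -1}" "?A = \<tau> * 1 * \<beta> ^ ?n"
      by (rule inv[OF t(2)])
    have ev: "even ?n" using l by simp
    then have "?A = \<tau>" using b(2) by (simp add: sign_power[OF b(1)])
    moreover have "A_isotopic r f (morin_model 1 \<tau>)" using A_isotopic_model[OF t(2) _ t(1)] by blast
    moreover have "\<not> A_isotopic r (morin_model 1 1 :: (real, 'n) vec \<Rightarrow> _) (morin_model 1 (-1))"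
    proof
      assume "A_isotopic r (morin_model 1 1 :: (real, 'n) vec \<Rightarrow> _) (morin_model 1 (-1))"
      then obtain \<beta> \<beta>' :: real where b: "\<beta> \<in> {1, -1}" "\<beta>' \<in> {1, -1}"
        "1 * 1 * \<beta> ^ ?n = -1 * 1 * \<beta>' ^ ?n"
        by (rule iso) auto
      then show False using ev by (simp add: sign_power[OF b(1)] sign_power[OF b(2)])
    qed
    ultimately show ?thesis unfolding morin_sgn_model[OF n2] using t(1) by blast
  qed
  \<comment> \<open>Both exponents of \<beta> are odd. With \<tau> = 1 the two signs are \<sigma>
    \<beta> and \<beta>, and only their product \<sigma> is independent of the field.\<close>
  have e: "(\<exists>\<epsilon>2\<in>{1, -1}. \<epsilon>2 = sgn ((along \<eta> ^^ ?n) (jac_det f) 0 * grad_det \<eta> (jac_det f) 0) \<and>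
        A_isotopic r f (morin_sgn ?n 1 \<epsilon>2)) \<and>
      \<not> A_isotopic r (morin_sgn ?n 1 1 :: (real, 'n) vec \<Rightarrow> _) (morin_sgn ?n 1 (-1))"
    if l: "?n = 4 * l + 3" for l
  proof -
    have n2: "2 \<le> ?n" using l by linarith
    obtain \<sigma> where s: "\<sigma> \<in> {1, -1}" "morin_type \<sigma> 1 f"
      using Morin_singularity_target_sign[OF assms(1) l] by blast
    obtain \<beta> where b: "\<beta> \<in> {1, -1}" "?A = 1 * \<sigma> * \<beta> ^ ?n"
      "?G = (-1) ^ (?n - 1) * \<sigma> * (1 * \<sigma>) ^ ?n * \<beta> ^ (\<Sum>k<?n. k)"
      by (rule inv[OF s(2)])
    have od: "odd ?n" "even (?n - 1)" using l by auto
    then have "?A * ?G = \<sigma>"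
      unfolding b(2,3) using sum_lessThan_parity(4)[OF l] s(1) b(1)
      by (auto simp: sign_power[OF b(1)])
    then have "sgn ((along \<eta> ^^ ?n) (jac_det f) 0 * grad_det \<eta> (jac_det f) 0) = \<sigma>" by (simp add: sgn_mult)
    moreover have "A_isotopic r f (morin_model \<sigma> 1)" using A_isotopic_model[OF s(2,1)] n2 by blast
    moreover have "\<not> A_isotopic r (morin_model 1 1 :: (real, 'n) vec \<Rightarrow> _) (morin_model (-1) 1)"
    proof
      assume "A_isotopic r (morin_model 1 1 :: (real, 'n) vec \<Rightarrow> _) (morin_model (-1) 1)"
      then obtain \<beta> \<beta>' :: real where b: "\<beta> \<in> {1, -1}" "\<beta>' \<in> {1, -1}"
        "1 * 1 * \<beta> ^ ?n = 1 * -1 * \<beta>' ^ ?n"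
        "1 * (1 * 1) ^ ?n * \<beta> ^ (\<Sum>k<?n. k) = -1 * (1 * -1) ^ ?n * \<beta>' ^ (\<Sum>k<?n. k)"
        by (rule iso) (use n2 in auto)
      \<comment> \<open>The two equations say \<beta> = -\<beta>' and \<beta> = \<beta>'.\<close>
      then show False
        using sum_lessThan_parity(4)[OF l] od by (auto simp: sign_power[OF b(1)] sign_power[OF b(2)])
    qed
    ultimately show ?thesis unfolding morin_sgn_model[OF n2] using s(1) by blast
  qed
  have c: "(\<exists>\<epsilon>1\<in>{1, -1}. \<epsilon>1 = ?G \<and> A_isotopic r f (morin_sgn ?n \<epsilon>1 1)) \<and>
      \<not> A_isotopic r (morin_sgn ?n 1 1 :: (real, 'n) vec \<Rightarrow> _) (morin_sgn ?n (-1) 1)"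
    if l: "l \<ge> 1" "?n = 4 * l + 1" for l
  proof -
    have n2: "2 \<le> ?n" using l by linarith
    show ?thesis unfolding morin_sgn_model[OF n2] using one[OF l(2)] not_one[OF l(2)] by blast
  qed
  show ?thesis
  proof (intro conjI)
  qed (rule impI, erule a, use b in blast, use c in blast, use d in blast, use e in blast)
qed

end
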